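(* Let $C_{\mathrm{2lvl}}>0$ be a constant, independent of the mesh size, the polynomial approximation degree and the level $k$, such that the two-level error propagation operator satisfies $\|\mathbb{E}^{\mathrm{2lvl}}_{k,m_1,m_2}v\|_{1,k}\le C_{\mathrm{2lvl}}\Sigma_k\|v\|_{1,k}$ for all $v\in V_k$, where $$\Sigma_k=\frac{p_k^{2+\mu}}{(1+m_1)^{1/2}(1+m_2)^{1/2}}.$$ Then there exist a constant $\widehat{\mathsf C}>C_{\mathrm{2lvl}}$ and an integer $\widehat{\mathsf m}_k$ independent of the mesh size, but dependent on the polynomial approximation degree, such that the error propagation operator $\mathbb{E}_{k,m_1,m_2}$ of the W-cycle multigrid method satisfies $$\|\mathbb{E}_{k,m_1,m_2}v\|_{1,k}\le \widehat{\mathsf C}\,\Sigma_k\,\|v\|_{1,k}\qquad\forall v\in V_k,$$ provided $m_1+m_2\ge\widehat{\mathsf m}_k$.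
   Context: **Meshes and spaces.** $\Omega\subset\mathbb{R}^d$, $d\in\{2,3\}$, is a polygonal/polyhedral domain. $\mathcal{T}_1$ is a quasi-uniform partition of $\Omega$ into shape-regular elements $T=\mathsf{F}_T(\widehat T)$, affine images of a reference element $\widehat T$ (open unit simplex or unit hypercube), and $\mathcal{T}_k$, $k=2,\dots,K$, is obtained from $\mathcal{T}_{k-1}$ by uniform refinement (each element split into $2^d$ elements), so the mesh size is $h_k=h_12^{1-k}$; $h_T$ is the diameter of $T$. The degrees $p_k\ge1$ satisfy $p_{k-1}\le p_k\le C_p\,p_{k-1}$ for $k=2,\dots,K$, with $C_p$ independent of the discretization parameters. $V_k=\{v\in L^2(\Omega): v\circ\mathsf F_T\in\mathbb{M}^{p_k}(\widehat T)\ \forall T\in\mathcal{T}_k\}$, where $\mathbb{M}^{p}(\widehat T)$ is the space of polynomials of total degree $\le p$ (simplex) or of degree $\le p$ in each variable (hypercube). Thus $V_1\subseteq\dots\subseteq V_K$. Throughout, $C$ denotes positive constants independent of the discretization parameters. **Jumps, averages, liftings.** $\mathcal{F}_k$ is the set of all faces (edges if $d=2$) of $\mathcal{T}_k$, $\mathcal{F}^I_k$ the interior ones. On an interior face shared by $T^\pm$ with outward normals $\mathbf n_{T^\pm}$: $[\![v]\!]=v^+\mathbf n_{T^+}+v^-\mathbf n_{T^-}$, $[\![\boldsymbol\tau]\!]=\boldsymbol\tau^+\cdot\mathbf n_{T^+}+\boldsymbol\tau^-\cdot\mathbf n_{T^-}$, $\{\!\{\boldsymbol\tau\}\!\}=\tfrac12(\boldsymbol\tau^++\boldsymbol\tau^-)$.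 On a boundary face: $[\![v]\!]=v\,\mathbf n_T$, $\{\!\{\boldsymbol\tau\}\!\}=\boldsymbol\tau$. Define $\mathcal R_k(\boldsymbol\tau)=\sum_{F\in\mathcal F_k}r_F(\boldsymbol\tau)$, $\mathcal L_k(v)=\sum_{F\in\mathcal F^I_k}l_F(v)$ with $r_F(\boldsymbol\tau),l_F(v)\in[V_k]^d$ given by $\int_\Omega r_F(\boldsymbol\tau)\cdot\boldsymbol\eta\,dx=-\int_F\boldsymbol\tau\cdot\{\!\{\boldsymbol\eta\}\!\}\,ds$, $\int_\Omega l_F(v)\cdot\boldsymbol\eta\,dx=-\int_F v[\![\boldsymbol\eta]\!]\,ds$ for all $\boldsymbol\eta\in[V_k]^d$. **Bilinear forms.** With $\nabla$ taken elementwise and $\mathcal G_k(v):=\mathcal R_k([\![v]\!])+\mathcal L_k(\boldsymbol\beta\cdot[\![v]\!])$, $$\mathcal A_k(w,v)=\int_\Omega\big(\nabla w\cdot\nabla v+\nabla w\cdot\mathcal G_k(v)+\mathcal G_k(w)\cdot\nabla v+\theta\,\mathcal G_k(w)\cdot\mathcal G_k(v)\big)dx+\sum_{F\in\mathcal F_k}\int_F\sigma_k[\![w]\!]\cdot[\![v]\!]\,ds,$$ where $\sigma_k|_F=\alpha_kp_k^2/\min(h_{T^+},h_{T^-})$ on interior faces and $\alpha_kp_k^2/h_T$ on boundary faces, $\alpha_k>0$. One of three choices is made: SIPG ($\theta=0$, $\boldsymbol\beta=\mathbf 0$); SIPG($\delta$) ($\theta=0$, $\boldsymbol\beta=(\delta-\tfrac12)\mathbf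 n_{T^+}$ on each interior face, $\delta\in[0,1]$); LDG ($\theta=1$, $\boldsymbol\beta\in\mathbb R^d$ uniformly bounded, possibly null). For SIPG and SIPG($\delta$), $\alpha_k$ is chosen large enough that $\mathcal A_k$ is coercive on $V_k$ (with constant independent of the discretization parameters) with respect to the norm $\|v\|_{\mathrm{DG},k}^2=\sum_{T\in\mathcal T_k}\|\nabla v\|^2_{L^2(T)}+\sum_{F\in\mathcal F_k}\|\sigma_k^{1/2}[\![v]\!]\|^2_{L^2(F)}$. **Standing assumptions.** Elliptic regularity: for $f\in H^{s-1}(\Omega)$, $s\ge1$, the solution $u$ of $\int_\Omega\nabla u\cdot\nabla v\,dx=\int_\Omega fv\,dx$ with homogeneous Dirichlet boundary conditions satisfies $\|u\|_{H^{s+1}(\Omega)}\le C\|f\|_{H^{s-1}(\Omega)}$ (in particular, for $s=1$, $\|u\|_{H^2(\Omega)}\le C\|f\|_{L^2(\Omega)}$). Moreover $\mu\in\{0,1\}$ ($\mu=0$: $p$-optimal, $\mu=1$: $p$-suboptimal estimates) is such that, if $u\in H^{s+1}(\mathcal T_k)$ (the functions that are $H^{s+1}$ on each element), $s\ge1$, and $u_k\in V_k$ solves $\mathcal A_k(u_k,v)=\int_\Omega fv\,dx$ for all $v\in V_k$, then $$\|u-u_k\|_{\mathrm{DG},k}\le C\frac{h_k^{\min(p_k,s)}}{p_k^{s-\mu/2}}\|u\|_{H^{s+1}(\mathcal T_k)},\qquad\|u-u_k\|_{L^2(\Omega)}\le C\frac{h_k^{\min(p_k,s)+1}}{p_k^{s+1-\mu}}\|u\|_{H^{s+1}(\mathcal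 T_k)}.$$ **Discrete operators and norms.** $\{\phi_i^k\}_{i=1}^{n_k}$ is a basis of $V_k$, each function supported in a single element, obtained by mapping with $\mathsf F_T$ an $L^2(\widehat T)$-orthonormal basis of $\mathbb M^{p_k}(\widehat T)$. For $u=\sum u_i\phi^k_i$, $v=\sum v_i\phi_i^k$: $(u,v)_k=h_k^d\sum_i u_iv_i$. The operator $A_k$ on $V_k$ is defined by $(A_ku,v)_k=\mathcal A_k(u,v)$ for all $u,v\in V_k$; it is symmetric positive definite for $(\cdot,\cdot)_k$. For $s\in\mathbb R$, $\|v\|_{s,k}:=\sqrt{(A_k^sv,v)_k}$. **Multigrid.** $R_{k-1}^k:V_{k-1}\to V_k$ is the prolongation (natural injection), and $P_k^{k-1}:V_k\to V_{k-1}$ is defined by $\mathcal A_{k-1}(P_k^{k-1}v,w)=\mathcal A_k(v,R_{k-1}^kw)$ for all $v\in V_k$, $w\in V_{k-1}$. The smoother is Richardson's: $G_k=\mathrm I_k-\Lambda_k^{-1}A_k$, where $\mathrm I_k$ is the identity on $V_k$ and $\Lambda_k$ is a bound for the spectral radius of $A_k$ with $\Lambda_k\le C\,p_k^4/h_k^2$. For $m_1,m_2$ pre- and post-smoothing steps, the two-level operator is $\mathbb E^{\mathrm{2lvl}}_{k,m_1,m_2}=G_k^{m_2}(\mathrm I_k-R_{k-1}^kP_k^{k-1})G_k^{m_1}$, $k\ge 2$. The error propagation operator of the W-cycle (exact solve on level 1, two recursive coarse-grid calls on each level) is $$\mathbb E_{1,m_1,m_2}=0,\qquad\mathbb E_{k,m_1,m_2}=G_k^{m_2}\big(\mathrm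 I_k-R_{k-1}^k(\mathrm I_{k-1}-\mathbb E_{k-1,m_1,m_2}^2)P_k^{k-1}\big)G_k^{m_1},\quad k>1.$$ *)

theory Defs
  imports "HOL-Analysis.Analysis"
begin

definition L2 :: "(real^'n::finite) set \<Rightarrow> (real^'n \<Rightarrow> 'b::euclidean_space) \<Rightarrow> bool" where
  "L2 S f \<longleftrightarrow> f \<in> borel_measurable (lebesgue_on S) \<and>
     integrable (lebesgue_on S) (\<lambda>x. (norm (f x))\<^sup>2)"

definition L2_norm_on :: "(real^'n::finite) set \<Rightarrow> (real^'n \<Rightarrow> 'b::euclidean_space) \<Rightarrow> real" where
  "L2_norm_on S f = sqrt (\<integral>x. (norm (f x))\<^sup>2 \<partial>lebesgue_on S)"

primrec iter_partial :: "'n::finite list \<Rightarrow> (real^'n \<Rightarrow> real) \<Rightarrow> real^'n \<Rightarrow> real" where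
  "iter_partial [] f = f"
| "iter_partial (i # is) f = (\<lambda>x. frechet_derivative (iter_partial is f) (at x) (axis i 1))"

definition grad :: "(real^'n::finite \<Rightarrow> real) \<Rightarrow> real^'n \<Rightarrow> real^'n" where
  "grad v x = (\<chi> i. frechet_derivative v (at x) (axis i 1))"

definition test_function :: "(real^'n::finite) set \<Rightarrow> (real^'n \<Rightarrow> real) \<Rightarrow> bool" where
  "test_function S \<phi> \<longleftrightarrow> (\<forall>is x. iter_partial is \<phi> differentiable (at x)) \<and>
     compact (closure {x. \<phi> x \<noteq> 0}) \<and> closure {x. \<phi> x \<noteq> 0} \<subseteq> S"

definition has_weak_deriv ::
  "(real^'n::finite) set \<Rightarrow> 'n list \<Rightarrow> (real^'n \<Rightarrow> real) \<Rightarrow> (real^'n \<Rightarrow> real) \<Rightarrow> bool" where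
  "has_weak_deriv S is u w \<longleftrightarrow> L2 S u \<and> L2 S w \<and>
     (\<forall>\<phi>. test_function S \<phi> \<longrightarrow>
        (\<integral>x. u x * iter_partial is \<phi> x \<partial>lebesgue_on S)
          = (-1) ^ length is * (\<integral>x. w x * \<phi> x \<partial>lebesgue_on S))"

definition weak_deriv ::
  "(real^'n::finite) set \<Rightarrow> 'n list \<Rightarrow> (real^'n \<Rightarrow> real) \<Rightarrow> real^'n \<Rightarrow> real" where
  "weak_deriv S is u = (SOME w. has_weak_deriv S is u w)"

text \<open>Squared Sobolev--Slobodeckij norm of real order \<open>r \<ge> 0\<close>: the \<open>L\<^sup>2\<close> norms of the derivative
  tensors of order at most \<open>m = \<lfloor>r\<rfloor>\<close> (a tensor entry is addressed by a list of coordinate indices),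
  plus the Gagliardo seminorm of order \<open>r - m\<close> of the \<open>m\<close>-th derivatives if \<open>r\<close> is not an integer.\<close>

definition sobolev_sq :: "(real^'n::finite) set \<Rightarrow> real \<Rightarrow> (real^'n \<Rightarrow> real) \<Rightarrow> ennreal" where
  "sobolev_sq S r u =
     (let m = nat \<lfloor>r\<rfloor>; \<sigma> = r - real m in
       (\<Sum>is | length is \<le> m. \<integral>\<^sup>+x. ennreal ((weak_deriv S is u x)\<^sup>2) \<partial>lebesgue_on S) +
       (if \<sigma> = 0 then 0 else
         (\<Sum>is | length is = m. \<integral>\<^sup>+x. (\<integral>\<^sup>+y.
            ennreal ((weak_deriv S is u x - weak_deriv S is u y)\<^sup>2
                      / norm (x - y) powr (real CARD('n) + 2 * \<sigma>))
            \<partial>lebesgue_on S) \<partial>lebesgue_on S)))"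

definition in_sobolev :: "(real^'n::finite) set \<Rightarrow> real \<Rightarrow> (real^'n \<Rightarrow> real) \<Rightarrow> bool" where
  "in_sobolev S r u \<longleftrightarrow>
     (\<forall>is. length is \<le> nat \<lfloor>r\<rfloor> \<longrightarrow> (\<exists>w. has_weak_deriv S is u w)) \<and> sobolev_sq S r u < \<infinity>"

definition sobolev_norm :: "(real^'n::finite) set \<Rightarrow> real \<Rightarrow> (real^'n \<Rightarrow> real) \<Rightarrow> real" where
  "sobolev_norm S r u = sqrt (enn2real (sobolev_sq S r u))"

text \<open>\<open>u \<in> H\<^sup>1\<^sub>0(\<Omega>)\<close> with weak gradient \<open>g\<close>: the \<open>H\<^sup>1\<close>-closure of the test functions.\<close>

definition H10 :: "(real^'n::finite) set \<Rightarrow> (real^'n \<Rightarrow> real) \<Rightarrow> (real^'n \<Rightarrow> real^'n) \<Rightarrow> bool" where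
  "H10 \<Omega> u g \<longleftrightarrow> L2 \<Omega> u \<and> L2 \<Omega> g \<and>
     (\<exists>\<phi>. (\<forall>j::nat. test_function \<Omega> (\<phi> j)) \<and>
        (\<lambda>j. L2_norm_on \<Omega> (\<lambda>x. u x - \<phi> j x)) \<longlonglongrightarrow> 0 \<and>
        (\<lambda>j. L2_norm_on \<Omega> (\<lambda>x. g x - grad (\<phi> j) x)) \<longlonglongrightarrow> 0)"

definition weak_solution ::
  "(real^'n::finite) set \<Rightarrow> (real^'n \<Rightarrow> real) \<Rightarrow> (real^'n \<Rightarrow> real) \<Rightarrow> (real^'n \<Rightarrow> real^'n) \<Rightarrow> bool" where
  "weak_solution \<Omega> f u g \<longleftrightarrow> H10 \<Omega> u g \<and>
     (\<forall>v w. H10 \<Omega> v w \<longrightarrow>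
        (\<integral>x. g x \<bullet> w x \<partial>lebesgue_on \<Omega>) = (\<integral>x. f x * v x \<partial>lebesgue_on \<Omega>))"

definition elliptic_regularity :: "(real^'n::finite) set \<Rightarrow> real \<Rightarrow> bool" where
  "elliptic_regularity \<Omega> s \<longleftrightarrow>
     (\<exists>C>0. \<forall>f u g. in_sobolev \<Omega> (s - 1) f \<and> weak_solution \<Omega> f u g \<longrightarrow>
        in_sobolev \<Omega> (s + 1) u \<and> sobolev_norm \<Omega> (s + 1) u \<le> C * sobolev_norm \<Omega> (s - 1) f)"

definition polyhedral_domain :: "(real^'n::finite) set \<Rightarrow> bool" where
  "polyhedral_domain \<Omega> \<longleftrightarrow> open \<Omega> \<and> connected \<Omega> \<and> \<Omega> \<noteq> {} \<and>
     (\<exists>\<P>. finite \<P> \<and> (\<forall>P\<in>\<P>. polytope P) \<and> \<Omega> = interior (\<Union>\<P>))"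

datatype ref_kind = Simplex | Hypercube

text \<open>The vector \<open>\<beta>\<close> of LDG is allowed to depend on the level and on the face.\<close>

datatype 'n scheme =
    SIPG
  | SIPG_delta real
  | LDG "nat \<Rightarrow> (real^'n::finite) set \<Rightarrow> real^'n"

text \<open>All the data that may vary while constants stay fixed. Levels are \<open>1, \<dots>, levels D\<close>.
  \<open>emap D k T\<close> is the affine map \<open>F\<^sub>T\<close>, \<open>plus_el D k F\<close> the element called \<open>T\<^sup>+\<close> on the interior
  face \<open>F\<close>, \<open>refbasis D k\<close> the \<open>L\<^sup>2\<close>-orthonormal basis on the reference element, and \<open>bnd D k\<close>
  the number \<open>\<Lambda>\<^sub>k\<close> of the Richardson smoother.\<close>

record ('n::finite) disc =
  dmn :: "(real^'n) set"
  kind :: ref_kind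
  levels :: nat
  mesh :: "nat \<Rightarrow> (real^'n) set set"
  emap :: "nat \<Rightarrow> (real^'n) set \<Rightarrow> real^'n \<Rightarrow> real^'n"
  deg :: "nat \<Rightarrow> nat"
  scheme :: "'n scheme"
  alpha :: "nat \<Rightarrow> real"
  plus_el :: "nat \<Rightarrow> (real^'n) set \<Rightarrow> (real^'n) set"
  refbasis :: "nat \<Rightarrow> (real^'n \<Rightarrow> real) set"
  bnd :: "nat \<Rightarrow> real"

definition ref_elem :: "ref_kind \<Rightarrow> (real^'n::finite) set" where
  "ref_elem r = (case r of
      Simplex \<Rightarrow> {x. (\<forall>i. 0 < x $ i) \<and> (\<Sum>i\<in>UNIV. x $ i) < 1}
    | Hypercube \<Rightarrow> {x. \<forall>i. 0 < x $ i \<and> x $ i < 1})"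

definition exponents :: "ref_kind \<Rightarrow> nat \<Rightarrow> ('n::finite \<Rightarrow> nat) set" where
  "exponents r p = (case r of
      Simplex \<Rightarrow> {a. (\<Sum>i\<in>UNIV. a i) \<le> p}
    | Hypercube \<Rightarrow> {a. \<forall>i. a i \<le> p})"

definition poly_space :: "ref_kind \<Rightarrow> nat \<Rightarrow> (real^'n::finite \<Rightarrow> real) set" where
  "poly_space r p = {q. \<exists>c. q = (\<lambda>x. \<Sum>a\<in>exponents r p. c a * (\<Prod>i\<in>UNIV. x $ i ^ a i))}"

definition partition_of :: "(real^'n::finite) set \<Rightarrow> (real^'n) set set \<Rightarrow> bool" where
  "partition_of \<Omega> \<T> \<longleftrightarrow> finite \<T> \<and> pairwise disjnt \<T> \<and> (\<Union>T\<in>\<T>. closure T) = closure \<Omega>"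

text \<open>Uniform (red) refinement: every element is split into \<open>2\<^sup>d\<close> elements, all of whose vertices are
  vertices of the parent or midpoints of two of them, among them the half-size copies of the parent
  at each of its vertices. For parallelepipeds these copies are all \<open>2\<^sup>d\<close> children; for a
  triangle only the middle one is left, for a tetrahedron only the cut of the inner octahedron.\<close>

definition uniform_refinement :: "(real^'n::finite) set set \<Rightarrow> (real^'n) set set \<Rightarrow> bool" where
  "uniform_refinement \<T> \<T>' \<longleftrightarrow>
     (\<forall>T'\<in>\<T>'. \<exists>T\<in>\<T>. T' \<subseteq> T) \<and>
     (\<forall>T\<in>\<T>. card {T'\<in>\<T>'. T' \<subseteq> T} = 2 ^ CARD('n) \<and>
        (\<forall>a. a extreme_point_of closure T \<longrightarrow> midpoint a ` T \<in> \<T>') \<and>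
        (\<forall>T'\<in>\<T>'. T' \<subseteq> T \<longrightarrow> {x. x extreme_point_of closure T'}
             \<subseteq> {midpoint a b | a b. a extreme_point_of closure T \<and> b extreme_point_of closure T}))"

definition mesh_size :: "'n::finite disc \<Rightarrow> nat \<Rightarrow> real" where
  "mesh_size D k = Max (diameter ` mesh D 1) / 2 ^ (k - 1)"

text \<open>\<open>V\<^sub>k\<close>: every class in \<open>L\<^sup>2\<close> is represented by the function that vanishes off the (open) elements,
  so equality in \<open>V\<^sub>k\<close> is equality of functions.\<close>

definition V :: "'n::finite disc \<Rightarrow> nat \<Rightarrow> (real^'n \<Rightarrow> real) set" where
  "V D k = {v. (\<forall>T\<in>mesh D k. \<exists>q\<in>poly_space (kind D) (deg D k).
                   \<forall>x\<in>ref_elem (kind D). v (emap D k T x) = q x) \<and>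
               (\<forall>x. x \<notin> \<Union>(mesh D k) \<longrightarrow> v x = 0)}"

definition Vvec :: "'n::finite disc \<Rightarrow> nat \<Rightarrow> (real^'n \<Rightarrow> real^'n) set" where
  "Vvec D k = {\<eta>. \<forall>i. (\<lambda>x. \<eta> x $ i) \<in> V D k}"

definition bgrad :: "'n::finite disc \<Rightarrow> nat \<Rightarrow> (real^'n \<Rightarrow> real) \<Rightarrow> real^'n \<Rightarrow> real^'n" where
  "bgrad D k v x = (if x \<in> \<Union>(mesh D k) then grad v x else 0)"

text \<open>Hanging nodes are not excluded: an interior face is the \<open>(d-1)\<close>-dimensional intersection of
  two closed elements, a boundary face is the part of a facet on the boundary of the domain, provided it
  has nonempty relative interior in the hyperplane. For matching meshes these are the facets.\<close>

definition int_faces :: "'n::finite disc \<Rightarrow> nat \<Rightarrow> (real^'n) set set" where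
  "int_faces D k = {closure S \<inter> closure T | S T. S \<in> mesh D k \<and> T \<in> mesh D k \<and> S \<noteq> T \<and>
      aff_dim (closure S \<inter> closure T) = int CARD('n) - 1}"

definition bd_faces :: "'n::finite disc \<Rightarrow> nat \<Rightarrow> (real^'n) set set" where
  "bd_faces D k = {G \<inter> frontier (dmn D) | G T. T \<in> mesh D k \<and> G facet_of closure T \<and>
      aff_dim (G \<inter> frontier (dmn D)) = int CARD('n) - 1 \<and> rel_interior (G \<inter> frontier (dmn D)) \<noteq> {}}"

definition faces :: "'n::finite disc \<Rightarrow> nat \<Rightarrow> (real^'n) set set" where
  "faces D k = int_faces D k \<union> bd_faces D k"

text \<open>\<open>{T\<^sup>+, T\<^sup>-}\<close> for an interior face, \<open>{T}\<close> for a boundary face; jumps and averages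
  below are sums over this set and so cover both cases.\<close>

definition adj :: "'n::finite disc \<Rightarrow> nat \<Rightarrow> (real^'n) set \<Rightarrow> (real^'n) set set" where
  "adj D k F = {T \<in> mesh D k. F \<subseteq> closure T}"

definition outer_normal :: "(real^'n::finite) set \<Rightarrow> (real^'n) set \<Rightarrow> real^'n" where
  "outer_normal T F = (THE n. norm n = 1 \<and> (\<forall>x\<in>F. \<forall>y\<in>T. n \<bullet> (y - x) < 0))"

definition face_trace :: "(real^'n::finite) set \<Rightarrow> (real^'n \<Rightarrow> 'b::euclidean_space) \<Rightarrow> real^'n \<Rightarrow> 'b" where
  "face_trace T v x = Lim (at x within T) v"

text \<open>Integral over a flat \<open>(d-1)\<close>-dimensional set \<open>F\<close> with respect to surface measure, written by
  Fubini as the \<open>d\<close>-dimensional integral over the prism of height 1 erected on \<open>F\<close> along its unit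
  normal of the integrand extended constantly along the normal.\<close>

definition face_integral :: "(real^'n::finite) set \<Rightarrow> (real^'n \<Rightarrow> real) \<Rightarrow> real" where
  "face_integral F g =
     (let n = (SOME n. norm n = 1 \<and> (\<forall>x\<in>F. \<forall>y\<in>F. n \<bullet> (y - x) = 0));
          a = (SOME a. a \<in> F);
          foot = (\<lambda>z. z - (n \<bullet> (z - a)) *\<^sub>R n)
      in \<integral>z. g (foot z) \<partial>lebesgue_on {z. 0 \<le> n \<bullet> (z - a) \<and> n \<bullet> (z - a) \<le> 1 \<and> foot z \<in> F})"

definition jump :: "'n::finite disc \<Rightarrow> nat \<Rightarrow> (real^'n) set \<Rightarrow> (real^'n \<Rightarrow> real) \<Rightarrow> real^'n \<Rightarrow> real^'n" where
  "jump D k F v x = (\<Sum>T\<in>adj D k F. face_trace T v x *\<^sub>R outer_normal T F)"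

definition njump :: "'n::finite disc \<Rightarrow> nat \<Rightarrow> (real^'n) set \<Rightarrow> (real^'n \<Rightarrow> real^'n) \<Rightarrow> real^'n \<Rightarrow> real" where
  "njump D k F \<tau> x = (\<Sum>T\<in>adj D k F. face_trace T \<tau> x \<bullet> outer_normal T F)"

definition avg :: "'n::finite disc \<Rightarrow> nat \<Rightarrow> (real^'n) set \<Rightarrow> (real^'n \<Rightarrow> real^'n) \<Rightarrow> real^'n \<Rightarrow> real^'n" where
  "avg D k F \<tau> x = (1 / real (card (adj D k F))) *\<^sub>R (\<Sum>T\<in>adj D k F. face_trace T \<tau> x)"

definition lift_r :: "'n::finite disc \<Rightarrow> nat \<Rightarrow> (real^'n) set \<Rightarrow> (real^'n \<Rightarrow> real^'n) \<Rightarrow> real^'n \<Rightarrow> real^'n" where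
  "lift_r D k F \<tau> = (THE r. r \<in> Vvec D k \<and>
     (\<forall>\<eta>\<in>Vvec D k. (\<integral>x. r x \<bullet> \<eta> x \<partial>lebesgue_on (dmn D))
        = - face_integral F (\<lambda>x. \<tau> x \<bullet> avg D k F \<eta> x)))"

definition lift_l :: "'n::finite disc \<Rightarrow> nat \<Rightarrow> (real^'n) set \<Rightarrow> (real^'n \<Rightarrow> real) \<Rightarrow> real^'n \<Rightarrow> real^'n" where
  "lift_l D k F v = (THE l. l \<in> Vvec D k \<and>
     (\<forall>\<eta>\<in>Vvec D k. (\<integral>x. l x \<bullet> \<eta> x \<partial>lebesgue_on (dmn D))
        = - face_integral F (\<lambda>x. v x * njump D k F \<eta> x)))"

text \<open>The arguments of the global liftings are functions on the skeleton, given face by face.\<close>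

definition Lift_R :: "'n::finite disc \<Rightarrow> nat \<Rightarrow> ((real^'n) set \<Rightarrow> real^'n \<Rightarrow> real^'n) \<Rightarrow> real^'n \<Rightarrow> real^'n" where
  "Lift_R D k \<tau> x = (\<Sum>F\<in>faces D k. lift_r D k F (\<tau> F) x)"

definition Lift_L :: "'n::finite disc \<Rightarrow> nat \<Rightarrow> ((real^'n) set \<Rightarrow> real^'n \<Rightarrow> real) \<Rightarrow> real^'n \<Rightarrow> real^'n" where
  "Lift_L D k v x = (\<Sum>F\<in>int_faces D k. lift_l D k F (v F) x)"

definition beta :: "'n::finite disc \<Rightarrow> nat \<Rightarrow> (real^'n) set \<Rightarrow> real^'n" where
  "beta D k F = (case scheme D of
      SIPG \<Rightarrow> 0
    | SIPG_delta \<delta> \<Rightarrow> (\<delta> - 1/2) *\<^sub>R outer_normal (plus_el D k F) F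
    | LDG b \<Rightarrow> b k F)"

definition theta :: "'n::finite disc \<Rightarrow> real" where
  "theta D = (case scheme D of SIPG \<Rightarrow> 0 | SIPG_delta \<delta> \<Rightarrow> 0 | LDG b \<Rightarrow> 1)"

definition sigma :: "'n::finite disc \<Rightarrow> nat \<Rightarrow> (real^'n) set \<Rightarrow> real" where
  "sigma D k F = alpha D k * real (deg D k) ^ 2 / Min (diameter ` adj D k F)"

definition Gop :: "'n::finite disc \<Rightarrow> nat \<Rightarrow> (real^'n \<Rightarrow> real) \<Rightarrow> real^'n \<Rightarrow> real^'n" where
  "Gop D k v x = Lift_R D k (\<lambda>F. jump D k F v) x
     + Lift_L D k (\<lambda>F y. beta D k F \<bullet> jump D k F v y) x"

definition Aform :: "'n::finite disc \<Rightarrow> nat \<Rightarrow> (real^'n \<Rightarrow> real) \<Rightarrow> (real^'n \<Rightarrow> real) \<Rightarrow> real" where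
  "Aform D k w v =
     (\<integral>x. (bgrad D k w x \<bullet> bgrad D k v x + bgrad D k w x \<bullet> Gop D k v x + Gop D k w x \<bullet> bgrad D k v x
           + theta D * (Gop D k w x \<bullet> Gop D k v x)) \<partial>lebesgue_on (dmn D))
     + (\<Sum>F\<in>faces D k. face_integral F (\<lambda>x. sigma D k F * (jump D k F w x \<bullet> jump D k F v x)))"

text \<open>The DG norm of \<open>v\<close>, whose elementwise gradient is passed as \<open>g\<close>, because it is also applied to
  functions that have only a weak gradient.\<close>

definition DG_norm :: "'n::finite disc \<Rightarrow> nat \<Rightarrow> (real^'n \<Rightarrow> real) \<Rightarrow> (real^'n \<Rightarrow> real^'n) \<Rightarrow> real" where
  "DG_norm D k v g = sqrt ((\<Sum>T\<in>mesh D k. (L2_norm_on T g)\<^sup>2)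
     + (\<Sum>F\<in>faces D k. face_integral F (\<lambda>x. (norm (sqrt (sigma D k F) *\<^sub>R jump D k F v x))\<^sup>2)))"

definition orthonormal_refbasis :: "'n::finite disc \<Rightarrow> nat \<Rightarrow> bool" where
  "orthonormal_refbasis D k \<longleftrightarrow> finite (refbasis D k) \<and>
     refbasis D k \<subseteq> poly_space (kind D) (deg D k) \<and>
     (\<forall>q\<in>poly_space (kind D) (deg D k). \<exists>c. q = (\<lambda>x. \<Sum>b\<in>refbasis D k. c b * b x)) \<and>
     (\<forall>b\<in>refbasis D k. \<forall>b'\<in>refbasis D k.
        (\<integral>x. b x * b' x \<partial>lebesgue_on (ref_elem (kind D))) = (if b = b' then 1 else 0))"

text \<open>The basis of \<open>V\<^sub>k\<close> is indexed by pairs of an element and a reference basis function.\<close>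

definition basis_fun :: "'n::finite disc \<Rightarrow> nat \<Rightarrow> (real^'n) set \<times> (real^'n \<Rightarrow> real) \<Rightarrow> real^'n \<Rightarrow> real" where
  "basis_fun D k = (\<lambda>(T, b) x. if x \<in> T then b (inv (emap D k T) x) else 0)"

definition coord :: "'n::finite disc \<Rightarrow> nat \<Rightarrow> (real^'n \<Rightarrow> real) \<Rightarrow> (real^'n) set \<times> (real^'n \<Rightarrow> real) \<Rightarrow> real" where
  "coord D k u = (THE c. (\<forall>i. i \<notin> mesh D k \<times> refbasis D k \<longrightarrow> c i = 0) \<and>
     u = (\<lambda>x. \<Sum>i\<in>mesh D k \<times> refbasis D k. c i * basis_fun D k i x))"

definition ip :: "'n::finite disc \<Rightarrow> nat \<Rightarrow> (real^'n \<Rightarrow> real) \<Rightarrow> (real^'n \<Rightarrow> real) \<Rightarrow> real" where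
  "ip D k u v = mesh_size D k ^ CARD('n) *
     (\<Sum>i\<in>mesh D k \<times> refbasis D k. coord D k u i * coord D k v i)"

definition Aop :: "'n::finite disc \<Rightarrow> nat \<Rightarrow> (real^'n \<Rightarrow> real) \<Rightarrow> real^'n \<Rightarrow> real" where
  "Aop D k u = (THE w. w \<in> V D k \<and> (\<forall>v\<in>V D k. ip D k w v = Aform D k u v))"

text \<open>\<open>\<parallel>v\<parallel>\<^bsub>s,k\<^esub>\<close> for \<open>s = 1\<close>.\<close>

definition norm1 :: "'n::finite disc \<Rightarrow> nat \<Rightarrow> (real^'n \<Rightarrow> real) \<Rightarrow> real" where
  "norm1 D k v = sqrt (ip D k (Aop D k v) v)"

text \<open>Since \<open>A\<^sub>k\<close> is symmetric, its spectrum consists of real eigenvalues.\<close>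

definition Aop_spectrum :: "'n::finite disc \<Rightarrow> nat \<Rightarrow> real set" where
  "Aop_spectrum D k = {l. \<exists>v\<in>V D k. v \<noteq> (\<lambda>x. 0) \<and> Aop D k v = (\<lambda>x. l * v x)}"

text \<open>\<open>prolong D k\<close> and \<open>project D k\<close> act between the levels \<open>k - 1\<close> and \<open>k\<close>. The former
  is the inclusion of \<open>L\<^sup>2\<close> classes: it passes to the representative that vanishes off the elements
  of level \<open>k\<close>.\<close>

definition prolong :: "'n::finite disc \<Rightarrow> nat \<Rightarrow> (real^'n \<Rightarrow> real) \<Rightarrow> real^'n \<Rightarrow> real" where
  "prolong D k v x = (if x \<in> \<Union>(mesh D k) then v x else 0)"

definition project :: "'n::finite disc \<Rightarrow> nat \<Rightarrow> (real^'n \<Rightarrow> real) \<Rightarrow> real^'n \<Rightarrow> real" where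
  "project D k v = (THE u. u \<in> V D (k - 1) \<and>
     (\<forall>w\<in>V D (k - 1). Aform D (k - 1) u w = Aform D k v (prolong D k w)))"

definition smoother :: "'n::finite disc \<Rightarrow> nat \<Rightarrow> (real^'n \<Rightarrow> real) \<Rightarrow> real^'n \<Rightarrow> real" where
  "smoother D k v x = v x - inverse (bnd D k) * Aop D k v x"

definition two_level :: "'n::finite disc \<Rightarrow> nat \<Rightarrow> nat \<Rightarrow> nat \<Rightarrow> (real^'n \<Rightarrow> real) \<Rightarrow> real^'n \<Rightarrow> real" where
  "two_level D k m1 m2 v =
     (let w = (smoother D k ^^ m1) v
      in (smoother D k ^^ m2) (\<lambda>x. w x - prolong D k (project D k w) x))"

text \<open>Level 0 is a dummy; level 1 is \<open>Suc 0\<close>.\<close>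

primrec wcycle :: "'n::finite disc \<Rightarrow> nat \<Rightarrow> nat \<Rightarrow> nat \<Rightarrow> (real^'n \<Rightarrow> real) \<Rightarrow> real^'n \<Rightarrow> real" where
  "wcycle D m1 m2 0 = (\<lambda>v x. 0)"
| "wcycle D m1 m2 (Suc k) = (if k = 0 then (\<lambda>v x. 0) else
     (\<lambda>v. let w = (smoother D (Suc k) ^^ m1) v;
              q = project D (Suc k) w;
              c = (\<lambda>x. q x - wcycle D m1 m2 k (wcycle D m1 m2 k q) x)
          in (smoother D (Suc k) ^^ m2) (\<lambda>x. w x - prolong D (Suc k) c x)))"

definition Sigma_k :: "nat \<Rightarrow> 'n::finite disc \<Rightarrow> nat \<Rightarrow> nat \<Rightarrow> nat \<Rightarrow> real" where
  "Sigma_k \<mu> D k m1 m2 = real (deg D k) ^ (2 + \<mu>) / (sqrt (1 + real m1) * sqrt (1 + real m2))"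

definition discretization :: "(real^'n::finite) set \<Rightarrow> 'n disc \<Rightarrow> bool" where
  "discretization \<Omega> D \<longleftrightarrow> dmn D = \<Omega> \<and> 1 \<le> levels D \<and>
     (\<forall>\<delta>. scheme D = SIPG_delta \<delta> \<longrightarrow> 0 \<le> \<delta> \<and> \<delta> \<le> 1) \<and>
     (\<forall>k\<in>{1..levels D}.
        partition_of \<Omega> (mesh D k) \<and>
        (\<forall>T\<in>mesh D k. T = emap D k T ` ref_elem (kind D) \<and>
           (\<exists>B b. invertible B \<and> emap D k T = (\<lambda>x. B *v x + b))) \<and>
        1 \<le> deg D k \<and> 0 < alpha D k \<and>
        (\<forall>F\<in>int_faces D k. plus_el D k F \<in> adj D k F) \<and>
        orthonormal_refbasis D k \<and>
        (\<forall>l\<in>Aop_spectrum D k. \<bar>l\<bar> \<le> bnd D k)) \<and>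
     (\<forall>k\<in>{2..levels D}. uniform_refinement (mesh D (k - 1)) (mesh D k) \<and> deg D (k - 1) \<le> deg D k)"

text \<open>The constants that are independent of the discretization parameters, i.e. common to all members
  of a family \<open>\<D>\<close> of discretizations: for quasi-uniformity and shape regularity of the coarsest mesh, \<open>C\<^sub>p\<close>,
  the bound of the LDG vector \<open>\<beta>\<close>, coercivity (assumed for the SIPG variants), and the bound of \<open>\<Lambda>\<^sub>k\<close>.\<close>

definition uniform_family :: "'n::finite disc set \<Rightarrow> bool" where
  "uniform_family \<D> \<longleftrightarrow>
     (\<exists>C>0. \<forall>D\<in>\<D>. \<forall>T\<in>mesh D 1. mesh_size D 1 \<le> C * diameter T) \<and>
     (\<exists>C>0. \<forall>D\<in>\<D>. \<forall>T\<in>mesh D 1. \<exists>x r. ball x r \<subseteq> T \<and> diameter T \<le> C * r) \<and>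
     (\<exists>C>0. \<forall>D\<in>\<D>. \<forall>k\<in>{2..levels D}. real (deg D k) \<le> C * real (deg D (k - 1))) \<and>
     (\<exists>C>0. \<forall>D\<in>\<D>. \<forall>b. scheme D = LDG b \<longrightarrow>
        (\<forall>k\<in>{1..levels D}. \<forall>F\<in>int_faces D k. norm (b k F) \<le> C)) \<and>
     (\<exists>c>0. \<forall>D\<in>\<D>. (\<forall>b. scheme D \<noteq> LDG b) \<longrightarrow>
        (\<forall>k\<in>{1..levels D}. \<forall>v\<in>V D k. c * (DG_norm D k v (bgrad D k v))\<^sup>2 \<le> Aform D k v v)) \<and>
     (\<exists>C>0. \<forall>D\<in>\<D>. \<forall>k\<in>{1..levels D}. bnd D k \<le> C * real (deg D k) ^ 4 / (mesh_size D k)\<^sup>2)"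

text \<open>Membership in \<open>H\<^bsup>s+1\<^esup>(\<T>\<^sub>k)\<close>, \<open>s \<ge> 1\<close>, implies continuity on each element for \<open>d \<le> 3\<close>;
  \<open>u\<close> is taken to be the continuous representative, so that its traces are limits.\<close>

definition dg_error_estimate :: "nat \<Rightarrow> 'n::finite disc set \<Rightarrow> real \<Rightarrow> bool" where
  "dg_error_estimate \<mu> \<D> s \<longleftrightarrow>
     (\<exists>C>0. \<forall>D\<in>\<D>. \<forall>k\<in>{1..levels D}. \<forall>f u g uk.
        L2 (dmn D) f \<and> weak_solution (dmn D) f u g \<and>
        (\<forall>T\<in>mesh D k. in_sobolev T (s + 1) u \<and> continuous_on T u) \<and>
        uk \<in> V D k \<and> (\<forall>v\<in>V D k. Aform D k uk v = (\<integral>x. f x * v x \<partial>lebesgue_on (dmn D)))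
        \<longrightarrow>
        (let N = sqrt (\<Sum>T\<in>mesh D k. (sobolev_norm T (s + 1) u)\<^sup>2);
             h = mesh_size D k; p = real (deg D k)
         in DG_norm D k (\<lambda>x. u x - uk x) (\<lambda>x. g x - bgrad D k uk x)
              \<le> C * (h powr min p s / p powr (s - real \<mu> / 2)) * N \<and>
            L2_norm_on (dmn D) (\<lambda>x. u x - uk x)
              \<le> C * (h powr (min p s + 1) / p powr (s + 1 - real \<mu>)) * N))"

end

theory Submission
  imports Defs "HOL-Library.Function_Algebras"
begin

text \<open>The idea is the usual perturbation argument for W-cycles. If \<open>E\<close> is the error propagation operator on
level \<open>k - 1\<close>, then on level \<open>k\<close> it is the two-level operator plus \<open>G\<^bsup>m2\<^esup> R E\<^sup>2 P G\<^bsup>m1\<^esup>\<close>. The smoother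
\<open>G\<close> does not increase the energy norm, so if \<open>E\<close> is bounded by \<open>C \<Sigma>\<close> then the perturbation is bounded by
\<open>\<parallel>R\<parallel> \<parallel>P\<parallel> C\<^sup>2 \<Sigma>\<^sup>2\<close>. As \<open>\<Sigma>\<close> tends to zero when \<open>m1 + m2\<close> grows, one factor \<open>\<Sigma>\<close> absorbs the
constants once \<open>m1 + m2\<close> exceeds a threshold that depends on the degree only; with \<open>C = C2lvl + 1\<close> the
induction over the levels closes (lemmas \<open>wcycle_step\<close> and \<open>coarse_term_absorbed\<close>). The threshold is
increasing in the degree, hence it is also met on all coarser levels.

The stability of \<open>R\<close> and \<open>P\<close> is extracted from the two-level bound itself. Without smoothing steps it reads
\<open>\<parallel>v - R P v\<parallel> \<le> K \<parallel>v\<parallel>\<close> with \<open>K = C2lvl p\<^bsup>2+\<mu>\<^esup>\<close>. Since \<open>P\<close> is the adjoint of \<open>R\<close> in the energy inner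
products, \<open>\<parallel>P\<parallel>\<^sup>2 = \<parallel>R\<parallel>\<^sup>2 = \<parallel>R P\<parallel> \<le> 1 + K\<close> (lemma \<open>transfer_bounds\<close>). The constant depends on the degree,
and the threshold may depend on the degree as well.

This needs the operators to be what their defining equations say, that is, \<open>A\<^sub>k\<close>, \<open>P\<close> and the liftings must
exist as Riesz representers. The form \<open>\<A>\<^sub>k\<close> is therefore shown to be an inner product on \<open>V\<^sub>k\<close>. It is bilinear
because all integrands are piecewise polynomial, with traces that are continuous on each face. It is
nonnegative by coercivity for the SIPG variants and by completing the square for LDG. It is
nondegenerate because an element \<open>u\<close> of its kernel is a discrete solution for the data \<open>f = 0\<close>: the error estimate
bounds all multiples of \<open>u\<close> by one constant, so \<open>u = 0\<close> (lemma \<open>nondegenerate_if_error_estimate\<close>).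

Two further points carry weight. The smoother is a contraction because the largest Rayleigh quotient of
\<open>A\<^sub>k\<close> is an eigenvalue (lemma \<open>rayleigh_bound\<close>). The spaces are nested: for hypercubes the space
\<open>\<M>\<^sup>p\<close> is not invariant under all affine maps, but the children of a parallelepiped are its half-size copies at the
vertices, and an affine map of the cube onto such a copy permutes the coordinate axes (lemmas
\<open>hypercube_children\<close> and \<open>cube_automorphism\<close>).\<close>

section \<open>Functions as a real vector space\<close>

text \<open>Subspaces, spans and linear maps of finite element functions are then those of the library.\<close>

instantiation "fun" :: (type, real_vector) real_vector
begin

definition scaleR_fun :: "real \<Rightarrow> ('a \<Rightarrow> 'b) \<Rightarrow> 'a \<Rightarrow> 'b"
  where "scaleR_fun c f = (\<lambda>x. c *\<^sub>R f x)"

instance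
  by standard (simp_all add: scaleR_fun_def fun_eq_iff scaleR_add_right scaleR_add_left)

end

lemma scaleR_fun_apply [simp]: "(c *\<^sub>R f) x = c *\<^sub>R f x"
  by (simp add: scaleR_fun_def)

section \<open>Symmetric bilinear forms on finite-dimensional subspaces\<close>

text \<open>The forms are relative to a subspace \<open>W\<close>, because the spaces \<open>V\<^sub>k\<close> are not types and the forms in use
behave well on piecewise polynomials only.\<close>

locale sym_form =
  fixes W :: "'a::real_vector set" and b :: "'a \<Rightarrow> 'a \<Rightarrow> real"
  assumes sub: "subspace W"
    and sym: "u \<in> W \<Longrightarrow> v \<in> W \<Longrightarrow> b u v = b v u"
    and lin: "u \<in> W \<Longrightarrow> v \<in> W \<Longrightarrow> w \<in> W \<Longrightarrow> b u (c *\<^sub>R v + w) = c * b u v + b u w"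
begin

lemma mem [intro, simp]:
  shows "0 \<in> W" "u \<in> W \<Longrightarrow> c *\<^sub>R u \<in> W" "u \<in> W \<Longrightarrow> - u \<in> W"
    "u \<in> W \<Longrightarrow> v \<in> W \<Longrightarrow> u + v \<in> W" "u \<in> W \<Longrightarrow> v \<in> W \<Longrightarrow> u - v \<in> W"
  using sub by (auto intro: subspace_0 subspace_add subspace_diff subspace_scale subspace_neg)

lemma add_right: "u \<in> W \<Longrightarrow> v \<in> W \<Longrightarrow> w \<in> W \<Longrightarrow> b u (v + w) = b u v + b u w"
  using lin[of u v w 1] by simp

lemma zero_right [simp]: "u \<in> W \<Longrightarrow> b u 0 = 0"
  using lin[of u 0 0 1] by simp

lemma scale_right: "u \<in> W \<Longrightarrow> v \<in> W \<Longrightarrow> b u (c *\<^sub>R v) = c * b u v"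
  using lin[of u v 0 c] by simp

lemma diff_right: "u \<in> W \<Longrightarrow> v \<in> W \<Longrightarrow> w \<in> W \<Longrightarrow> b u (v - w) = b u v - b u w"
  using lin[of u w v "-1"] by (simp add: algebra_simps)

lemma add_left: "u \<in> W \<Longrightarrow> v \<in> W \<Longrightarrow> w \<in> W \<Longrightarrow> b (v + w) u = b v u + b w u"
  using add_right[of u v w] sym[of u v] sym[of u w] sym[of u "v + w"] by simp

lemma zero_left [simp]: "u \<in> W \<Longrightarrow> b 0 u = 0"
  using zero_right[of u] sym[of u 0] by simp

lemma scale_left: "u \<in> W \<Longrightarrow> v \<in> W \<Longrightarrow> b (c *\<^sub>R v) u = c * b v u"
  using scale_right[of u v c] sym[of u v] sym[of u "c *\<^sub>R v"] by simp

lemma diff_left: "u \<in> W \<Longrightarrow> v \<in> W \<Longrightarrow> w \<in> W \<Longrightarrow> b (v - w) u = b v u - b w u"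
  using diff_right[of u v w] sym[of u v] sym[of u w] sym[of u "v - w"] by simp

lemmas expand = add_right zero_right scale_right diff_right add_left zero_left scale_left diff_left

end

locale psd_form = sym_form +
  assumes nonneg: "u \<in> W \<Longrightarrow> 0 \<le> b u u"
begin

text \<open>The form may be degenerate: if \<open>b v v = 0\<close>, then \<open>b u u + 2 t b u v\<close> is nonnegative for all \<open>t\<close>, so its
slope vanishes.\<close>

lemma cauchy_schwarz:
  assumes [simp]: "u \<in> W" "v \<in> W"
  shows "(b u v)\<^sup>2 \<le> b u u * b v v"
proof -
  have q: "0 \<le> b u u + 2 * t * b u v + t\<^sup>2 * b v v" for t
  proof -
    have "b (u + t *\<^sub>R v) (u + t *\<^sub>R v) = b u u + 2 * t * b u v + t\<^sup>2 * b v v"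
      using sym[of u v] by (simp add: expand algebra_simps power2_eq_square)
    then show ?thesis using nonneg[of "u + t *\<^sub>R v"] by simp
  qed
  show ?thesis
  proof (cases "b v v = 0")
    case True
    have "b u v = 0"
    proof (rule ccontr)
      assume "b u v \<noteq> 0"
      then show False
        using q[of "- (b u u + 1) / (2 * b u v)"] True by (simp add: field_simps)
    qed
    then show ?thesis using True by simp
  next
    case False
    then have "b v v > 0" using nonneg[of v] by simp
    then show ?thesis
      using q[of "- b u v / b v v"] by (simp add: field_simps power2_eq_square)
  qed
qed

text \<open>This turns an extremum of a Rayleigh quotient into an eigenvalue equation, and nondegeneracy into definiteness.\<close>

lemma null_orthogonal:
  assumes "w \<in> W" "b w w = 0" "v \<in> W"
  shows "b w v = 0"
  using cauchy_schwarz[of w v] assms by simp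

definition nrm :: "'a \<Rightarrow> real" where "nrm v = sqrt (b v v)"

lemma nrm_nonneg: "v \<in> W \<Longrightarrow> 0 \<le> nrm v"
  by (simp add: nrm_def nonneg)

lemma nrm_sq: "v \<in> W \<Longrightarrow> (nrm v)\<^sup>2 = b v v"
  by (simp add: nrm_def nonneg)

lemma abs_le_nrm:
  assumes "u \<in> W" "v \<in> W"
  shows "\<bar>b u v\<bar> \<le> nrm u * nrm v"
proof -
  have "\<bar>b u v\<bar> = sqrt ((b u v)\<^sup>2)" by simp
  also have "\<dots> \<le> sqrt (b u u * b v v)"
    using cauchy_schwarz[OF assms] by (rule real_sqrt_le_mono)
  finally show ?thesis by (simp add: nrm_def real_sqrt_mult)
qed

lemma nrm_add_le:
  assumes [simp]: "u \<in> W" "v \<in> W"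
  shows "nrm (u + v) \<le> nrm u + nrm v"
proof (rule power2_le_imp_le)
  have "(nrm (u + v))\<^sup>2 = b u u + 2 * b u v + b v v"
    using sym[of u v] by (simp add: nrm_sq expand)
  also have "\<dots> \<le> (nrm u)\<^sup>2 + 2 * (nrm u * nrm v) + (nrm v)\<^sup>2"
    using abs_le_nrm[of u v] by (simp add: nrm_sq)
  finally show "(nrm (u + v))\<^sup>2 \<le> (nrm u + nrm v)\<^sup>2"
    by (simp add: power2_sum)
qed (simp add: nrm_nonneg)

lemma nrm_minus: "v \<in> W \<Longrightarrow> nrm (- v) = nrm v"
  using scale_left[of v v "-1"] scale_right[of "-v" v "-1"] by (simp add: nrm_def)

lemma nrm_diff_le: "u \<in> W \<Longrightarrow> v \<in> W \<Longrightarrow> nrm (u - v) \<le> nrm u + nrm v"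
  using nrm_add_le[of u "- v"] by (simp add: nrm_minus)

end

lemma span_insert_decompose:
  assumes p: "p \<in> span B" and v: "v \<in> span (insert e B)"
  obtains t u where "u \<in> span B" "v = t *\<^sub>R (e - p) + u"
proof -
  obtain t where t: "v - t *\<^sub>R e \<in> span B"
    using v by (auto simp: span_breakdown_eq)
  have "(v - t *\<^sub>R e) + t *\<^sub>R p \<in> span B"
    using t p by (intro span_add span_scale)
  then show thesis
    by (intro that[of "(v - t *\<^sub>R e) + t *\<^sub>R p" t]) (auto simp: algebra_simps)
qed

locale pd_form = psd_form +
  assumes definite: "u \<in> W \<Longrightarrow> b u u = 0 \<Longrightarrow> u = 0"
begin

lemma pos: "u \<in> W \<Longrightarrow> u \<noteq> 0 \<Longrightarrow> 0 < b u u"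
  using nonneg[of u] definite[of u] by fastforce

lemma eq_if_all_eq:
  assumes [simp]: "u \<in> W" "v \<in> W" and "\<And>w. w \<in> W \<Longrightarrow> b u w = b v w"
  shows "u = v"
  using definite[of "u - v"] assms(3)[of "u - v"] by (simp add: diff_left)

definition functional :: "('a \<Rightarrow> real) \<Rightarrow> bool" where
  "functional L \<longleftrightarrow> (\<forall>u\<in>W. \<forall>v\<in>W. \<forall>c. L (c *\<^sub>R u + v) = c * L u + L v)"

text \<open>Induction over the spanning set. A new vector \<open>e\<close> is made orthogonal to the old span by subtracting its own
representer \<open>p\<close>, and the representer of \<open>L\<close> is corrected by a multiple of \<open>e - p\<close>.\<close>

lemma riesz_on_span:
  assumes "finite B" "span B \<subseteq> W" "functional L"
  shows "\<exists>r\<in>span B. \<forall>v\<in>span B. b r v = L v"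
  using assms
proof (induction B arbitrary: L rule: finite_induct)
  case empty
  have "L 0 = 0" using empty(2)[unfolded functional_def, rule_format, of 0 0 1] by simp
  then show ?case by (auto)
next
  case (insert e B)
  have sB: "span B \<subseteq> W" using insert.prems(1) span_mono[of B "insert e B"] by blast
  have eW: "e \<in> W" using insert.prems(1) span_base[of e "insert e B"] by blast
  have "functional (b e)" unfolding functional_def using eW by (simp add: lin)
  then obtain p where p: "p \<in> span B" "\<forall>v\<in>span B. b p v = b e v"
    using insert.IH sB by blast
  obtain r where r: "r \<in> span B" "\<forall>v\<in>span B. b r v = L v"
    using insert.IH sB insert.prems(2) by blast
  define e' where "e' = e - p"
  have W: "p \<in> W" "r \<in> W" "e' \<in> W" using p r sB eW by (auto simp: e'_def)
  have orth: "b e' u = 0" if "u \<in> span B" for u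
    using that p sB eW W by (auto simp: e'_def diff_left subset_eq)
  \<comment> \<open>If e' = 0 then division by zero makes the correction term vanish, as it should.\<close>
  define s where "s = L e' / b e' e'"
  have L0: "L e' = 0" if "e' = 0"
    using insert.prems(2)[unfolded functional_def, rule_format, of 0 0 1] that by simp
  have se: "s * b e' e' = L e'"
    using definite[OF W(3)] L0 by (auto simp: s_def)
  have "b (r + s *\<^sub>R e') v = L v" if v: "v \<in> span (insert e B)" for v
  proof -
    obtain t u where u: "u \<in> span B" "v = t *\<^sub>R e' + u"
      using span_insert_decompose[OF p(1) v] unfolding e'_def by metis
    have uW: "u \<in> W" using u sB by auto
    have "b r e' = 0" using orth[OF r(1)] sym[of e' r] W by simp
    then have "b (r + s *\<^sub>R e') v = b r u + t * (s * b e' e')"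
      using orth[OF u(1)] W uW by (simp add: u(2) expand algebra_simps)
    also have "\<dots> = t * L e' + L u" using r(2) u(1) se by simp
    also have "\<dots> = L v" using insert.prems(2) W uW by (simp add: functional_def u(2))
    finally show ?thesis .
  qed
  moreover have "r + s *\<^sub>R e' \<in> span (insert e B)"
  proof -
    have "span B \<subseteq> span (insert e B)" by (rule span_mono) auto
    then show ?thesis unfolding e'_def
      using r p by (intro span_add span_scale span_diff) (auto intro: span_base)
  qed
  ultimately show ?case by blast
qed

lemma riesz:
  assumes "finite B" "W = span B" "functional L"
  shows "\<exists>!r. r \<in> W \<and> (\<forall>v\<in>W. b r v = L v)"
proof -
  obtain r where "r \<in> W" "\<forall>v\<in>W. b r v = L v"
    using riesz_on_span[of B L] assms by auto
  then show ?thesis by (metis eq_if_all_eq)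
qed

text \<open>Equivalence of norms on a finite-dimensional space, proved without compactness by the same orthogonal
induction: the mixed term \<open>2 t c(e', u)\<close> is at most \<open>t\<^sup>2 + c(e', u)\<^sup>2\<close>, and \<open>c(e', \<cdot>)\<close> is represented by a vector of
the old span, to which the Cauchy-Schwarz inequality applies.\<close>

lemma dominates_on_span:
  assumes c: "sym_form W c" and "finite B" "span B \<subseteq> W"
  shows "\<exists>C. \<forall>v\<in>span B. c v v \<le> C * b v v"
  using assms(2,3)
proof (induction B rule: finite_induct)
  case empty
  interpret c: sym_form W c by fact
  show ?case by simp
next
  case (insert e B)
  interpret c: sym_form W c by fact
  have sB: "span B \<subseteq> W" using insert.prems(1) span_mono[of B "insert e B"] by blast
  have eW: "e \<in> W" using insert.prems(1) span_base[of e "insert e B"] by blast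
  have "functional (b e)" unfolding functional_def using eW by (simp add: lin)
  then obtain p where p: "p \<in> span B" "\<forall>v\<in>span B. b p v = b e v"
    using riesz_on_span[OF insert.hyps(1) sB] by blast
  define e' where "e' = e - p"
  have W: "p \<in> W" "e' \<in> W" using p sB eW by (auto simp: e'_def)
  have orth: "b e' u = 0" if "u \<in> span B" for u
    using that p sB eW W by (auto simp: e'_def diff_left subset_eq)
  have "functional (c e')" unfolding functional_def using W by (simp add: c.lin)
  then obtain r where r: "r \<in> span B" "\<forall>v\<in>span B. b r v = c e' v"
    using riesz_on_span[OF insert.hyps(1) sB] by blast
  have rW: "r \<in> W" using r sB by auto
  obtain C where C: "\<forall>v\<in>span B. c v v \<le> C * b v v"
    using insert.IH sB by blast
  define K where "K = max (b r r + C) ((c e' e' + 1) / b e' e')"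
  have "c v v \<le> K * b v v" if v: "v \<in> span (insert e B)" for v
  proof -
    obtain t u where u: "u \<in> span B" "v = t *\<^sub>R e' + u"
      using span_insert_decompose[OF p(1) v] unfolding e'_def by metis
    have uW: "u \<in> W" using u sB by auto
    have vb: "b v v = t\<^sup>2 * b e' e' + b u u"
      using orth[OF u(1)] sym[of u e'] W uW by (simp add: u(2) expand algebra_simps power2_eq_square)
    have "c v v = t\<^sup>2 * c e' e' + 2 * t * c e' u + c u u"
      using c.sym[of u e'] W uW by (simp add: u(2) c.expand algebra_simps power2_eq_square)
    also have "2 * t * c e' u \<le> t\<^sup>2 + (c e' u)\<^sup>2"
      using sum_squares_bound[of t "c e' u"] by simp
    also have "(c e' u)\<^sup>2 \<le> b r r * b u u"
      using cauchy_schwarz[OF rW uW] r(2) u(1) by simp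
    finally have 1: "c v v \<le> t\<^sup>2 * (c e' e' + 1) + (b r r + C) * b u u"
      using C u(1) by (auto simp: algebra_simps intro: order_trans)
    have 2: "(b r r + C) * b u u \<le> K * b u u"
      by (rule mult_right_mono) (auto simp: K_def nonneg uW)
    have 3: "t\<^sup>2 * (c e' e' + 1) \<le> K * (t\<^sup>2 * b e' e')" if "e' \<noteq> 0"
    proof -
      have "c e' e' + 1 \<le> K * b e' e'"
        using pos[OF W(2) that] by (simp add: K_def pos_divide_le_eq[symmetric])
      from mult_left_mono[OF this, of "t\<^sup>2"] show ?thesis by (simp add: algebra_simps)
    qed
    show ?thesis
    proof (cases "e' = 0")
      case True
      then have "v = u" using u by simp
      moreover have "C * b u u \<le> K * b u u"
        by (rule mult_right_mono) (auto simp: K_def nonneg uW rW intro: max.coboundedI1)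
      ultimately show ?thesis using C u by (auto intro: order_trans)
    next
      case False
      then show ?thesis using 1 2 3 by (simp add: vb algebra_simps)
    qed
  qed
  then show ?case by blast
qed

text \<open>If every eigenvalue of \<open>a\<close> relative to \<open>b\<close> is at most \<open>\<Lambda>\<close>, then so is every Rayleigh quotient. Their supremum
\<open>M\<close> is finite since \<open>b\<close> dominates \<open>a\<close>. Were \<open>M b - a\<close> definite, it would dominate \<open>b\<close> and \<open>M\<close> could be lowered;
so it has a null vector, which is an eigenvector with eigenvalue \<open>M\<close>.\<close>

lemma rayleigh_bound:
  assumes a: "psd_form W a" and B: "finite B" "W = span B"
    and ev: "\<And>l w. w \<in> W \<Longrightarrow> w \<noteq> 0 \<Longrightarrow> (\<And>v. v \<in> W \<Longrightarrow> a w v = l * b w v) \<Longrightarrow> l \<le> \<Lambda>"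
    and w: "w \<in> W"
  shows "a w w \<le> \<Lambda> * b w w"
proof (cases "w = 0")
  case True
  interpret a: psd_form W a by fact
  show ?thesis using True by simp
next
  case False
  interpret a: psd_form W a by fact
  define T where "T = {t. \<forall>v\<in>W. a v v \<le> t * b v v}"
  obtain C0 where "C0 \<in> T"
    using dominates_on_span[OF a.sym_form_axioms B(1)] B(2) by (auto simp: T_def)
  then have ne: "T \<noteq> {}" by auto
  have "t \<ge> 0" if "t \<in> T" for t
  proof -
    have "0 \<le> t * b w w" using that w a.nonneg[OF w] by (force simp: T_def)
    then show ?thesis using pos[OF w False] by (simp add: zero_le_mult_iff)
  qed
  then have bdd: "bdd_below T" by (auto simp: bdd_below_def)
  define M where "M = Inf T"
  have M: "a v v \<le> M * b v v" if v: "v \<in> W" for v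
  proof (cases "v = 0")
    case False
    have "a v v / b v v \<le> t" if "t \<in> T" for t
      using that v pos[OF v False] by (simp add: T_def pos_divide_le_eq)
    then have "a v v / b v v \<le> M" unfolding M_def using ne by (intro cInf_greatest)
    then show ?thesis using pos[OF v False] by (simp add: pos_divide_le_eq)
  qed simp
  define d where "d u v = M * b u v - a u v" for u v
  interpret d: psd_form W d
    by standard (auto simp: d_def sub sym a.sym lin a.lin M right_diff_distrib distrib_left)
  \<comment> \<open>At the infimum the form d degenerates, and a null vector of d is an eigenvector.\<close>
  have "\<exists>z\<in>W. z \<noteq> 0 \<and> d z z = 0"
  proof (rule ccontr)
    assume "\<not> ?thesis"
    then interpret d: pd_form W d by unfold_locales auto
    obtain C where C: "\<forall>v\<in>W. b v v \<le> C * d v v"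
      using d.dominates_on_span[OF sym_form_axioms B(1)] B(2) by auto
    have "0 < C * d w w" using C w pos[OF w False] by force
    then have C0: "C > 0" using d.pos[OF w False] by (simp add: zero_less_mult_iff)
    have "M - 1 / C \<in> T"
      unfolding T_def using C C0 by (auto simp: d_def field_simps)
    then have "M \<le> M - 1 / C" unfolding M_def using bdd by (rule cInf_lower)
    then show False using C0 by simp
  qed
  then obtain z where z: "z \<in> W" "z \<noteq> 0" "d z z = 0" by blast
  have "a z v = M * b z v" if "v \<in> W" for v
    using d.null_orthogonal[OF z(1,3) that] by (simp add: d_def)
  then have "M \<le> \<Lambda>" using ev z by blast
  then show ?thesis
    using M[OF w] mult_right_mono[of M \<Lambda> "b w w"] nonneg[OF w] by linarith
qed

end

text \<open>With \<open>z = A u\<close> the energy decreases by \<open>(2 / \<Lambda>) m(z, z) - a(z, z) / \<Lambda>\<^sup>2\<close>, which is at least \<open>m(z, z) / \<Lambda>\<close>. If \<open>z\<close> is not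
zero then the bound of the Rayleigh quotient makes \<open>\<Lambda>\<close> positive.\<close>

lemma richardson_contraction:
  assumes m: "pd_form W m" and a: "pd_form W a"
    and A: "\<And>u. u \<in> W \<Longrightarrow> A u \<in> W" "\<And>u v. u \<in> W \<Longrightarrow> v \<in> W \<Longrightarrow> m (A u) v = a u v"
    and L: "\<And>w. w \<in> W \<Longrightarrow> a w w \<le> \<Lambda> * m w w"
    and u: "u \<in> W"
  shows "a (u - inverse \<Lambda> *\<^sub>R A u) (u - inverse \<Lambda> *\<^sub>R A u) \<le> a u u"
proof -
  interpret m: pd_form W m by fact
  interpret a: pd_form W a by fact
  define z t where "z = A u" "t = inverse \<Lambda>"
  have z: "z \<in> W" using A u by (simp add: z_t_def)
  have uz: "a u z = m z z" using A(2)[OF u z] by (simp add: z_t_def)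
  have e: "a (u - t *\<^sub>R z) (u - t *\<^sub>R z) = a u u - 2 * t * m z z + t\<^sup>2 * a z z"
    using u z uz a.sym[of z u] by (simp add: a.expand algebra_simps power2_eq_square)
  show ?thesis
  proof (cases "z = 0")
    case True then show ?thesis by (simp add: z_t_def)
  next
    case False
    have "0 < \<Lambda> * m z z" using a.pos[OF z False] L[OF z] by linarith
    then have \<Lambda>: "\<Lambda> > 0" using m.pos[OF z False] by (simp add: zero_less_mult_iff)
    have "t\<^sup>2 * a z z \<le> t\<^sup>2 * (\<Lambda> * m z z)" using L[OF z] by (intro mult_left_mono) auto
    also have "\<dots> = t * m z z" using \<Lambda> by (simp add: z_t_def power2_eq_square)
    finally have "a (u - t *\<^sub>R z) (u - t *\<^sub>R z) \<le> a u u - t * m z z" using e by simp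
    moreover have "0 \<le> t * m z z" using \<Lambda> m.nonneg[OF z] by (simp add: z_t_def)
    ultimately show ?thesis by (simp add: z_t_def)
  qed
qed

text \<open>\<open>P\<close> is the adjoint of \<open>R\<close>, so \<open>\<parallel>P v\<parallel>\<^sup>2 = a(v, R P v)\<close> and \<open>\<parallel>R w\<parallel>\<^sup>2 = ac(P R w, w)\<close>. The first identity with
\<open>\<parallel>R P v\<parallel> \<le> (1 + K) \<parallel>v\<parallel>\<close> bounds \<open>P\<close>, and the second one then bounds \<open>R\<close>.\<close>

lemma transfer_bounds:
  assumes "pd_form Wc ac" "pd_form W a"
    and R: "\<And>w. w \<in> Wc \<Longrightarrow> R w \<in> W"
    and P: "\<And>v. v \<in> W \<Longrightarrow> P v \<in> Wc" "\<And>v w. v \<in> W \<Longrightarrow> w \<in> Wc \<Longrightarrow> ac (P v) w = a v (R w)"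
    and K: "\<And>v. v \<in> W \<Longrightarrow> psd_form.nrm a (v - R (P v)) \<le> K * psd_form.nrm a v" "0 \<le> K"
  shows "v \<in> W \<Longrightarrow> psd_form.nrm ac (P v) \<le> sqrt (1 + K) * psd_form.nrm a v"
    and "w \<in> Wc \<Longrightarrow> psd_form.nrm a (R w) \<le> sqrt (1 + K) * psd_form.nrm ac w"
proof -
  interpret c: pd_form Wc ac by fact
  interpret a: pd_form W a by fact
  have 1: "c.nrm (P v) \<le> sqrt (1 + K) * a.nrm v" if v: "v \<in> W" for v
  proof (rule power2_le_imp_le)
    have PW: "P v \<in> Wc" "R (P v) \<in> W" using P R v by auto
    have "(c.nrm (P v))\<^sup>2 = a v (R (P v))" using P v PW by (simp add: c.nrm_sq)
    also have "\<dots> \<le> a.nrm v * a.nrm (R (P v))" using a.abs_le_nrm[OF v PW(2)] by simp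
    also have "\<dots> \<le> a.nrm v * ((1 + K) * a.nrm v)"
    proof (rule mult_left_mono[OF _ a.nrm_nonneg[OF v]])
      have "a.nrm (R (P v)) \<le> a.nrm v + a.nrm (v - R (P v))"
        using a.nrm_diff_le[of v "v - R (P v)"] v PW by simp
      then show "a.nrm (R (P v)) \<le> (1 + K) * a.nrm v"
        using K(1)[OF v] by (simp add: algebra_simps)
    qed
    also have "\<dots> = (sqrt (1 + K) * a.nrm v)\<^sup>2"
      using K(2) by (simp add: power_mult_distrib power2_eq_square)
    finally show "(c.nrm (P v))\<^sup>2 \<le> (sqrt (1 + K) * a.nrm v)\<^sup>2" .
  qed (use v K a.nrm_nonneg in auto)
  then show "v \<in> W \<Longrightarrow> c.nrm (P v) \<le> sqrt (1 + K) * a.nrm v" .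
  show "a.nrm (R w) \<le> sqrt (1 + K) * c.nrm w" if w: "w \<in> Wc"
  proof (cases "a.nrm (R w) = 0")
    case True then show ?thesis using K(2) c.nrm_nonneg[OF w] by simp
  next
    case False
    have RW: "R w \<in> W" "P (R w) \<in> Wc" using R P w by auto
    have "(a.nrm (R w))\<^sup>2 = ac (P (R w)) w" using P RW w by (simp add: a.nrm_sq)
    also have "\<dots> \<le> c.nrm (P (R w)) * c.nrm w" using c.abs_le_nrm[OF RW(2) w] by simp
    also have "\<dots> \<le> sqrt (1 + K) * a.nrm (R w) * c.nrm w"
      using 1[OF RW(1)] c.nrm_nonneg[OF w] by (rule mult_right_mono)
    finally have "a.nrm (R w) * a.nrm (R w) \<le> a.nrm (R w) * (sqrt (1 + K) * c.nrm w)"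
      by (simp add: power2_eq_square algebra_simps)
    then show ?thesis using False a.nrm_nonneg[OF RW(1)] by simp
  qed
qed

section \<open>Polynomials under affine substitution\<close>

definition monomial :: "('n::finite \<Rightarrow> nat) \<Rightarrow> real^'n \<Rightarrow> real" where
  "monomial a x = (\<Prod>i\<in>UNIV. x $ i ^ a i)"

lemma sum_fun_apply: "(\<Sum>i\<in>I. f i) x = (\<Sum>i\<in>I. f i x)"
  by (induction I rule: infinite_finite_induct) auto

lemma finite_exponents: "finite (exponents r p :: ('n::finite \<Rightarrow> nat) set)"
proof (rule finite_subset)
  show "exponents r p \<subseteq> {a :: 'n \<Rightarrow> nat. \<forall>i. a i \<in> {..p}}"
  proof
    fix a :: "'n \<Rightarrow> nat" assume a: "a \<in> exponents r p"
    have "a i \<le> (\<Sum>i\<in>UNIV. a i)" for i by (rule member_le_sum) auto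
    then show "a \<in> {a. \<forall>i. a i \<in> {..p}}"
      using a by (cases r) (auto simp: exponents_def intro: le_trans)
  qed
  have "{a :: 'n \<Rightarrow> nat. \<forall>i. a i \<in> {..p}} = (\<Pi>\<^sub>E i\<in>UNIV. {..p})"
    by (auto simp: PiE_def)
  then show "finite {a :: 'n \<Rightarrow> nat. \<forall>i. a i \<in> {..p}}"
    by (simp add: finite_PiE)
qed

lemma poly_space_eq_span:
  "(poly_space r p :: (real^'n::finite \<Rightarrow> real) set) = span (monomial ` exponents r p)"
proof
  have eq: "(\<lambda>x. \<Sum>a\<in>exponents r p. c a * (\<Prod>i\<in>UNIV. x $ i ^ a i))
    = (\<Sum>a\<in>exponents r p. c a *\<^sub>R monomial a)" for c :: "('n \<Rightarrow> nat) \<Rightarrow> real"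
    by (auto simp: fun_eq_iff sum_fun_apply monomial_def)
  show "poly_space r p \<subseteq> span (monomial ` (exponents r p :: ('n \<Rightarrow> nat) set))"
    unfolding poly_space_def eq
    by (auto intro!: span_sum span_scale intro: span_base)
  show "span (monomial ` (exponents r p :: ('n \<Rightarrow> nat) set)) \<subseteq> poly_space r p"
  proof (rule span_minimal)
    show "subspace (poly_space r p :: (real^'n \<Rightarrow> real) set)"
    proof (rule subspaceI)
      show "0 \<in> (poly_space r p :: (real^'n \<Rightarrow> real) set)"
        unfolding poly_space_def by (auto simp: fun_eq_iff intro!: exI[of _ "\<lambda>_. 0"])
      show "x + y \<in> poly_space r p" if xy: "x \<in> poly_space r p" "y \<in> poly_space r p"
        for x y :: "real^'n \<Rightarrow> real"
      proof -
        obtain c d where cd: "x = (\<Sum>a\<in>exponents r p. c a *\<^sub>R monomial a)"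
            "y = (\<Sum>a\<in>exponents r p. d a *\<^sub>R monomial a)"
          using xy unfolding poly_space_def eq by auto
        have "x + y = (\<Sum>a\<in>exponents r p. (c a + d a) *\<^sub>R monomial a)"
          by (simp add: cd sum.distrib scaleR_left_distrib)
        then show ?thesis unfolding poly_space_def eq by auto
      qed
      show "t *\<^sub>R x \<in> poly_space r p" if x: "x \<in> poly_space r p" for t and x :: "real^'n \<Rightarrow> real"
      proof -
        obtain c where c: "x = (\<Sum>a\<in>exponents r p. c a *\<^sub>R monomial a)"
          using x unfolding poly_space_def eq by auto
        have "t *\<^sub>R x = (\<Sum>a\<in>exponents r p. (t * c a) *\<^sub>R monomial a)"
          by (simp add: c scaleR_sum_right)
        then show ?thesis unfolding poly_space_def eq by auto
      qed
    qed
    show "monomial ` exponents r p \<subseteq> (poly_space r p :: (real^'n \<Rightarrow> real) set)"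
    proof
      fix f :: "real^'n \<Rightarrow> real" assume "f \<in> monomial ` exponents r p"
      then obtain a where a: "a \<in> exponents r p" "f = monomial a" by auto
      have "f = (\<Sum>b\<in>exponents r p. (if b = a then 1 else 0) *\<^sub>R monomial b)"
      proof -
        have "(\<Sum>b\<in>exponents r p. (if b = a then 1 else 0) *\<^sub>R monomial b)
            = (\<Sum>b\<in>exponents r p. if b = a then monomial b else 0)"
          by (intro sum.cong) auto
        also have "\<dots> = f" using a by (simp add: sum.delta' sum.delta finite_exponents)
        finally show ?thesis by simp
      qed
      then show "f \<in> poly_space r p" unfolding poly_space_def eq by auto
    qed
  qed
qed

lemma subspace_poly_space: "subspace (poly_space r p)"
  by (simp add: poly_space_eq_span)

lemma real_polynomial_function_poly_space:
  fixes q :: "real^'n::finite \<Rightarrow> real"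
  shows "q \<in> poly_space r p \<Longrightarrow> real_polynomial_function q"
  by (auto simp: poly_space_def intro!: real_polynomial_function_sum finite_exponents
      real_polynomial_function.intros(2,4) real_polynomial_function_prod
      real_polynomial_function_power real_polynomial_function.intros(1)[OF bounded_linear_vec_nth])

lemma poly_space_mono:
  "p \<le> p' \<Longrightarrow> poly_space r p \<subseteq> (poly_space r p' :: (real^'n::finite \<Rightarrow> real) set)"
  unfolding poly_space_eq_span
  by (intro span_mono image_mono, cases r) (auto simp: exponents_def intro: le_trans)

lemma scaleR_times_fun:
  fixes f g :: "'a \<Rightarrow> real"
  shows "(c *\<^sub>R f) * g = c *\<^sub>R (f * g)" "f * (c *\<^sub>R g) = c *\<^sub>R (f * g)"
  by (simp_all add: fun_eq_iff)

text \<open>Degree bounds enter only through sets of exponents, so that simplices (total degree) and hypercubes (degree in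
each variable) are treated alike.\<close>

lemma span_mult_span:
  assumes f: "f \<in> span (monomial ` E1)" and g: "g \<in> span (monomial ` E2)"
    and E: "\<And>a b. a \<in> E1 \<Longrightarrow> b \<in> E2 \<Longrightarrow> a + b \<in> E"
  shows "f * g \<in> span (monomial ` E)"
  using f
proof (induction f rule: span_induct)
  show "subspace {f. f * g \<in> span (monomial ` E)}"
    by (rule subspaceI) (simp_all add: distrib_right scaleR_times_fun span_add span_zero span_scale)
  show "f * g \<in> span (monomial ` E)" if "f \<in> monomial ` E1" for f
    using g
  proof (induction g rule: span_induct)
    show "subspace {g. f * g \<in> span (monomial ` E)}"
      by (rule subspaceI) (simp_all add: distrib_left scaleR_times_fun span_add span_zero span_scale)
    show "f * g \<in> span (monomial ` E)" if g: "g \<in> monomial ` E2" for g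
    proof -
      obtain a b where ab: "a \<in> E1" "f = monomial a" "b \<in> E2" "g = monomial b"
        using \<open>f \<in> monomial ` E1\<close> g by auto
      have "f * g = monomial (a + b)"
        by (auto simp: ab monomial_def fun_eq_iff power_add prod.distrib)
      then show ?thesis using E ab by (auto intro: span_base)
    qed
  qed
qed

text \<open>\<open>E\<close> assigns to a weight the exponents that it admits. The weight is a number for the total degree, and a
function of the variable for the degree in each variable.\<close>

lemma substitute_in_span:
  fixes \<phi> :: "real^'n::finite \<Rightarrow> real^'n" and w :: "'n \<Rightarrow> 'w::comm_monoid_add"
  assumes zero: "(\<lambda>i. 0) \<in> E 0"
    and plus: "\<And>u v a b. a \<in> E u \<Longrightarrow> b \<in> E v \<Longrightarrow> a + b \<in> E (u + v)"
    and \<phi>: "\<And>i. (\<lambda>x. \<phi> x $ i) \<in> span (monomial ` E (w i))"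
  shows "(\<lambda>x. monomial a (\<phi> x)) \<in> span (monomial ` E (\<Sum>i\<in>UNIV. \<Sum>k<a i. w i))"
proof -
  have one: "(\<lambda>x. 1) \<in> span (monomial ` E 0)"
    using zero by (intro span_base) (auto simp: monomial_def fun_eq_iff intro!: image_eqI[of _ _ "\<lambda>i. 0"])
  have mult: "(\<lambda>x. f x * g x) \<in> span (monomial ` E (u + v))"
    if "f \<in> span (monomial ` E u)" "g \<in> span (monomial ` E v)" for f g u v
    using span_mult_span[OF that plus] by (simp add: times_fun_def)
  have pow: "(\<lambda>x. (\<phi> x $ i) ^ m) \<in> span (monomial ` E (\<Sum>k<m. w i))" for i m
  proof (induction m)
    case (Suc m)
    then show ?case using mult[OF Suc \<phi>[of i]] by (simp add: mult.commute)
  qed (use one in simp)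
  have "(\<lambda>x. \<Prod>i\<in>I. (\<phi> x $ i) ^ a i) \<in> span (monomial ` E (\<Sum>i\<in>I. \<Sum>k<a i. w i))" if "finite I" for I
    using that
  proof (induction I)
    case (insert i I)
    then show ?case using mult[OF pow[of i "a i"] insert.IH] by simp
  qed (use one in simp)
  then show ?thesis by (simp add: monomial_def)
qed

lemma compose_poly_space:
  fixes \<phi> :: "real^'n::finite \<Rightarrow> real^'n"
  assumes "\<And>a. a \<in> exponents r p \<Longrightarrow> (\<lambda>x. monomial a (\<phi> x)) \<in> poly_space r p" "q \<in> poly_space r p"
  shows "(\<lambda>x. q (\<phi> x)) \<in> poly_space r p"
  using assms(2) unfolding poly_space_eq_span
proof (induction q rule: span_induct)
  show "subspace {q. (\<lambda>x. q (\<phi> x)) \<in> span (monomial ` (exponents r p :: ('n \<Rightarrow> nat) set))}"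
    (is "subspace {q. _ \<in> ?S}")
  proof (rule subspaceI)
    show "0 \<in> {q. (\<lambda>x. q (\<phi> x)) \<in> ?S}"
      using span_zero[of "monomial ` exponents r p"] by (simp add: zero_fun_def)
    show "f + g \<in> {q. (\<lambda>x. q (\<phi> x)) \<in> ?S}"
      if "f \<in> {q. (\<lambda>x. q (\<phi> x)) \<in> ?S}" "g \<in> {q. (\<lambda>x. q (\<phi> x)) \<in> ?S}" for f g
      using that span_add[of "\<lambda>x. f (\<phi> x)" _ "\<lambda>x. g (\<phi> x)"] by (simp add: plus_fun_def)
    show "t *\<^sub>R f \<in> {q. (\<lambda>x. q (\<phi> x)) \<in> ?S}" if "f \<in> {q. (\<lambda>x. q (\<phi> x)) \<in> ?S}" for t f
      using that span_scale[of "\<lambda>x. f (\<phi> x)" _ t] by (simp add: scaleR_fun_def)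
  qed
  show "(\<lambda>x. q (\<phi> x)) \<in> span (monomial ` exponents r p)" if "q \<in> monomial ` exponents r p" for q
    using that assms(1) by (auto simp: poly_space_eq_span)
qed

lemma coord_in_span: "(\<lambda>x. x $ j) \<in> span (monomial ` E)" if "(\<lambda>k. if k = j then 1 else 0) \<in> E"
proof (rule span_base, rule image_eqI[OF _ that])
  show "(\<lambda>x. x $ j) = monomial (\<lambda>k. if k = j then 1 else 0)"
    by (auto simp: monomial_def fun_eq_iff if_distrib prod.delta cong: if_cong)
qed

lemma affine_in_span:
  assumes "\<And>j. M $ i $ j \<noteq> 0 \<Longrightarrow> (\<lambda>k. if k = j then 1 else 0) \<in> E" "(\<lambda>k. 0) \<in> E"
  shows "(\<lambda>x. (M *v x + c) $ i) \<in> span (monomial ` E)"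
proof -
  have "(\<lambda>x. (M *v x + c) $ i) = (\<Sum>j\<in>UNIV. (M $ i $ j) *\<^sub>R (\<lambda>x. x $ j)) + c $ i *\<^sub>R monomial (\<lambda>k. 0)"
    by (auto simp: fun_eq_iff sum_fun_apply matrix_vector_mult_def monomial_def)
  moreover have "(M $ i $ j) *\<^sub>R (\<lambda>x. x $ j) \<in> span (monomial ` E)" for j
  proof (cases "M $ i $ j = 0")
    case True then show ?thesis by (simp add: span_zero)
  next
    case False then show ?thesis using assms by (intro span_scale coord_in_span) auto
  qed
  moreover have "monomial (\<lambda>k. 0) \<in> span (monomial ` E)"
    using assms(2) by (intro span_base) auto
  ultimately show ?thesis
    by (simp add: span_add span_sum span_scale)
qed

lemma simplex_poly_affine:
  fixes M :: "real^'n::finite^'n"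
  assumes q: "q \<in> poly_space Simplex p"
  shows "(\<lambda>x. q (M *v x + c)) \<in> poly_space Simplex p"
proof (rule compose_poly_space[OF _ q])
  fix a :: "'n \<Rightarrow> nat" assume a: "a \<in> exponents Simplex p"
  define E :: "nat \<Rightarrow> ('n \<Rightarrow> nat) set" where "E = exponents Simplex"
  have "(\<lambda>x. monomial a (M *v x + c)) \<in> span (monomial ` E (\<Sum>i\<in>UNIV. \<Sum>k<a i. 1))"
  proof (rule substitute_in_span)
    show "(\<lambda>x. (M *v x + c) $ i) \<in> span (monomial ` E 1)" for i
      by (rule affine_in_span) (auto simp: E_def exponents_def)
  qed (auto simp: E_def exponents_def sum.distrib intro: add_mono)
  also have "\<dots> \<subseteq> span (monomial ` E p)"
    using a by (intro span_mono image_mono) (auto simp: E_def exponents_def)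
  finally show "(\<lambda>x. monomial a (M *v x + c)) \<in> poly_space Simplex p"
    by (simp add: poly_space_eq_span E_def)
qed

text \<open>For a matrix with one nonzero entry in each row, in pairwise different columns, the substitution is a rescaling and
permutation of the variables, which respects the degree in each variable.\<close>

lemma hypercube_poly_affine:
  fixes M :: "real^'n::finite^'n"
  assumes q: "q \<in> poly_space Hypercube p" and \<pi>: "inj \<pi>" "\<And>i j. j \<noteq> \<pi> i \<Longrightarrow> M $ i $ j = 0"
  shows "(\<lambda>x. q (M *v x + c)) \<in> poly_space Hypercube p"
proof (rule compose_poly_space[OF _ q])
  fix a :: "'n \<Rightarrow> nat" assume a: "a \<in> exponents Hypercube p"
  define E :: "('n \<Rightarrow> nat) \<Rightarrow> ('n \<Rightarrow> nat) set" where "E u = {a. \<forall>i. a i \<le> u i}" for u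
  define w :: "'n \<Rightarrow> 'n \<Rightarrow> nat" where "w i = (\<lambda>k. if k = \<pi> i then 1 else 0)" for i
  have "(\<lambda>x. monomial a (M *v x + c)) \<in> span (monomial ` E (\<Sum>i\<in>UNIV. \<Sum>k<a i. w i))"
  proof (rule substitute_in_span[where E = E and w = w])
    show "(\<lambda>x. (M *v x + c) $ i) \<in> span (monomial ` E (w i))" for i
    proof (rule affine_in_span)
      show "(\<lambda>k. if k = j then 1 else 0) \<in> E (w i)" if "M $ i $ j \<noteq> 0" for j
        using \<pi>(2)[of j i] that by (auto simp: E_def w_def)
    qed (simp add: E_def)
  qed (auto simp: E_def intro: add_mono)
  also have "\<dots> \<subseteq> span (monomial ` (exponents Hypercube p :: ('n \<Rightarrow> nat) set))"
  proof (intro span_mono image_mono)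
    have "(\<Sum>i\<in>UNIV. \<Sum>k<a i. w i) j \<le> p" for j
    proof -
      have "(\<Sum>i\<in>UNIV. \<Sum>k<a i. w i) j = (\<Sum>i\<in>UNIV. if \<pi> i = j then a i else 0)"
        by (auto simp: sum_fun_apply w_def intro!: sum.cong)
      also have "\<dots> = (\<Sum>i\<in>{i. \<pi> i = j}. a i)"
        by (simp add: sum.If_cases)
      also have "\<dots> \<le> p"
      proof (cases "\<exists>i. \<pi> i = j")
        case True
        then obtain i where "\<pi> i = j" by auto
        then have "{i. \<pi> i = j} = {i}" using \<pi>(1) by (auto dest: injD)
        then show ?thesis using a by (auto simp: exponents_def)
      qed auto
      finally show ?thesis .
    qed
    then show "E (\<Sum>i\<in>UNIV. \<Sum>k<a i. w i) \<subseteq> exponents Hypercube p"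
      by (auto simp: E_def exponents_def intro: le_trans)
  qed
  finally show "(\<lambda>x. monomial a (M *v x + c)) \<in> poly_space Hypercube p"
    by (simp add: poly_space_eq_span)
qed

section \<open>Affine elements\<close>

definition affine_elem :: "ref_kind \<Rightarrow> (real^'n::finite \<Rightarrow> real^'n) \<Rightarrow> (real^'n) set \<Rightarrow> bool" where
  "affine_elem r F T \<longleftrightarrow> T = F ` ref_elem r \<and> (\<exists>B b. invertible B \<and> F = (\<lambda>x. B *v x + b))"

lemma ref_elem_Hypercube: "ref_elem Hypercube = (box 0 1 :: (real^'n::finite) set)"
  by (auto simp: ref_elem_def mem_box_cart)

lemma ref_elem_subset_box: "ref_elem r \<subseteq> (box 0 1 :: (real^'n::finite) set)"
proof (cases r)
  case Simplex
  have "x $ i < 1" if x: "\<forall>i. 0 < x $ i" "(\<Sum>i\<in>UNIV. x $ i) < 1" for x :: "real^'n" and i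
  proof -
    have "x $ i \<le> (\<Sum>i\<in>UNIV. x $ i)" using x by (intro member_le_sum) (auto intro: less_imp_le)
    then show ?thesis using x by simp
  qed
  then show ?thesis using Simplex by (auto simp: ref_elem_def mem_box_cart)
qed (simp add: ref_elem_Hypercube)

lemma ref_elem_topology:
  shows open_ref_elem: "open (ref_elem r :: (real^'n::finite) set)"
    and ref_elem_nonempty: "ref_elem r \<noteq> ({} :: (real^'n) set)"
    and bounded_ref_elem: "bounded (ref_elem r :: (real^'n) set)"
proof -
  have "open {x :: real^'n. (\<forall>i. 0 < x $ i) \<and> (\<Sum>i\<in>UNIV. x $ i) < 1}"
    by (intro open_Collect_conj open_Collect_less continuous_intros)
       (simp add: Collect_all_eq open_INT open_Collect_less continuous_intros)
  then show "open (ref_elem r :: (real^'n) set)"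
    by (cases r) (auto simp: ref_elem_Hypercube, simp add: ref_elem_def)
  have "(\<chi> i. 1 / (real CARD('n) + 1)) \<in> (ref_elem r :: (real^'n) set)"
    by (cases r) (auto simp: ref_elem_def field_simps)
  then show "ref_elem r \<noteq> ({} :: (real^'n) set)" by auto
  show "bounded (ref_elem r :: (real^'n) set)"
    using bounded_subset[OF bounded_box ref_elem_subset_box] .
qed

lemma affine_inverse:
  fixes B :: "real^'n::finite^'n"
  assumes "invertible B"
  obtains B' c where "invertible B'" "inv (\<lambda>x. B *v x + b) = (\<lambda>x. B' *v x + c)"
    "\<And>x. B *v (B' *v x + c) + b = x" "\<And>x. B' *v (B *v x + b) + c = x"
proof -
  obtain B' where B': "B ** B' = mat 1" "B' ** B = mat 1"
    using assms unfolding invertible_def by auto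
  define c where "c = - (B' *v b)"
  have 1: "B *v (B' *v x + c) + b = x" for x
    using B' by (simp add: c_def matrix_vector_mult_diff_distrib matrix_vector_mul_assoc)
  have 2: "B' *v (B *v x + b) + c = x" for x
    using B' by (simp add: c_def matrix_vector_right_distrib matrix_vector_mul_assoc)
  have "inv (\<lambda>x. B *v x + b) = (\<lambda>x. B' *v x + c)"
    using 1 2 by (intro inv_equality) auto
  moreover have "invertible B'" using B' unfolding invertible_def by auto
  ultimately show thesis using 1 2 that by blast
qed

lemma affine_elem_inv:
  fixes F :: "real^'n::finite \<Rightarrow> real^'n"
  assumes "affine_elem r F T"
  shows "F (inv F x) = x" "inv F (F x) = x" "x \<in> T \<Longrightarrow> inv F x \<in> ref_elem r"
    "polynomial_function (inv F)"
proof -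
  obtain B b where F: "T = F ` ref_elem r" "invertible B" "F = (\<lambda>x. B *v x + b)"
    using assms by (auto simp: affine_elem_def)
  obtain B' c where B': "inv F = (\<lambda>x. B' *v x + c)" "\<And>x. F (inv F x) = x" "\<And>x. inv F (F x) = x"
    using affine_inverse[OF F(2), of b] F(3) by metis
  show inv: "F (inv F x) = x" "inv F (F x) = x" for x using B' by auto
  show "x \<in> T \<Longrightarrow> inv F x \<in> ref_elem r" using F(1) B' by auto
  have "polynomial_function (\<lambda>x. B *v x + b)" for B :: "real^'n^'n" and b
    by (intro polynomial_function_add polynomial_function_bounded_linear
        linear_linear[THEN iffD2] matrix_vector_mul_linear polynomial_function_const)
  then show "polynomial_function (inv F)" by (simp add: B'(1))
qed

lemma affine_elem_topology:
  assumes "affine_elem r F T"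
  shows open_affine_elem: "open T" and affine_elem_nonempty: "T \<noteq> {}" and bounded_affine_elem: "bounded T"
proof -
  obtain B b where F: "T = F ` ref_elem r" "invertible B" "F = (\<lambda>x. B *v x + b)"
    using assms by (auto simp: affine_elem_def)
  have T: "T = (+) b ` ((*v) B ` ref_elem r)" by (auto simp: F image_image add.commute)
  have "surj ((*v) B)" using F(2) by (simp add: invertible_eq_bij bij_is_surj)
  then show "open T" unfolding T
    by (intro open_translation open_surjective_linear_image open_ref_elem matrix_vector_mul_linear)
  show "T \<noteq> {}" using ref_elem_nonempty F(1) by auto
  show "bounded T" unfolding T
    by (intro bounded_translation bounded_linear_image bounded_ref_elem
        linear_linear[THEN iffD2] matrix_vector_mul_linear)
qed

section \<open>Affine automorphisms of the cube\<close>

text \<open>The row sum is the width of the range of the \<open>i\<close>-th component, attained at two opposite vertices; the map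
extends to the closed cube by continuity.\<close>

lemma cube_row_sum:
  fixes M :: "real^'n::finite^'n"
  assumes "\<And>y. y \<in> box 0 1 \<Longrightarrow> M *v y + c \<in> box 0 1"
  shows "(\<Sum>j\<in>UNIV. \<bar>M $ i $ j\<bar>) \<le> 1"
proof -
  have im: "(\<lambda>y. M *v y + c) ` closure (box 0 1) \<subseteq> cbox 0 1"
  proof (rule image_closure_subset)
    show "continuous_on (closure (box 0 1)) (\<lambda>y. M *v y + c)"
      by (intro continuous_intros linear_continuous_on linear_linear[THEN iffD2] matrix_vector_mul_linear)
    show "(\<lambda>y. M *v y + c) ` box 0 1 \<subseteq> cbox 0 1"
      using assms box_subset_cbox by fast
  qed auto
  have ne: "box 0 (1 :: real^'n) \<noteq> {}"
    using ref_elem_nonempty[of Hypercube] by (simp add: ref_elem_Hypercube)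
  have cb: "M *v y + c \<in> cbox 0 1" if "y \<in> cbox 0 1" for y
    using im that ne by (auto simp: closure_box)
  define y z :: "real^'n" where "y = (\<chi> j. if 0 < M $ i $ j then 1 else 0)"
    and "z = (\<chi> j. if 0 < M $ i $ j then 0 else 1)"
  have "y \<in> cbox 0 1" "z \<in> cbox 0 1" by (auto simp: y_def z_def mem_box_cart)
  then have "(M *v y + c) $ i \<le> 1" "0 \<le> (M *v z + c) $ i"
    using cb[of y] cb[of z] by (auto simp: mem_box_cart)
  then have "(M *v y) $ i - (M *v z) $ i \<le> 1" by simp
  also have "(M *v y) $ i - (M *v z) $ i = (\<Sum>j\<in>UNIV. \<bar>M $ i $ j\<bar>)"
    by (auto simp: matrix_vector_mult_def y_def z_def sum_subtractf[symmetric] intro!: sum.cong)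
  finally show ?thesis .
qed

text \<open>Both \<open>M\<close> and its inverse \<open>M'\<close> have row sums of moduli at most 1. Then \<open>1 = \<Sum>\<^sub>j M\<^sub>i\<^sub>j M'\<^sub>j\<^sub>i\<close> forces \<open>|M'\<^sub>j\<^sub>i| = 1\<close>
whenever \<open>M\<^sub>i\<^sub>j \<noteq> 0\<close>, so row \<open>j\<close> of \<open>M'\<close> has no other nonzero entry. Two nonzero entries in row \<open>i\<close> of \<open>M\<close> would
give two dependent rows of \<open>M'\<close>.\<close>

lemma cube_automorphism:
  fixes M :: "real^'n::finite^'n"
  assumes M: "invertible M" and im: "(\<lambda>y. M *v y + c) ` box 0 1 = box 0 1"
  obtains \<pi> where "inj \<pi>" "\<And>i j. j \<noteq> \<pi> i \<Longrightarrow> M $ i $ j = 0"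
proof -
  obtain M' c' where M': "invertible M'" "\<And>x. M *v (M' *v x + c') + c = x" "\<And>x. M' *v (M *v x + c) + c' = x"
    using affine_inverse[OF M] by metis
  have "M' *v y + c' \<in> box 0 1" if "y \<in> box 0 1" for y
  proof -
    have "y \<in> (\<lambda>y. M *v y + c) ` box 0 1" using im that by simp
    then obtain z where "z \<in> box 0 1" "y = M *v z + c" by blast
    then show ?thesis by (simp add: M')
  qed
  then have row': "(\<Sum>j\<in>UNIV. \<bar>M' $ i $ j\<bar>) \<le> 1" for i by (rule cube_row_sum)
  have row: "(\<Sum>j\<in>UNIV. \<bar>M $ i $ j\<bar>) \<le> 1" for i
    using im by (intro cube_row_sum) auto
  have lin: "M *v (M' *v x) = x" for x
  proof -
    have "M *v (M' *v x) = (M *v (M' *v x + c') + c) - (M *v (M' *v 0 + c') + c)"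
      by (simp add: matrix_vector_right_distrib)
    then show ?thesis by (simp only: M') simp
  qed
  have prod: "(\<Sum>j\<in>UNIV. M $ i $ j * M' $ j $ k) = (if i = k then 1 else 0)" for i k
  proof -
    have "M ** M' = mat 1" using lin by (simp add: matrix_eq matrix_vector_mul_assoc[symmetric])
    then have "(M ** M') $ i $ k = mat 1 $ i $ k" by simp
    then show ?thesis by (simp add: matrix_matrix_mult_def mat_def)
  qed
  have le1: "\<bar>M' $ j $ k\<bar> \<le> 1" for j k
    using row'[of j] member_le_sum[of k UNIV "\<lambda>k. \<bar>M' $ j $ k\<bar>"] by simp
  \<comment> \<open>Equality in \<open>1 = (M M')\<^sub>i\<^sub>i \<le> \<Sum>\<^sub>j |M\<^sub>i\<^sub>j| |M'\<^sub>j\<^sub>i| \<le> 1\<close>.\<close>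
  have one: "\<bar>M' $ j $ i\<bar> = 1" if "M $ i $ j \<noteq> 0" for i j
  proof (rule ccontr)
    assume "\<bar>M' $ j $ i\<bar> \<noteq> 1"
    then have lt: "\<bar>M' $ j $ i\<bar> < 1" using le1[of j i] by simp
    have "1 = \<bar>\<Sum>j\<in>UNIV. M $ i $ j * M' $ j $ i\<bar>" by (simp add: prod)
    also have "\<dots> \<le> (\<Sum>j\<in>UNIV. \<bar>M $ i $ j\<bar> * \<bar>M' $ j $ i\<bar>)"
      by (rule order_trans[OF sum_abs]) (simp add: abs_mult)
    also have "\<dots> < (\<Sum>j\<in>UNIV. \<bar>M $ i $ j\<bar>)"
    proof (rule sum_strict_mono_ex1)
      show "\<forall>j\<in>UNIV. \<bar>M $ i $ j\<bar> * \<bar>M' $ j $ i\<bar> \<le> \<bar>M $ i $ j\<bar>"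
        using le1 by (auto intro: mult_left_le)
      show "\<exists>j\<in>UNIV. \<bar>M $ i $ j\<bar> * \<bar>M' $ j $ i\<bar> < \<bar>M $ i $ j\<bar>"
        using lt that by (intro bexI[of _ j]) (auto simp: mult_less_cancel_left1)
    qed simp
    finally show False using row[of i] by simp
  qed
  have zero: "M' $ j $ k = 0" if "M $ i $ j \<noteq> 0" "k \<noteq> i" for i j k
  proof -
    have "\<bar>M' $ j $ i\<bar> + \<bar>M' $ j $ k\<bar> = (\<Sum>l\<in>{i, k}. \<bar>M' $ j $ l\<bar>)" using that by simp
    also have "\<dots> \<le> (\<Sum>l\<in>UNIV. \<bar>M' $ j $ l\<bar>)" by (rule sum_mono2) auto
    finally show ?thesis using one[OF that(1)] row'[of j] by simp
  qed
  have ex: "\<exists>j. M $ i $ j \<noteq> 0" for i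
  proof (rule ccontr)
    assume "\<not> ?thesis"
    then show False using prod[of i i] by simp
  qed
  define \<pi> where "\<pi> i = (SOME j. M $ i $ j \<noteq> 0)" for i
  have \<pi>: "M $ i $ \<pi> i \<noteq> 0" for i unfolding \<pi>_def using ex by (rule someI_ex)
  have "inj \<pi>"
  proof (rule injI, rule ccontr)
    fix i k assume "\<pi> i = \<pi> k" "i \<noteq> k"
    then show False using zero[OF \<pi>[of i], of k] one[OF \<pi>[of k]] by auto
  qed
  moreover have "M $ i $ j = 0" if "j \<noteq> \<pi> i" for i j
  proof (rule ccontr)
    assume nz: "M $ i $ j \<noteq> 0"
    define s t where "s = M' $ j $ i" and "t = M' $ \<pi> i $ i"
    \<comment> \<open>Rows j and \<open>\<pi> i\<close> of M' would be supported in column i only, hence dependent.\<close>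
    have r: "(M' *v x) $ j = s * x $ i" "(M' *v x) $ \<pi> i = t * x $ i" for x
    proof -
      have "(\<Sum>l\<in>UNIV. M' $ j $ l * x $ l) = (\<Sum>l\<in>{i}. M' $ j $ l * x $ l)"
        using zero[OF nz] by (intro sum.mono_neutral_right) auto
      then show "(M' *v x) $ j = s * x $ i" by (simp add: matrix_vector_mult_def s_def)
      have "(\<Sum>l\<in>UNIV. M' $ \<pi> i $ l * x $ l) = (\<Sum>l\<in>{i}. M' $ \<pi> i $ l * x $ l)"
        using zero[OF \<pi>] by (intro sum.mono_neutral_right) auto
      then show "(M' *v x) $ \<pi> i = t * x $ i" by (simp add: matrix_vector_mult_def t_def)
    qed
    obtain x where x: "M' *v x = axis j 1"
      using M'(1) by (metis invertible_eq_bij bij_pointE)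
    have "t \<noteq> 0" using one[OF \<pi>[of i]] by (auto simp: t_def)
    then have "x $ i = 0" using r(2)[of x] that by (simp add: x axis_def)
    then show False using r(1)[of x] by (simp add: x)
  qed
  ultimately show thesis by (rule that)
qed

section \<open>Uniform refinement of parallelepipeds\<close>

definition cube_vertices :: "(real^'n::finite) set" where
  "cube_vertices = {e. \<forall>i. e $ i = 0 \<or> e $ i = 1}"

lemma card_cube_vertices: "card (cube_vertices :: (real^'n::finite) set) = 2 ^ CARD('n)"
proof -
  have "bij_betw (\<lambda>S :: 'n set. \<chi> i. if i \<in> S then 1 else (0 :: real)) UNIV cube_vertices"
    by (rule bij_betwI[of _ _ _ "\<lambda>e. {i. e $ i = 1}"]) (auto simp: cube_vertices_def vec_eq_iff)
  then have "card (UNIV :: 'n set set) = card (cube_vertices :: (real^'n) set)" by (rule bij_betw_same_card)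
  then show ?thesis by (simp add: card_UNIV_set flip: Pow_UNIV card_Pow)
qed

lemma cube_child:
  fixes F :: "real^'n::finite \<Rightarrow> real^'n"
  assumes "F = (\<lambda>x. B *v x + b)" "T = F ` box 0 1"
  shows "midpoint (F e) ` T = F ` (\<lambda>y. (1/2) *\<^sub>R (e + y)) ` box 0 1"
proof -
  have "midpoint (F e) (F y) = F ((1/2) *\<^sub>R (e + y))" for y
    by (simp add: assms midpoint_def matrix_vector_right_distrib matrix_vector_mult_scaleR
        flip: scaleR_add_left) (simp add: scaleR_add_right flip: scaleR_add_left)
  then show ?thesis by (simp add: assms(2) image_image)
qed

lemma cube_vertex_extreme:
  fixes F :: "real^'n::finite \<Rightarrow> real^'n"
  assumes F: "affine_elem Hypercube F T" and e: "e \<in> cube_vertices"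
  shows "F e extreme_point_of closure T"
proof -
  obtain B b where FB: "T = F ` box 0 1" "F = (\<lambda>x. B *v x + b)"
    using F by (auto simp: affine_elem_def ref_elem_Hypercube)
  have ne: "box 0 (1 :: real^'n) \<noteq> {}" using ref_elem_nonempty[of Hypercube] by (simp add: ref_elem_Hypercube)
  have cont: "continuous_on S F" for S unfolding FB(2)
    by (intro continuous_intros linear_continuous_on linear_linear[THEN iffD2] matrix_vector_mul_linear)
  have "F ` closure (box 0 1) \<subseteq> closure T"
    using cont closure_subset[of T] unfolding FB(1) by (intro image_closure_subset) auto
  moreover have "closure T \<subseteq> F ` cbox 0 1"
    unfolding FB(1) using box_subset_cbox
    by (intro closure_minimal image_mono compact_imp_closed compact_continuous_image cont) auto
  ultimately have cl: "closure T = F ` cbox 0 1" using ne by (auto simp: closure_box)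
  have "F e \<in> closure T"
    unfolding cl using e by (intro imageI) (auto simp: cube_vertices_def mem_box_cart, metis order_refl zero_le_one, metis order_refl zero_le_one)
  moreover have False if xy: "x \<in> cbox 0 1" "y \<in> cbox 0 1" "F e \<in> open_segment (F x) (F y)" for x y
  proof -
    obtain u where u: "0 < u" "u < 1" "F e = (1 - u) *\<^sub>R F x + u *\<^sub>R F y" and ne: "F x \<noteq> F y"
      using xy(3) by (auto simp: in_segment)
    have "(1 - u) *\<^sub>R F x + u *\<^sub>R F y = F ((1 - u) *\<^sub>R x + u *\<^sub>R y)"
      by (simp add: FB(2) matrix_vector_right_distrib matrix_vector_mult_scaleR algebra_simps)
    then have "e = (1 - u) *\<^sub>R x + u *\<^sub>R y"
      using u(3) affine_elem_inv(2)[OF F] by metis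
    then have ei: "e $ i = (1 - u) * x $ i + u * y $ i" for i by simp
    have "x $ i = y $ i" for i
    proof -
      have b: "0 \<le> x $ i" "x $ i \<le> 1" "0 \<le> y $ i" "y $ i \<le> 1" using xy by (auto simp: mem_box_cart)
      consider "e $ i = 0" | "e $ i = 1" using e by (auto simp: cube_vertices_def)
      then show ?thesis
      proof cases
        case 1
        then show ?thesis using ei[of i] b u
          by (metis add_nonneg_eq_0_iff diff_gt_0_iff_gt less_eq_real_def mult_eq_0_iff mult_nonneg_nonneg not_less_iff_gr_or_eq)
      next
        case 2
        then have "(1 - u) * (1 - x $ i) + u * (1 - y $ i) = 0" using ei[of i] by (simp add: algebra_simps)
        moreover have "0 \<le> (1 - u) * (1 - x $ i)" "0 \<le> u * (1 - y $ i)" using u b by auto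
        ultimately have "(1 - u) * (1 - x $ i) = 0" "u * (1 - y $ i) = 0" by linarith+
        then show ?thesis using u by simp
      qed
    qed
    then have "x = y" by (simp add: vec_eq_iff)
    then show False using ne by simp
  qed
  ultimately show ?thesis by (auto simp: extreme_point_of_def cl)
qed

text \<open>The half-size copies of the parent at its \<open>2\<^sup>d\<close> vertices are pairwise different children, and there are only
\<open>2\<^sup>d\<close> children.\<close>

lemma hypercube_children:
  fixes \<T> :: "(real^'n::finite) set set"
  assumes F: "affine_elem Hypercube F T"
    and card: "card {T'\<in>\<T>. T' \<subseteq> T} = 2 ^ CARD('n)"
    and copies: "\<And>a. a extreme_point_of closure T \<Longrightarrow> midpoint a ` T \<in> \<T>"
    and T': "T' \<in> \<T>" "T' \<subseteq> T"
  obtains e where "T' = F ` (\<lambda>y. (1/2) *\<^sub>R (e + y)) ` box 0 1"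
proof -
  obtain B b where FB: "T = F ` box 0 1" "F = (\<lambda>x. B *v x + b)"
    using F by (auto simp: affine_elem_def ref_elem_Hypercube)
  define c :: "real^'n \<Rightarrow> (real^'n) set" where "c e = F ` (\<lambda>y. (1/2) *\<^sub>R (e + y)) ` box 0 1" for e
  have injF: "inj F" using affine_elem_inv(2)[OF F] by (metis injI)
  have sub: "c ` cube_vertices \<subseteq> {T'\<in>\<T>. T' \<subseteq> T}"
  proof safe
    fix e :: "real^'n" assume e: "e \<in> cube_vertices"
    show "c e \<in> \<T>"
      using copies[OF cube_vertex_extreme[OF F e]] cube_child[OF FB(2,1), of e] by (simp add: c_def)
    show "x \<in> T" if "x \<in> c e" for x
    proof -
      obtain y where y: "y \<in> box 0 1" "x = F ((1/2) *\<^sub>R (e + y))"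
        using \<open>x \<in> c e\<close> unfolding c_def by blast
      have "0 < ((1/2) *\<^sub>R (e + y)) $ i \<and> ((1/2) *\<^sub>R (e + y)) $ i < 1" for i
      proof -
        have "0 < y $ i" "y $ i < 1" "e $ i = 0 \<or> e $ i = 1"
          using y(1) e by (auto simp: cube_vertices_def mem_box_cart)
        then show ?thesis by auto
      qed
      then show ?thesis using y FB(1) by (auto simp: mem_box_cart)
    qed
  qed
  have inj: "inj_on c cube_vertices"
  proof (rule inj_onI, rule ccontr)
    fix e e' :: "real^'n" assume e: "e \<in> cube_vertices" "e' \<in> cube_vertices" "c e = c e'" "e \<noteq> e'"
    then have im: "(\<lambda>y. (1/2) *\<^sub>R (e + y)) ` box 0 1 = (\<lambda>y. (1/2) *\<^sub>R (e' + y)) ` box 0 1"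
      unfolding c_def using injF by (simp add: inj_image_eq_iff)
    obtain i where i: "e $ i \<noteq> e' $ i" using e(4) by (auto simp: vec_eq_iff)
    obtain y :: "real^'n" where y: "y \<in> box 0 1"
      using ref_elem_nonempty[of Hypercube] by (auto simp: ref_elem_Hypercube)
    then obtain z where z: "z \<in> box 0 1" "(1/2) *\<^sub>R (e + y) = (1/2) *\<^sub>R (e' + z)" using im by force
    then have "((1/2) *\<^sub>R (e + y)) $ i = ((1/2) *\<^sub>R (e' + z)) $ i" by simp
    then have "e $ i + y $ i = e' $ i + z $ i" by simp
    moreover have "0 < y $ i" "y $ i < 1" "0 < z $ i" "z $ i < 1" using y z by (auto simp: mem_box_cart)
    moreover have "e $ i = 0 \<or> e $ i = 1" "e' $ i = 0 \<or> e' $ i = 1" using e by (auto simp: cube_vertices_def)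
    ultimately show False using i by auto
  qed
  have "c ` cube_vertices = {T'\<in>\<T>. T' \<subseteq> T}"
  proof (rule card_subset_eq[OF _ sub])
    show "finite {T'\<in>\<T>. T' \<subseteq> T}" using card by (metis card.infinite power_not_zero zero_neq_numeral)
    show "card (c ` cube_vertices) = card {T'\<in>\<T>. T' \<subseteq> T}"
      using inj by (simp add: card_image card_cube_vertices card)
  qed
  then have "T' \<in> c ` cube_vertices" using T' by simp
  then obtain e where "T' = c e" by blast
  then show thesis using that[of e] by (simp add: c_def)
qed

lemma poly_space_child:
  fixes F F' :: "real^'n::finite \<Rightarrow> real^'n"
  assumes F: "affine_elem r F T" and F': "affine_elem r F' T'"
    and child: "r = Hypercube \<Longrightarrow> \<exists>e. T' = F ` (\<lambda>y. (1/2) *\<^sub>R (e + y)) ` box 0 1"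
    and q: "q \<in> poly_space r p"
  shows "(\<lambda>x. q (inv F (F' x))) \<in> poly_space r p"
proof -
  obtain B b where B: "invertible B" "F = (\<lambda>x. B *v x + b)" using F by (auto simp: affine_elem_def)
  obtain G g where G: "invertible G" "inv F = (\<lambda>x. G *v x + g)"
    using affine_inverse[OF B(1), of b] B(2) by metis
  obtain B' b' where B': "invertible B'" "F' = (\<lambda>x. B' *v x + b')" using F' by (auto simp: affine_elem_def)
  define M c where "M = G ** B'" and "c = G *v b' + g"
  have comp: "inv F (F' x) = M *v x + c" for x
    by (simp add: G B' M_def c_def matrix_vector_right_distrib matrix_vector_mul_assoc)
  have inv: "invertible M" using G B' by (simp add: M_def invertible_mult)
  show ?thesis
  proof (cases r)
    case Simplex
    then show ?thesis using simplex_poly_affine q by (simp add: comp)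
  next
    case Hypercube
    then obtain e where e: "T' = F ` (\<lambda>y. (1/2) *\<^sub>R (e + y)) ` box 0 1" using child by auto
    have "T' = F' ` box 0 1" using F' Hypercube by (auto simp: affine_elem_def ref_elem_Hypercube)
    then have "inv F ` F' ` box 0 1 = inv F ` F ` (\<lambda>y. (1/2) *\<^sub>R (e + y)) ` box 0 1" using e by simp
    then have im: "(\<lambda>x. M *v x + c) ` box 0 1 = (\<lambda>y. (1/2) *\<^sub>R (e + y)) ` box 0 1"
      by (simp add: image_image comp affine_elem_inv(2)[OF F])
    \<comment> \<open>Blowing the corner cube up to the unit cube gives an automorphism of the cube.\<close>
    have "(\<lambda>x. (2 *\<^sub>R M) *v x + (2 *\<^sub>R c - e)) ` box 0 1 = (\<lambda>x. 2 *\<^sub>R x - e) ` (\<lambda>x. M *v x + c) ` box 0 1"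
      by (simp add: image_image scaleR_matrix_vector_assoc[symmetric] algebra_simps)
    also have "\<dots> = box 0 1" unfolding im by (simp add: image_image scaleR_add_right)
    finally have im2: "(\<lambda>x. (2 *\<^sub>R M) *v x + (2 *\<^sub>R c - e)) ` box 0 1 = box 0 1" .
    have "invertible (2 *\<^sub>R M)"
    proof -
      obtain N where N: "M ** N = mat 1" "N ** M = mat 1" using inv by (auto simp: invertible_def)
      have "(2 *\<^sub>R M) ** ((1/2) *\<^sub>R N) = M ** N" "((1/2) *\<^sub>R N) ** (2 *\<^sub>R M) = N ** M"
        by (simp_all add: vec_eq_iff matrix_matrix_mult_def)
      then show ?thesis using N unfolding invertible_def by metis
    qed
    then obtain \<pi> where "inj \<pi>" "\<And>i j. j \<noteq> \<pi> i \<Longrightarrow> (2 *\<^sub>R M) $ i $ j = 0"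
      using im2 by (rule cube_automorphism) blast
    then show ?thesis using hypercube_poly_affine[of q p \<pi> M c] q Hypercube by (simp add: comp)
  qed
qed

section \<open>Piecewise continuous functions\<close>

lemma integrable_indicator_continuous:
  fixes g :: "'a::euclidean_space \<Rightarrow> 'b::euclidean_space"
  assumes "continuous_on UNIV g" "bounded S" "S \<in> sets lebesgue"
  shows "integrable lebesgue (\<lambda>x. indicat_real S x *\<^sub>R g x)"
proof -
  obtain a where a: "S \<subseteq> cbox (-a) a" using bounded_subset_cbox_symmetric assms(2) by blast
  have "g absolutely_integrable_on cbox (-a) a"
    using assms(1) by (intro absolutely_integrable_continuous) (auto intro: continuous_on_subset)
  then have "g absolutely_integrable_on S" by (rule set_integrable_subset) (use assms a in auto)
  then show ?thesis by (simp add: set_integrable_def)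
qed

text \<open>The elements of a mesh as disjoint open pieces of the domain. Their union omits the skeleton, on which functions are
set to zero, like the representatives chosen for \<open>V\<^sub>k\<close>.\<close>

locale broken =
  fixes \<Omega> :: "(real^'n::finite) set" and M :: "(real^'n) set set"
  assumes open_domain: "open \<Omega>"
    and finite_pieces: "finite M"
    and piece: "T \<in> M \<Longrightarrow> open T" "T \<in> M \<Longrightarrow> bounded T" "T \<in> M \<Longrightarrow> T \<noteq> {}" "T \<in> M \<Longrightarrow> T \<subseteq> \<Omega>"
    and disjoint_pieces: "T \<in> M \<Longrightarrow> T' \<in> M \<Longrightarrow> x \<in> T \<Longrightarrow> x \<in> T' \<Longrightarrow> T = T'"
begin

text \<open>The continuous function \<open>g\<close> is defined on the whole space. It provides the trace on the closure of the piece, its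
boundedness there, and closure under algebraic operations.\<close>

definition pw_continuous :: "(real^'n \<Rightarrow> 'b::euclidean_space) \<Rightarrow> bool" where
  "pw_continuous f \<longleftrightarrow> (\<forall>T\<in>M. \<exists>g. continuous_on UNIV g \<and> (\<forall>x\<in>T. f x = g x)) \<and> (\<forall>x. x \<notin> \<Union>M \<longrightarrow> f x = 0)"

lemma pw_piece:
  assumes "pw_continuous f" "T \<in> M"
  obtains g where "continuous_on UNIV g" "\<And>x. x \<in> T \<Longrightarrow> f x = g x"
  using assms unfolding pw_continuous_def by blast

lemma pw_outside: "pw_continuous f \<Longrightarrow> x \<notin> \<Union>M \<Longrightarrow> f x = 0"
  unfolding pw_continuous_def by blast

lemma pw_combine:
  assumes f: "pw_continuous f" and g: "pw_continuous g" and h: "continuous_on UNIV (\<lambda>z. h (fst z) (snd z))" "h 0 0 = 0"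
  shows "pw_continuous (\<lambda>x. h (f x) (g x))"
  unfolding pw_continuous_def
proof (intro conjI ballI allI impI)
  fix T assume T: "T \<in> M"
  obtain f' where f': "continuous_on UNIV f'" "\<And>x. x \<in> T \<Longrightarrow> f x = f' x" using pw_piece[OF f T] by blast
  obtain g' where g': "continuous_on UNIV g'" "\<And>x. x \<in> T \<Longrightarrow> g x = g' x" using pw_piece[OF g T] by blast
  have "continuous_on UNIV (\<lambda>x. h (f' x) (g' x))"
    using continuous_on_compose2[OF h(1) continuous_on_Pair[OF f'(1) g'(1)]] by simp
  then show "\<exists>k. continuous_on UNIV k \<and> (\<forall>x\<in>T. h (f x) (g x) = k x)" using f' g' by force
next
  show "h (f x) (g x) = 0" if "x \<notin> \<Union>M" for x
    using pw_outside[OF f that] pw_outside[OF g that] h(2) by simp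
qed

lemma pw_inner: "pw_continuous f \<Longrightarrow> pw_continuous g \<Longrightarrow> pw_continuous (\<lambda>x. f x \<bullet> g x)"
  by (rule pw_combine) (auto intro!: continuous_intros)

lemma pw_integrable:
  assumes f: "pw_continuous f"
  shows "integrable (lebesgue_on \<Omega>) f"
proof -
  have "\<forall>T\<in>M. \<exists>g. continuous_on UNIV g \<and> (\<forall>x\<in>T. f x = g x)" using f unfolding pw_continuous_def by blast
  then obtain g where g: "\<And>T. T \<in> M \<Longrightarrow> continuous_on UNIV (g T)" "\<And>T x. T \<in> M \<Longrightarrow> x \<in> T \<Longrightarrow> f x = g T x"
    by metis
  have "indicat_real \<Omega> x *\<^sub>R f x = (\<Sum>T\<in>M. indicat_real T x *\<^sub>R g T x)" for x
  proof (cases "x \<in> \<Union>M")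
    case True
    then obtain T where T: "T \<in> M" "x \<in> T" by auto
    have "(\<Sum>S\<in>M. indicat_real S x *\<^sub>R g S x) = (\<Sum>S\<in>{T}. indicat_real S x *\<^sub>R g S x)"
      using T disjoint_pieces by (intro sum.mono_neutral_right finite_pieces) (auto simp: indicator_def)
    then show ?thesis using T piece(4)[OF T(1)] g(2)[OF T] by auto
  next
    case False
    then show ?thesis using pw_outside[OF f False] by (auto simp: indicator_def intro!: sum.neutral)
  qed
  moreover have "integrable lebesgue (\<lambda>x. \<Sum>T\<in>M. indicat_real T x *\<^sub>R g T x)"
    using g piece by (intro Bochner_Integration.integrable_sum integrable_indicator_continuous) auto
  ultimately have "integrable lebesgue (\<lambda>x. indicat_real \<Omega> x *\<^sub>R f x)" by simp
  then show ?thesis using open_domain by (subst integrable_restrict_space) auto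
qed

text \<open>A point with a positive value has a neighbourhood in its piece with positive values, which is not a null set. The
conclusion is pointwise, also at the points off the pieces, since the function vanishes there.\<close>

lemma pw_eq_0_if_integral_eq_0:
  fixes f :: "real^'n \<Rightarrow> real"
  assumes f: "pw_continuous f" and nn: "\<And>x. 0 \<le> f x" and int: "(\<integral>x. f x \<partial>lebesgue_on \<Omega>) = 0"
  shows "f x = 0"
proof (rule ccontr)
  assume nz: "f x \<noteq> 0"
  then obtain T where T: "T \<in> M" "x \<in> T" using pw_outside[OF f] by blast
  obtain g where g: "continuous_on UNIV g" "\<And>x. x \<in> T \<Longrightarrow> f x = g x" using pw_piece[OF f T(1)] by blast
  have "AE x in lebesgue_on \<Omega>. f x = 0"
    using integral_nonneg_eq_0_iff_AE[OF pw_integrable[OF f]] nn int by simp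
  then have "AE x in lebesgue. x \<in> \<Omega> \<longrightarrow> f x = 0"
    using open_domain by (subst (asm) AE_restrict_space_iff) auto
  then obtain N where N: "N \<in> null_sets lebesgue" "{x. \<not> (x \<in> \<Omega> \<longrightarrow> f x = 0)} \<subseteq> N"
    by (auto simp: eventually_ae_filter)
  define U where "U = T \<inter> {x. g x \<noteq> 0}"
  have "open U" unfolding U_def
    using piece(1)[OF T(1)] g(1) by (intro open_Int open_Collect_neq continuous_on_const) auto
  moreover have "U \<noteq> {}" using T nz g by (auto simp: U_def)
  moreover have "negligible U"
    using N piece(4)[OF T(1)] g(2) by (intro negligible_subset[of N U]) (auto simp: U_def negligible_iff_null_sets)
  ultimately show False using open_not_negligible by blast
qed

definition l2 :: "(real^'n \<Rightarrow> 'b::euclidean_space) \<Rightarrow> (real^'n \<Rightarrow> 'b) \<Rightarrow> real" where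
  "l2 f g = (\<integral>x. f x \<bullet> g x \<partial>lebesgue_on \<Omega>)"

lemma l2_lin:
  assumes "pw_continuous f" "pw_continuous g" "pw_continuous h"
  shows "l2 f (c *\<^sub>R g + h) = c * l2 f g + l2 f h"
proof -
  have i: "integrable (lebesgue_on \<Omega>) (\<lambda>x. f x \<bullet> g x)" "integrable (lebesgue_on \<Omega>) (\<lambda>x. f x \<bullet> h x)"
    using assms by (auto intro: pw_integrable pw_inner)
  have "l2 f (c *\<^sub>R g + h) = (\<integral>x. c * (f x \<bullet> g x) + f x \<bullet> h x \<partial>lebesgue_on \<Omega>)"
    by (simp add: l2_def inner_add_right)
  then show ?thesis using i by (simp add: l2_def)
qed

lemma pd_form_l2:
  fixes W :: "(real^'n \<Rightarrow> 'b::euclidean_space) set"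
  assumes W: "subspace W" "\<And>f. f \<in> W \<Longrightarrow> pw_continuous f"
  shows "pd_form W l2"
proof
  show "l2 u v = l2 v u" for u v by (simp add: l2_def inner_commute)
  show "0 \<le> l2 u u" for u by (simp add: l2_def)
  show "u = 0" if "u \<in> W" "l2 u u = 0" for u
  proof
    fix x
    have "u x \<bullet> u x = 0"
      using that W(2) by (intro pw_eq_0_if_integral_eq_0[of "\<lambda>x. u x \<bullet> u x"] pw_inner) (auto simp: l2_def)
    then show "u x = 0 x" by simp
  qed
qed (use W in \<open>auto intro!: l2_lin\<close>)

lemma face_trace_eq:
  assumes T: "T \<in> M" and x: "x \<in> closure T" and g: "continuous_on UNIV g" "\<And>x. x \<in> T \<Longrightarrow> f x = g x"
  shows "face_trace T f x = g x"
  unfolding face_trace_def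
proof (rule tendsto_Lim)
  have "x islimpt T"
    using x piece(1)[OF T] islimpt_in_closure[of x T] open_imp_islimpt[of T x] unfolding closure_def by auto
  then show "\<not> trivial_limit (at x within T)" by (simp add: trivial_limit_within)
  have "(g \<longlongrightarrow> g x) (at x within T)"
    using g(1) by (meson UNIV_I continuous_on_def subset_UNIV tendsto_within_subset)
  moreover have "\<forall>\<^sub>F y in at x within T. g y = f y"
    unfolding eventually_at_filter using g(2) by (intro always_eventually) auto
  ultimately show "(f \<longlongrightarrow> g x) (at x within T)" by (rule Lim_transform_eventually)
qed

lemma face_trace_continuous:
  assumes "pw_continuous f" "T \<in> M"
  shows "continuous_on (closure T) (face_trace T f)"
proof -
  obtain g where g: "continuous_on UNIV g" "\<And>x. x \<in> T \<Longrightarrow> f x = g x" using pw_piece[OF assms] by blast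
  have "continuous_on (closure T) g" using g(1) by (rule continuous_on_subset) simp
  then show ?thesis
    by (rule continuous_on_cong[THEN iffD1, rotated -1]) (auto simp: face_trace_eq[OF assms(2) _ g])
qed

lemma face_trace_lin:
  assumes "pw_continuous f" "pw_continuous h" "T \<in> M" "x \<in> closure T"
  shows "face_trace T (c *\<^sub>R f + h) x = c *\<^sub>R face_trace T f x + face_trace T h x"
proof -
  obtain g where g: "continuous_on UNIV g" "\<And>x. x \<in> T \<Longrightarrow> f x = g x" using pw_piece[OF assms(1,3)] by blast
  obtain k where k: "continuous_on UNIV k" "\<And>x. x \<in> T \<Longrightarrow> h x = k x" using pw_piece[OF assms(2,3)] by blast
  have "face_trace T (c *\<^sub>R f + h) x = c *\<^sub>R g x + k x"
    using assms(3,4) g k by (intro face_trace_eq[where g = "\<lambda>x. c *\<^sub>R g x + k x"]) (auto intro!: continuous_intros)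
  then show ?thesis using face_trace_eq[OF assms(3,4) g] face_trace_eq[OF assms(3,4) k] by simp
qed

end

section \<open>Integrals over faces\<close>

lemma flat_normal:
  fixes F :: "(real^'n::finite) set"
  assumes "aff_dim F = int CARD('n) - 1"
  shows "\<exists>n. norm n = 1 \<and> (\<forall>x\<in>F. \<forall>y\<in>F. n \<bullet> (y - x) = 0)"
proof -
  obtain a b where ab: "a \<noteq> 0" "F \<subseteq> {x. a \<bullet> x = b}"
    using aff_lowdim_subset_hyperplane[of F] assms by auto
  have "(a /\<^sub>R norm a) \<bullet> (y - x) = 0" if "x \<in> F" "y \<in> F" for x y
  proof -
    have "a \<bullet> x = b" "a \<bullet> y = b" using ab(2) that by auto
    then show ?thesis by (simp add: inner_diff_right)
  qed
  moreover have "norm (a /\<^sub>R norm a) = 1" using ab(1) by simp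
  ultimately show ?thesis by blast
qed

text \<open>The prism over a compact flat set is compact, so the integrand, extended constantly along the normal, is continuous on a
compact set and hence integrable.\<close>

lemma face_integral_lin:
  fixes F :: "(real^'n::finite) set"
  assumes F: "compact F" "aff_dim F = int CARD('n) - 1"
    and g: "continuous_on F g" "continuous_on F h"
  shows "face_integral F (\<lambda>x. c * g x + h x) = c * face_integral F g + face_integral F h"
proof -
  define n where "n = (SOME n. norm n = 1 \<and> (\<forall>x\<in>F. \<forall>y\<in>F. n \<bullet> (y - x) = 0))"
  define a where "a = (SOME a. a \<in> F)"
  define foot where "foot z = z - (n \<bullet> (z - a)) *\<^sub>R n" for z
  define P where "P = {z. 0 \<le> n \<bullet> (z - a) \<and> n \<bullet> (z - a) \<le> 1 \<and> foot z \<in> F}"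
  have fi: "face_integral F g = (\<integral>z. g (foot z) \<partial>lebesgue_on P)" for g
    unfolding face_integral_def Let_def P_def foot_def n_def a_def by (rule refl)
  have n: "norm n = 1" unfolding n_def using someI_ex[OF flat_normal[OF F(2)]] by blast
  have "bounded P"
  proof -
    obtain R where R: "\<And>x. x \<in> F \<Longrightarrow> norm x \<le> R" using compact_imp_bounded[OF F(1)] unfolding bounded_iff by blast
    have "norm z \<le> R + 1" if "z \<in> P" for z
    proof -
      have "norm z \<le> norm (foot z) + norm ((n \<bullet> (z - a)) *\<^sub>R n)"
        using norm_triangle_ineq[of "foot z" "(n \<bullet> (z - a)) *\<^sub>R n"] by (simp add: foot_def)
      then show ?thesis using R[of "foot z"] that n by (auto simp: P_def)
    qed
    then show ?thesis by (auto simp: bounded_iff)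
  qed
  have cf: "continuous_on S foot" for S unfolding foot_def by (intro continuous_intros)
  have "closed P"
  proof -
    have "closed (foot -` F)"
      using cf[of UNIV] F(1) by (intro continuous_closed_vimage compact_imp_closed) (simp_all add: continuous_on_eq_continuous_at)
    moreover have "closed {z. 0 \<le> n \<bullet> (z - a)}" "closed {z. n \<bullet> (z - a) \<le> 1}"
      by (intro closed_Collect_le continuous_intros)+
    moreover have "P = {z. 0 \<le> n \<bullet> (z - a)} \<inter> {z. n \<bullet> (z - a) \<le> 1} \<inter> foot -` F" by (auto simp: P_def)
    ultimately show ?thesis by auto
  qed
  have cP: "compact P" using \<open>bounded P\<close> \<open>closed P\<close> by (simp add: compact_eq_bounded_closed)
  have int: "integrable (lebesgue_on P) (\<lambda>z. g (foot z))" if "continuous_on F g" for g :: "real^'n \<Rightarrow> real"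
  proof -
    have "continuous_on P (\<lambda>z. g (foot z))"
      by (rule continuous_on_compose2[OF that cf]) (auto simp: P_def)
    then have "integrable lborel (\<lambda>x. indicator P x *\<^sub>R g (foot x))"
      by (rule borel_integrable_compact[OF cP])
    then have "integrable lebesgue (\<lambda>x. indicator P x *\<^sub>R g (foot x))"
      by (subst integrable_completion) (auto dest: borel_measurable_integrable)
    then show ?thesis using \<open>closed P\<close> by (subst integrable_restrict_space) auto
  qed
  show ?thesis unfolding fi using int[OF g(1)] int[OF g(2)] by simp
qed

lemma face_integral_cong:
  assumes "\<And>x. x \<in> F \<Longrightarrow> g x = h x"
  shows "face_integral F g = face_integral F h"
  unfolding face_integral_def Let_def using assms
  by (intro Bochner_Integration.integral_cong refl) simp

lemma face_integral_nonneg: "(\<And>x. 0 \<le> g x) \<Longrightarrow> 0 \<le> face_integral F g"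
  by (simp add: face_integral_def Let_def)

section \<open>The discontinuous finite element space\<close>

lemma real_polynomial_function_derivative:
  assumes "real_polynomial_function f"
  shows "\<exists>f'. (\<forall>x. (f has_derivative f' x) (at x)) \<and> (\<forall>h. continuous_on UNIV (\<lambda>x. f' x h))"
  using assms
proof (induction f rule: real_polynomial_function.induct)
  case (linear f)
  then show ?case
    by (intro exI[of _ "\<lambda>x. f"]) (auto intro: bounded_linear_imp_has_derivative)
next
  case (const c)
  show ?case by (intro exI[of _ "\<lambda>x h. 0"]) auto
next
  case (add f g)
  then obtain f' g' where d: "\<And>x. (f has_derivative f' x) (at x)" "\<And>h. continuous_on UNIV (\<lambda>x. f' x h)"
    "\<And>x. (g has_derivative g' x) (at x)" "\<And>h. continuous_on UNIV (\<lambda>x. g' x h)" by blast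
  then show ?case
    by (intro exI[of _ "\<lambda>x h. f' x h + g' x h"]) (auto intro!: has_derivative_add continuous_intros)
next
  case (mult f g)
  then obtain f' g' where d: "\<And>x. (f has_derivative f' x) (at x)" "\<And>h. continuous_on UNIV (\<lambda>x. f' x h)"
    "\<And>x. (g has_derivative g' x) (at x)" "\<And>h. continuous_on UNIV (\<lambda>x. g' x h)" by blast
  moreover have "continuous_on UNIV f" "continuous_on UNIV g"
    using mult by (auto simp: real_polynomial_function_eq intro: continuous_on_polymonial_function)
  ultimately show ?case
    by (intro exI[of _ "\<lambda>x h. f x * g' x h + f' x h * g x"]) (auto intro!: has_derivative_mult continuous_intros)
qed

locale dg_level =
  fixes \<Omega> :: "(real^'n::finite) set" and D :: "'n disc" and k :: nat
  assumes domain: "polyhedral_domain \<Omega>" and disc: "discretization \<Omega> D"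
    and level: "1 \<le> k" "k \<le> levels D"
begin

lemma level_facts:
  shows dmn: "dmn D = \<Omega>" and partition: "partition_of \<Omega> (mesh D k)"
    and elem: "T \<in> mesh D k \<Longrightarrow> affine_elem (kind D) (emap D k T) T"
    and alpha_pos: "0 < alpha D k" and refbasis: "orthonormal_refbasis D k"
    and spectrum: "l \<in> Aop_spectrum D k \<Longrightarrow> \<bar>l\<bar> \<le> bnd D k"
proof -
  note d = disc[unfolded discretization_def]
  have k: "k \<in> {1..levels D}" using level by simp
  note dk = d[THEN conjunct2, THEN conjunct2, THEN conjunct2, THEN conjunct1, THEN bspec, OF k]
  show "dmn D = \<Omega>" using d by (rule conjunct1)
  show "partition_of \<Omega> (mesh D k)" using dk by (rule conjunct1)
  show "T \<in> mesh D k \<Longrightarrow> affine_elem (kind D) (emap D k T) T"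
    unfolding affine_elem_def using dk[THEN conjunct2, THEN conjunct1] by (rule bspec)
  show "0 < alpha D k" "orthonormal_refbasis D k" "l \<in> Aop_spectrum D k \<Longrightarrow> \<bar>l\<bar> \<le> bnd D k"
    using dk[THEN conjunct2, THEN conjunct2] by blast+
qed

lemma open_dmn: "open \<Omega>"
  using domain by (simp add: polyhedral_domain_def)

text \<open>The partition covers the closure of \<open>\<Omega>\<close>, so an element could a priori touch points of a slit. It does not, because
\<open>\<Omega>\<close> is the interior of a closed set.\<close>

lemma elem_subset_domain:
  assumes T: "T \<in> mesh D k"
  shows "T \<subseteq> \<Omega>"
proof -
  obtain P where P: "finite P" "\<forall>p\<in>P. polytope p" "\<Omega> = interior (\<Union>P)"
    using domain unfolding polyhedral_domain_def by blast
  have "closed (\<Union>P)" using P by (intro closed_Union) (auto intro: polytope_imp_closed)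
  then have "closure \<Omega> \<subseteq> \<Union>P" using P(3) by (simp add: closure_minimal interior_subset)
  moreover have "T \<subseteq> closure \<Omega>"
    using partition T closure_subset[of T] unfolding partition_of_def by blast
  moreover have "open T" using open_affine_elem[OF elem[OF T]] .
  ultimately show ?thesis unfolding P(3) by (intro interior_maximal) auto
qed

sublocale broken \<Omega> "mesh D k"
proof
  show "finite (mesh D k)" using partition by (simp add: partition_of_def)
  show "T = T'" if "T \<in> mesh D k" "T' \<in> mesh D k" "x \<in> T" "x \<in> T'" for T T' x
    using partition that unfolding partition_of_def pairwise_def disjnt_def by blast
qed (use open_dmn affine_elem_topology[OF elem] elem_subset_domain in auto)

lemma V_piece:
  assumes v: "v \<in> V D k" and T: "T \<in> mesh D k"
  obtains g where "real_polynomial_function g" "\<And>x. x \<in> T \<Longrightarrow> v x = g x"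
proof -
  let ?F = "emap D k T"
  obtain q where q: "q \<in> poly_space (kind D) (deg D k)" "\<forall>x\<in>ref_elem (kind D). v (?F x) = q x"
    using v T unfolding V_def by blast
  note F = affine_elem_inv[OF elem[OF T]]
  have "real_polynomial_function (q \<circ> inv ?F)"
    using F(4) real_polynomial_function_poly_space[OF q(1)] by (rule real_polynomial_function_compose)
  moreover have "v x = (q \<circ> inv ?F) x" if "x \<in> T" for x
    using q(2) F(3)[OF that] F(1)[of x] by force
  ultimately show thesis by (rule that)
qed

lemma V_outside: "v \<in> V D k \<Longrightarrow> x \<notin> \<Union>(mesh D k) \<Longrightarrow> v x = 0"
  unfolding V_def by blast

lemma V_pw:
  assumes v: "v \<in> V D k"
  shows "pw_continuous v"
  unfolding pw_continuous_def
proof (intro conjI ballI allI impI)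
  fix T assume T: "T \<in> mesh D k"
  obtain g where g: "real_polynomial_function g" "\<And>x. x \<in> T \<Longrightarrow> v x = g x"
    using V_piece[OF v T] by blast
  then have "continuous_on UNIV g"
    by (simp add: real_polynomial_function_eq continuous_on_polymonial_function)
  then show "\<exists>g. continuous_on UNIV g \<and> (\<forall>x\<in>T. v x = g x)" using g(2) by blast
qed (rule V_outside[OF v])

lemma subspace_V: "subspace (V D k)"
proof (rule subspaceI)
  show "0 \<in> V D k"
    unfolding V_def using subspace_0[OF subspace_poly_space] by (auto intro!: bexI[of _ 0])
  show "u + v \<in> V D k" if uv: "u \<in> V D k" "v \<in> V D k" for u v
  proof -
    have "\<exists>q\<in>poly_space (kind D) (deg D k). \<forall>x\<in>ref_elem (kind D). (u + v) (emap D k T x) = q x"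
      if T: "T \<in> mesh D k" for T
    proof -
      obtain q where q: "q \<in> poly_space (kind D) (deg D k)" "\<forall>x\<in>ref_elem (kind D). u (emap D k T x) = q x"
        using uv T unfolding V_def by blast
      obtain q' where q': "q' \<in> poly_space (kind D) (deg D k)" "\<forall>x\<in>ref_elem (kind D). v (emap D k T x) = q' x"
        using uv T unfolding V_def by blast
      show ?thesis using q q' by (intro bexI[of _ "q + q'"] subspace_add[OF subspace_poly_space]) auto
    qed
    then show ?thesis using V_outside uv unfolding V_def by auto
  qed
  show "c *\<^sub>R u \<in> V D k" if u: "u \<in> V D k" for c u
  proof -
    have "\<exists>q\<in>poly_space (kind D) (deg D k). \<forall>x\<in>ref_elem (kind D). (c *\<^sub>R u) (emap D k T x) = q x"
      if T: "T \<in> mesh D k" for T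
    proof -
      obtain q where q: "q \<in> poly_space (kind D) (deg D k)" "\<forall>x\<in>ref_elem (kind D). u (emap D k T x) = q x"
        using u T unfolding V_def by blast
      show ?thesis using q by (intro bexI[of _ "c *\<^sub>R q"] subspace_scale[OF subspace_poly_space]) auto
    qed
    then show ?thesis using V_outside[OF u] unfolding V_def by auto
  qed
qed

lemma subspace_Vvec: "subspace (Vvec D k)"
proof (rule subspaceI)
  show "0 \<in> Vvec D k" using subspace_0[OF subspace_V] by (simp add: Vvec_def zero_fun_def)
  show "u + v \<in> Vvec D k" if "u \<in> Vvec D k" "v \<in> Vvec D k" for u v
    unfolding Vvec_def
  proof (rule CollectI, rule allI)
    fix i
    have "(\<lambda>x. u x $ i) + (\<lambda>x. v x $ i) \<in> V D k"
      using that by (intro subspace_add[OF subspace_V]) (auto simp: Vvec_def)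
    then show "(\<lambda>x. (u + v) x $ i) \<in> V D k" by (simp add: plus_fun_def)
  qed
  show "c *\<^sub>R u \<in> Vvec D k" if "u \<in> Vvec D k" for c u
    unfolding Vvec_def
  proof (rule CollectI, rule allI)
    fix i
    have "c *\<^sub>R (\<lambda>x. u x $ i) \<in> V D k"
      using that by (intro subspace_scale[OF subspace_V]) (auto simp: Vvec_def)
    then show "(\<lambda>x. (c *\<^sub>R u) x $ i) \<in> V D k" by (simp add: scaleR_fun_def)
  qed
qed

lemma Vvec_pw:
  assumes "\<eta> \<in> Vvec D k"
  shows "pw_continuous \<eta>"
  unfolding pw_continuous_def
proof (intro conjI ballI allI impI)
  fix T assume T: "T \<in> mesh D k"
  have "\<forall>i. \<exists>g. continuous_on UNIV g \<and> (\<forall>x\<in>T. \<eta> x $ i = g x)"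
    using assms V_pw T unfolding Vvec_def pw_continuous_def by blast
  then obtain g where g: "\<And>i. continuous_on UNIV (g i)" "\<And>i x. x \<in> T \<Longrightarrow> \<eta> x $ i = g i x" by metis
  show "\<exists>g. continuous_on UNIV g \<and> (\<forall>x\<in>T. \<eta> x = g x)"
    using g by (intro exI[of _ "\<lambda>x. \<chi> i. g i x"]) (auto intro!: continuous_on_vec_lambda simp: vec_eq_iff)
next
  show "\<eta> x = 0" if "x \<notin> \<Union>(mesh D k)" for x
    using assms V_outside that unfolding Vvec_def by (auto simp: vec_eq_iff)
qed

abbreviation "idx \<equiv> mesh D k \<times> refbasis D k"

lemma finite_idx: "finite idx"
  using finite_pieces refbasis by (simp add: orthonormal_refbasis_def)

lemma basis_fun_on:
  assumes "T \<in> mesh D k" "T' \<in> mesh D k" "x \<in> ref_elem (kind D)"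
  shows "basis_fun D k (T', b) (emap D k T x) = (if T' = T then b x else 0)"
proof -
  have "emap D k T x \<in> T" using elem[OF assms(1)] assms(3) by (auto simp: affine_elem_def)
  then show ?thesis
    using disjoint_pieces[of T' T] assms affine_elem_inv(2)[OF elem[OF assms(1)]]
    by (auto simp: basis_fun_def)
qed

lemma sum_basis_on:
  assumes T: "T \<in> mesh D k" and x: "x \<in> ref_elem (kind D)"
  shows "(\<Sum>i\<in>idx. c i * basis_fun D k i (emap D k T x)) = (\<Sum>b\<in>refbasis D k. c (T, b) * b x)"
proof -
  have "(\<Sum>i\<in>idx. c i * basis_fun D k i (emap D k T x))
      = (\<Sum>T'\<in>mesh D k. \<Sum>b\<in>refbasis D k. c (T', b) * basis_fun D k (T', b) (emap D k T x))"
    by (simp add: sum.cartesian_product split_def)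
  also have "\<dots> = (\<Sum>T'\<in>mesh D k. if T' = T then \<Sum>b\<in>refbasis D k. c (T, b) * b x else 0)"
    by (intro sum.cong refl) (simp add: basis_fun_on[OF T _ x])
  also have "\<dots> = (\<Sum>b\<in>refbasis D k. c (T, b) * b x)"
    using T finite_pieces by simp
  finally show ?thesis .
qed

lemma basis_fun_outside: "i \<in> idx \<Longrightarrow> x \<notin> \<Union>(mesh D k) \<Longrightarrow> basis_fun D k i x = 0"
  by (cases i) (auto simp: basis_fun_def)

lemma sum_basis_in_V: "(\<lambda>x. \<Sum>i\<in>idx. c i * basis_fun D k i x) \<in> V D k"
proof -
  have poly: "(\<lambda>x. \<Sum>b\<in>refbasis D k. c (T, b) * b x) \<in> poly_space (kind D) (deg D k)" for T
  proof -
    have "(\<Sum>b\<in>refbasis D k. c (T, b) *\<^sub>R b) \<in> poly_space (kind D) (deg D k)"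
      using refbasis unfolding orthonormal_refbasis_def
      by (intro subspace_sum subspace_scale subspace_poly_space) auto
    moreover have "(\<Sum>b\<in>refbasis D k. c (T, b) *\<^sub>R b) = (\<lambda>x. \<Sum>b\<in>refbasis D k. c (T, b) * b x)"
      by (simp add: fun_eq_iff sum_fun_apply)
    ultimately show ?thesis by simp
  qed
  show ?thesis unfolding V_def
  proof (intro CollectI conjI ballI allI impI)
    fix T assume T: "T \<in> mesh D k"
    show "\<exists>q\<in>poly_space (kind D) (deg D k). \<forall>x\<in>ref_elem (kind D).
        (\<Sum>i\<in>idx. c i * basis_fun D k i (emap D k T x)) = q x"
      by (rule bexI[OF _ poly[of T]]) (simp add: sum_basis_on[OF T])
  next
    fix x assume "x \<notin> \<Union>(mesh D k)"
    then have "c i * basis_fun D k i x = 0" if "i \<in> idx" for i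
      using basis_fun_outside[OF that, of x] by simp
    then show "(\<Sum>i\<in>idx. c i * basis_fun D k i x) = 0" by (intro sum.neutral ballI)
  qed
qed

lemma V_expand:
  assumes v: "v \<in> V D k"
  obtains c where "\<And>i. i \<notin> idx \<Longrightarrow> c i = 0" "v = (\<lambda>x. \<Sum>i\<in>idx. c i * basis_fun D k i x)"
proof -
  have "\<forall>T\<in>mesh D k. \<exists>c. \<forall>x\<in>ref_elem (kind D). v (emap D k T x) = (\<Sum>b\<in>refbasis D k. c b * b x)"
  proof
    fix T assume T: "T \<in> mesh D k"
    obtain q where q: "q \<in> poly_space (kind D) (deg D k)" "\<forall>x\<in>ref_elem (kind D). v (emap D k T x) = q x"
      using v T unfolding V_def by blast
    obtain c where "q = (\<lambda>x. \<Sum>b\<in>refbasis D k. c b * b x)"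
      using refbasis q(1) unfolding orthonormal_refbasis_def by blast
    then show "\<exists>c. \<forall>x\<in>ref_elem (kind D). v (emap D k T x) = (\<Sum>b\<in>refbasis D k. c b * b x)"
      using q(2) by auto
  qed
  from bchoice[OF this] obtain c where c: "\<And>T x. T \<in> mesh D k \<Longrightarrow> x \<in> ref_elem (kind D) \<Longrightarrow>
      v (emap D k T x) = (\<Sum>b\<in>refbasis D k. c T b * b x)" by blast
  define c' where "c' i = (if i \<in> idx then c (fst i) (snd i) else 0)" for i
  have "v x = (\<Sum>i\<in>idx. c' i * basis_fun D k i x)" for x
  proof (cases "x \<in> \<Union>(mesh D k)")
    case True
    then obtain T where T: "T \<in> mesh D k" "x \<in> T" by auto
    then obtain y where y: "y \<in> ref_elem (kind D)" "x = emap D k T y"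
      using elem[OF T(1)] by (auto simp: affine_elem_def)
    show ?thesis unfolding y(2) sum_basis_on[OF T(1) y(1)] c[OF T(1) y(1)]
      using T by (intro sum.cong) (auto simp: c'_def)
  next
    case False
    then show ?thesis using V_outside[OF v False] basis_fun_outside by (simp add: sum.neutral)
  qed
  then show thesis by (intro that[of c']) (auto simp: c'_def)
qed

text \<open>Orthonormality: the coefficient of \<open>b\<close> is the integral of the combination against \<open>b\<close> over the reference element.\<close>

lemma refbasis_independent:
  assumes z: "\<And>x. x \<in> ref_elem (kind D) \<Longrightarrow> (\<Sum>b\<in>refbasis D k. c b * b x) = 0" and b: "b \<in> refbasis D k"
  shows "c b = 0"
proof -
  let ?R = "ref_elem (kind D) :: (real^'n) set"
  have R: "?R \<in> sets lebesgue" by (rule fmeasurableD[OF lmeasurable_open[OF bounded_ref_elem open_ref_elem]])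
  have rb: "finite (refbasis D k)"
    "\<And>b. b \<in> refbasis D k \<Longrightarrow> real_polynomial_function b"
    "\<And>b b'. b \<in> refbasis D k \<Longrightarrow> b' \<in> refbasis D k \<Longrightarrow> (\<integral>x. b x * b' x \<partial>lebesgue_on ?R) = (if b = b' then 1 else 0)"
    using refbasis real_polynomial_function_poly_space unfolding orthonormal_refbasis_def by blast+
  have "integrable (lebesgue_on ?R) (\<lambda>x. b' x * b x)" if "b' \<in> refbasis D k" for b'
  proof -
    have "real_polynomial_function (\<lambda>x. b' x * b x)"
      using rb(2)[OF that] rb(2)[OF b] by (rule real_polynomial_function.intros(4))
    then have "continuous_on UNIV (\<lambda>x. b' x * b x)"
      by (simp add: real_polynomial_function_eq continuous_on_polymonial_function)
    then have "integrable lebesgue (\<lambda>x. indicat_real ?R x *\<^sub>R (b' x * b x))"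
      by (rule integrable_indicator_continuous) (use bounded_ref_elem R in auto)
    then show ?thesis using R by (subst integrable_restrict_space) auto
  qed
  then have "(\<integral>x. (\<Sum>b'\<in>refbasis D k. c b' * (b' x * b x)) \<partial>lebesgue_on ?R)
      = (\<Sum>b'\<in>refbasis D k. c b' * (\<integral>x. b' x * b x \<partial>lebesgue_on ?R))"
    by (subst Bochner_Integration.integral_sum) auto
  also have "\<dots> = (\<Sum>b'\<in>refbasis D k. if b' = b then c b' else 0)"
    using rb(3)[OF _ b] by (intro sum.cong) auto
  also have "\<dots> = c b" using b rb(1) by simp
  finally have "c b = (\<integral>x. (\<Sum>b'\<in>refbasis D k. c b' * b' x) * b x \<partial>lebesgue_on ?R)"
    by (simp add: sum_distrib_right mult.assoc)
  also have "\<dots> = (\<integral>x. 0 \<partial>lebesgue_on ?R)"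
    using z by (intro Bochner_Integration.integral_cong) auto
  finally show ?thesis by simp
qed

lemma coord_unique:
  assumes c: "\<And>i. i \<notin> idx \<Longrightarrow> c i = 0" and d: "\<And>i. i \<notin> idx \<Longrightarrow> d i = 0"
    and eq: "(\<lambda>x. \<Sum>i\<in>idx. c i * basis_fun D k i x) = (\<lambda>x. \<Sum>i\<in>idx. d i * basis_fun D k i x)"
  shows "c = d"
proof
  fix i
  show "c i = d i"
  proof (cases "i \<in> idx")
    case True
    then obtain T b where i: "i = (T, b)" "T \<in> mesh D k" "b \<in> refbasis D k" by auto
    have "c (T, b) - d (T, b) = 0"
    proof (rule refbasis_independent[where c = "\<lambda>b. c (T, b) - d (T, b)"])
      fix x :: "real^'n" assume x: "x \<in> ref_elem (kind D)"
      show "(\<Sum>b\<in>refbasis D k. (c (T, b) - d (T, b)) * b x) = 0"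
        using fun_cong[OF eq, of "emap D k T x"] unfolding sum_basis_on[OF i(2) x]
        by (simp add: left_diff_distrib sum_subtractf)
    qed fact
    then show ?thesis using i by simp
  qed (use c d in auto)
qed

lemma coord_eqI:
  assumes "\<And>i. i \<notin> idx \<Longrightarrow> c i = 0" "u = (\<lambda>x. \<Sum>i\<in>idx. c i * basis_fun D k i x)"
  shows "coord D k u = c"
  unfolding coord_def
proof (rule the_equality)
  show "(\<forall>i. i \<notin> idx \<longrightarrow> c i = 0) \<and> u = (\<lambda>x. \<Sum>i\<in>idx. c i * basis_fun D k i x)" using assms by blast
  show "d = c" if "(\<forall>i. i \<notin> idx \<longrightarrow> d i = 0) \<and> u = (\<lambda>x. \<Sum>i\<in>idx. d i * basis_fun D k i x)" for d
  proof (rule coord_unique)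
    show "(\<lambda>x. \<Sum>i\<in>idx. d i * basis_fun D k i x) = (\<lambda>x. \<Sum>i\<in>idx. c i * basis_fun D k i x)"
      using that[THEN conjunct2] assms(2) by (rule trans[OF sym])
  qed (use that assms(1) in blast)+
qed

lemma coord_spec:
  assumes "u \<in> V D k"
  shows "i \<notin> idx \<Longrightarrow> coord D k u i = 0" "u = (\<lambda>x. \<Sum>i\<in>idx. coord D k u i * basis_fun D k i x)"
proof -
  obtain c where c: "\<And>i. i \<notin> idx \<Longrightarrow> c i = 0" "u = (\<lambda>x. \<Sum>i\<in>idx. c i * basis_fun D k i x)"
    using V_expand[OF assms] by blast
  have e: "coord D k u = c" using c by (rule coord_eqI)
  show "i \<notin> idx \<Longrightarrow> coord D k u i = 0" unfolding e by (rule c(1))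
  show "u = (\<lambda>x. \<Sum>i\<in>idx. coord D k u i * basis_fun D k i x)" unfolding e by (rule c(2))
qed

lemma coord_lin:
  assumes u: "u \<in> V D k" and v: "v \<in> V D k"
  shows "coord D k (c *\<^sub>R u + v) i = c * coord D k u i + coord D k v i"
proof -
  have "coord D k (c *\<^sub>R u + v) = (\<lambda>i. c * coord D k u i + coord D k v i)"
  proof (rule coord_eqI)
    show "c *\<^sub>R u + v = (\<lambda>x. \<Sum>i\<in>idx. (c * coord D k u i + coord D k v i) * basis_fun D k i x)"
    proof
      fix x
      have "(c *\<^sub>R u + v) x = c * (\<Sum>i\<in>idx. coord D k u i * basis_fun D k i x)
          + (\<Sum>i\<in>idx. coord D k v i * basis_fun D k i x)"
        unfolding plus_fun_apply scaleR_fun_apply real_scaleR_def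
        by (rule arg_cong2[where f = "\<lambda>a b. c * a + b", OF fun_cong[OF coord_spec(2)[OF u]] fun_cong[OF coord_spec(2)[OF v]]])
      then show "(c *\<^sub>R u + v) x = (\<Sum>i\<in>idx. (c * coord D k u i + coord D k v i) * basis_fun D k i x)"
        by (simp add: sum.distrib distrib_right sum_distrib_left mult.assoc)
    qed
  next
    show "c * coord D k u i + coord D k v i = 0" if "i \<notin> idx" for i
      using coord_spec(1)[OF u that] coord_spec(1)[OF v that] by simp
  qed
  then show ?thesis by simp
qed

lemma V_span: "V D k = span (basis_fun D k ` idx)"
proof
  show "V D k \<subseteq> span (basis_fun D k ` idx)"
  proof
    fix v assume "v \<in> V D k"
    then have "v = (\<lambda>x. \<Sum>i\<in>idx. coord D k v i * basis_fun D k i x)" by (rule coord_spec(2))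
    also have "\<dots> = (\<Sum>i\<in>idx. coord D k v i *\<^sub>R basis_fun D k i)"
      by (simp add: fun_eq_iff sum_fun_apply)
    also have "\<dots> \<in> span (basis_fun D k ` idx)"
      by (intro span_sum span_scale) (auto intro: span_base)
    finally show "v \<in> span (basis_fun D k ` idx)" .
  qed
  show "span (basis_fun D k ` idx) \<subseteq> V D k"
  proof (rule span_minimal[OF _ subspace_V], rule image_subsetI)
    fix i assume i: "i \<in> idx"
    have "(\<lambda>x. \<Sum>j\<in>idx. (if j = i then 1 else 0) * basis_fun D k j x) = basis_fun D k i"
      using i finite_idx by (simp add: if_distrib[of "\<lambda>c. c * _"] cong: if_cong)
    then show "basis_fun D k i \<in> V D k" using sum_basis_in_V[of "\<lambda>j. if j = i then 1 else 0"] by simp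
  qed
qed

text \<open>Vector-valued functions are combinations of scalar ones placed in the coordinate directions.\<close>

lemma Vvec_span: "\<exists>B. finite B \<and> Vvec D k = span B"
proof -
  define emb :: "'n \<Rightarrow> (real^'n \<Rightarrow> real) \<Rightarrow> real^'n \<Rightarrow> real^'n" where "emb j v x = v x *\<^sub>R axis j 1" for j v x
  have lin: "linear (emb j)" for j
    by (rule linearI) (auto simp: emb_def fun_eq_iff scaleR_add_left)
  define B where "B = (\<Union>j. emb j ` (basis_fun D k ` idx))"
  have emb: "emb j v \<in> Vvec D k" if "v \<in> V D k" for j v
  proof -
    have "(\<lambda>x. emb j v x $ i) = (if i = j then v else 0)" for i
      by (auto simp: emb_def axis_def fun_eq_iff)
    then show ?thesis using that subspace_0[OF subspace_V] by (simp add: Vvec_def)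
  qed
  have "emb j (basis_fun D k i) \<in> Vvec D k" if "i \<in> idx" for i j
  proof (rule emb)
    show "basis_fun D k i \<in> V D k" unfolding V_span using that by (intro span_base imageI)
  qed
  then have "span B \<subseteq> Vvec D k"
    unfolding B_def by (intro span_minimal subspace_Vvec) blast
  moreover have "\<eta> \<in> span B" if "\<eta> \<in> Vvec D k" for \<eta>
  proof -
    have eq: "\<eta> = (\<Sum>j\<in>UNIV. emb j (\<lambda>x. \<eta> x $ j))"
      by (auto simp: fun_eq_iff sum_fun_apply emb_def vec_eq_iff axis_def if_distrib cong: if_cong)
    have "emb j (\<lambda>x. \<eta> x $ j) \<in> span B" for j
    proof -
      have "emb j (\<lambda>x. \<eta> x $ j) \<in> emb j ` span (basis_fun D k ` idx)"
        using that by (intro imageI) (simp add: Vvec_def flip: V_span)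
      also have "\<dots> = span (emb j ` basis_fun D k ` idx)" using lin by (rule linear_span_image[symmetric])
      also have "\<dots> \<subseteq> span B" by (rule span_mono) (auto simp: B_def)
      finally show ?thesis .
    qed
    then show ?thesis by (subst eq) (rule span_sum)
  qed
  moreover have "finite B" unfolding B_def using finite_idx by auto
  ultimately show ?thesis by (intro exI[of _ B]) blast
qed

lemma mesh_size_pos: "0 < mesh_size D k"
proof -
  interpret c: dg_level \<Omega> D 1 using domain disc by unfold_locales (auto simp: discretization_def)
  have "mesh D 1 \<noteq> {}"
  proof
    assume "mesh D 1 = {}"
    then have "closure \<Omega> = {}" using c.partition by (simp add: partition_of_def)
    then show False using domain by (simp add: polyhedral_domain_def)
  qed
  then obtain T where T: "T \<in> mesh D 1" by blast
  have "0 < diameter T"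
  proof -
    obtain x where x: "x \<in> T" using c.piece(3)[OF T] by blast
    obtain e where e: "e > 0" "ball x e \<subseteq> T" using c.piece(1)[OF T] x open_contains_ball by blast
    obtain i :: 'n where True by simp
    define y where "y = x + (e/2) *\<^sub>R axis i 1"
    have d: "dist x y = e/2" using e by (simp add: y_def dist_norm norm_axis_1)
    then have "y \<in> T" using e by auto
    then have "dist x y \<le> diameter T" using diameter_bounded_bound[OF c.piece(2)[OF T] x] by blast
    then show ?thesis using d e by simp
  qed
  also have "diameter T \<le> Max (diameter ` mesh D 1)" using T c.finite_pieces by simp
  finally show ?thesis by (simp add: mesh_size_def)
qed

lemma pd_form_ip: "pd_form (V D k) (ip D k)"
proof
  show "subspace (V D k)" by (rule subspace_V)
  show "ip D k u v = ip D k v u" for u v by (simp add: ip_def mult.commute)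
  show "ip D k u (c *\<^sub>R v + w) = c * ip D k u v + ip D k u w" if "v \<in> V D k" "w \<in> V D k" for u v w c
    by (simp add: ip_def coord_lin[OF that] sum.distrib sum_distrib_left distrib_left mult_ac)
  show "0 \<le> ip D k u u" for u using mesh_size_pos by (simp add: ip_def sum_nonneg)
  show "u = 0" if "u \<in> V D k" "ip D k u u = 0" for u
  proof -
    have "(\<Sum>i\<in>idx. coord D k u i * coord D k u i) = 0" using that(2) mesh_size_pos by (simp add: ip_def)
    then have z: "coord D k u i = 0" if "i \<in> idx" for i
      using sum_nonneg_eq_0_iff[OF finite_idx, of "\<lambda>i. coord D k u i * coord D k u i"] that by force
    have "(\<Sum>i\<in>idx. coord D k u i * basis_fun D k i x) = 0" for x
    proof (rule sum.neutral, rule ballI)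
      fix i assume "i \<in> idx"
      show "coord D k u i * basis_fun D k i x = 0" using z[OF \<open>i \<in> idx\<close>] by simp
    qed
    then have "(\<lambda>x. \<Sum>i\<in>idx. coord D k u i * basis_fun D k i x) = 0" by (simp add: zero_fun_def)
    then show ?thesis by (rule trans[OF coord_spec(2)[OF that(1)]])
  qed
qed

end

section \<open>Gradients, traces and liftings\<close>

lemma convex_ref_elem: "convex (ref_elem r :: (real^'n::finite) set)"
proof (cases r)
  case Simplex
  have "(ref_elem r :: (real^'n) set) = (\<Inter>i. {x. axis i 1 \<bullet> x > 0}) \<inter> {x. (\<chi> i. 1) \<bullet> x < 1}"
  proof -
    have "(\<chi> i. 1) \<bullet> x = (\<Sum>i\<in>UNIV. x $ i)" for x :: "real^'n" by (simp add: inner_vec_def)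
    then show ?thesis using Simplex by (auto simp: ref_elem_def inner_axis')
  qed
  then show ?thesis
    by (simp only:) (intro convex_Int convex_INT convex_halfspace_gt convex_halfspace_lt)
qed (simp add: ref_elem_Hypercube convex_box)

lemma convex_affine_elem:
  assumes "affine_elem r F T"
  shows "convex T"
proof -
  obtain B b where F: "T = F ` ref_elem r" "F = (\<lambda>x. B *v x + b)"
    using assms by (auto simp: affine_elem_def)
  have "T = (+) b ` ((*v) B ` ref_elem r)" by (auto simp: F image_image add.commute)
  then show ?thesis
    by (simp only:) (intro convex_translation convex_linear_image matrix_vector_mul_linear convex_ref_elem)
qed

lemma grad_eq: "(v has_derivative v') (at x) \<Longrightarrow> grad v x = (\<chi> i. v' (axis i 1))"
  by (simp add: grad_def frechet_derivative_at[symmetric])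

context dg_level
begin

lemma V_derivative:
  assumes v: "v \<in> V D k" and T: "T \<in> mesh D k"
  obtains v' where "\<And>x. x \<in> T \<Longrightarrow> (v has_derivative v' x) (at x)" "\<And>h. continuous_on UNIV (\<lambda>x. v' x h)"
proof -
  obtain g where g: "real_polynomial_function g" "\<And>x. x \<in> T \<Longrightarrow> v x = g x"
    using V_piece[OF v T] by blast
  obtain g' where g': "\<And>x. (g has_derivative g' x) (at x)" "\<And>h. continuous_on UNIV (\<lambda>x. g' x h)"
    using real_polynomial_function_derivative[OF g(1)] by blast
  have "(v has_derivative g' x) (at x)" if "x \<in> T" for x
    using g'(1) by (rule has_derivative_transform_within_open[OF _ piece(1)[OF T] that]) (simp add: g(2))
  then show thesis using g'(2) by (rule that)
qed

lemma bgrad_pw: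
  assumes v: "v \<in> V D k"
  shows "pw_continuous (bgrad D k v)"
  unfolding pw_continuous_def
proof (intro conjI ballI allI impI)
  fix T assume T: "T \<in> mesh D k"
  obtain v' where v': "\<And>x. x \<in> T \<Longrightarrow> (v has_derivative v' x) (at x)" "\<And>h. continuous_on UNIV (\<lambda>x. v' x h)"
    using V_derivative[OF v T] by blast
  have "bgrad D k v x = (\<chi> i. v' x (axis i 1))" if "x \<in> T" for x
    using grad_eq[OF v'(1)[OF that]] T that by (auto simp: bgrad_def)
  moreover have "continuous_on UNIV (\<lambda>x. \<chi> i. v' x (axis i 1))"
    by (intro continuous_on_vec_lambda v'(2))
  ultimately show "\<exists>g. continuous_on UNIV g \<and> (\<forall>x\<in>T. bgrad D k v x = g x)" by blast
qed (simp add: bgrad_def)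

lemma bgrad_lin:
  assumes u: "u \<in> V D k" and v: "v \<in> V D k"
  shows "bgrad D k (c *\<^sub>R u + v) = c *\<^sub>R bgrad D k u + bgrad D k v"
proof
  fix x
  show "bgrad D k (c *\<^sub>R u + v) x = (c *\<^sub>R bgrad D k u + bgrad D k v) x"
  proof (cases "x \<in> \<Union>(mesh D k)")
    case True
    then obtain T where T: "T \<in> mesh D k" "x \<in> T" by blast
    obtain u' where u': "(u has_derivative u') (at x)" using V_derivative[OF u T(1)] T(2) by metis
    obtain v' where v': "(v has_derivative v') (at x)" using V_derivative[OF v T(1)] T(2) by metis
    have "((\<lambda>x. c *\<^sub>R u x + v x) has_derivative (\<lambda>h. c *\<^sub>R u' h + v' h)) (at x)"
      by (intro has_derivative_add has_derivative_scaleR_right u' v')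
    then have "(c *\<^sub>R u + v has_derivative (\<lambda>h. c *\<^sub>R u' h + v' h)) (at x)"
      by (simp add: plus_fun_def)
    from grad_eq[OF this] show ?thesis
      using True by (simp add: bgrad_def grad_eq[OF u'] grad_eq[OF v'] vec_eq_iff)
  qed (simp add: bgrad_def)
qed

lemma adj_mesh: "T \<in> adj D k F \<Longrightarrow> T \<in> mesh D k" "T \<in> adj D k F \<Longrightarrow> x \<in> F \<Longrightarrow> x \<in> closure T"
  unfolding adj_def by auto

text \<open>Compactness and the dimension make face integrals linear. The adjacent element keeps the diameters in the penalty
parameter meaningful: a minimum over the empty set would have no definite sign.\<close>

lemma face_facts:
  assumes F: "F \<in> faces D k"
  shows face_compact: "compact F" and face_dim: "aff_dim F = int CARD('n) - 1"
    and adj_nonempty: "adj D k F \<noteq> {}"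
proof -
  have cl: "compact (closure T)" if "T \<in> mesh D k" for T
    using piece(2)[OF that] by (simp add: compact_closure)
  consider S T where "F = closure S \<inter> closure T" "S \<in> mesh D k" "T \<in> mesh D k" "aff_dim F = int CARD('n) - 1"
    | G T where "F = G \<inter> frontier \<Omega>" "T \<in> mesh D k" "G facet_of closure T" "aff_dim F = int CARD('n) - 1"
    using F unfolding faces_def int_faces_def bd_faces_def dmn by blast
  then have "compact F \<and> aff_dim F = int CARD('n) - 1 \<and> adj D k F \<noteq> {}"
  proof cases
    case 1
    then have "S \<in> adj D k F" by (auto simp: adj_def)
    then show ?thesis using 1 cl by (auto intro: compact_Int)
  next
    case 2
    have G: "G face_of closure T" using 2(3) by (simp add: facet_of_def)
    have "convex (closure T)" using convex_affine_elem[OF elem[OF 2(2)]] by (rule convex_closure)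
    then have "compact G" using G cl[OF 2(2)] face_of_imp_compact by blast
    moreover have "T \<in> adj D k F" using 2 face_of_imp_subset[OF G] by (auto simp: adj_def)
    ultimately show ?thesis using 2 by (auto intro: compact_Int_closed)
  qed
  then show "compact F" "aff_dim F = int CARD('n) - 1" "adj D k F \<noteq> {}" by auto
qed

lemma trace_continuous:
  assumes "pw_continuous f" "T \<in> adj D k F"
  shows "continuous_on F (face_trace T f)"
  by (rule continuous_on_subset[OF face_trace_continuous[OF assms(1) adj_mesh(1)[OF assms(2)]]])
    (use adj_mesh(2)[OF assms(2)] in blast)

lemma jump_continuous: "v \<in> V D k \<Longrightarrow> continuous_on F (jump D k F v)"
  unfolding jump_def by (intro continuous_intros trace_continuous V_pw)

lemma njump_continuous: "\<eta> \<in> Vvec D k \<Longrightarrow> continuous_on F (njump D k F \<eta>)"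
  unfolding njump_def by (intro continuous_intros trace_continuous Vvec_pw)

lemma avg_continuous: "\<eta> \<in> Vvec D k \<Longrightarrow> continuous_on F (avg D k F \<eta>)"
  unfolding avg_def by (intro continuous_intros trace_continuous Vvec_pw)

lemma trace_lin:
  "pw_continuous f \<Longrightarrow> pw_continuous g \<Longrightarrow> T \<in> adj D k F \<Longrightarrow> x \<in> F \<Longrightarrow>
    face_trace T (c *\<^sub>R f + g) x = c *\<^sub>R face_trace T f x + face_trace T g x"
  by (intro face_trace_lin adj_mesh)

lemma jump_lin:
  assumes "u \<in> V D k" "v \<in> V D k" "x \<in> F"
  shows "jump D k F (c *\<^sub>R u + v) x = c *\<^sub>R jump D k F u x + jump D k F v x"
proof -
  have "face_trace T (c *\<^sub>R u + v) x *\<^sub>R outer_normal T F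
      = c *\<^sub>R (face_trace T u x *\<^sub>R outer_normal T F) + face_trace T v x *\<^sub>R outer_normal T F"
    if "T \<in> adj D k F" for T
    using trace_lin[OF V_pw[OF assms(1)] V_pw[OF assms(2)] that assms(3)] by (simp add: scaleR_add_left)
  then show ?thesis by (simp add: jump_def sum.distrib scaleR_sum_right)
qed

lemma njump_lin:
  assumes "u \<in> Vvec D k" "v \<in> Vvec D k" "x \<in> F"
  shows "njump D k F (c *\<^sub>R u + v) x = c * njump D k F u x + njump D k F v x"
proof -
  have "face_trace T (c *\<^sub>R u + v) x \<bullet> outer_normal T F
      = c * (face_trace T u x \<bullet> outer_normal T F) + face_trace T v x \<bullet> outer_normal T F"
    if "T \<in> adj D k F" for T
    using trace_lin[OF Vvec_pw[OF assms(1)] Vvec_pw[OF assms(2)] that assms(3)] by (simp add: inner_add_left)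
  then show ?thesis by (simp add: njump_def sum.distrib sum_distrib_left)
qed

lemma avg_lin:
  assumes "u \<in> Vvec D k" "v \<in> Vvec D k" "x \<in> F"
  shows "avg D k F (c *\<^sub>R u + v) x = c *\<^sub>R avg D k F u x + avg D k F v x"
proof -
  have "(\<Sum>T\<in>adj D k F. face_trace T (c *\<^sub>R u + v) x)
      = c *\<^sub>R (\<Sum>T\<in>adj D k F. face_trace T u x) + (\<Sum>T\<in>adj D k F. face_trace T v x)"
    using trace_lin[OF Vvec_pw[OF assms(1)] Vvec_pw[OF assms(2)] _ assms(3)]
    by (simp add: sum.distrib scaleR_sum_right)
  then show ?thesis by (simp add: avg_def scaleR_add_right)
qed

interpretation vec: pd_form "Vvec D k" l2
  by (rule pd_form_l2[OF subspace_Vvec Vvec_pw])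

lemma l2_dmn: "(\<integral>x. r x \<bullet> \<eta> x \<partial>lebesgue_on (dmn D)) = l2 r \<eta>"
  by (simp add: l2_def dmn)

lemma vec_riesz:
  assumes "vec.functional L"
  shows "\<exists>!r. r \<in> Vvec D k \<and> (\<forall>\<eta>\<in>Vvec D k. l2 r \<eta> = L \<eta>)"
proof -
  obtain B where "finite B" "Vvec D k = span B" using Vvec_span by blast
  then show ?thesis using assms by (rule vec.riesz)
qed

text \<open>The defining equation of the lifting has exactly one solution by the Riesz lemma, as its right-hand side is linear in
the test function.\<close>

lemma lift_r_spec:
  assumes F: "F \<in> faces D k" and \<tau>: "continuous_on F \<tau>"
  shows "lift_r D k F \<tau> \<in> Vvec D k \<and>
    (\<forall>\<eta>\<in>Vvec D k. l2 (lift_r D k F \<tau>) \<eta> = - face_integral F (\<lambda>x. \<tau> x \<bullet> avg D k F \<eta> x))"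
proof -
  have "face_integral F (\<lambda>x. \<tau> x \<bullet> avg D k F (c *\<^sub>R u + v) x)
      = c * face_integral F (\<lambda>x. \<tau> x \<bullet> avg D k F u x) + face_integral F (\<lambda>x. \<tau> x \<bullet> avg D k F v x)"
    if uv: "u \<in> Vvec D k" "v \<in> Vvec D k" for u v c
  proof -
    have "face_integral F (\<lambda>x. \<tau> x \<bullet> avg D k F (c *\<^sub>R u + v) x)
        = face_integral F (\<lambda>x. c * (\<tau> x \<bullet> avg D k F u x) + \<tau> x \<bullet> avg D k F v x)"
      by (rule face_integral_cong) (simp add: avg_lin[OF uv] inner_add_right)
    also have "\<dots> = c * face_integral F (\<lambda>x. \<tau> x \<bullet> avg D k F u x) + face_integral F (\<lambda>x. \<tau> x \<bullet> avg D k F v x)"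
      by (intro face_integral_lin face_compact[OF F] face_dim[OF F] continuous_on_inner \<tau> avg_continuous uv)
    finally show ?thesis .
  qed
  then have "vec.functional (\<lambda>\<eta>. - face_integral F (\<lambda>x. \<tau> x \<bullet> avg D k F \<eta> x))"
    unfolding vec.functional_def by simp
  from theI'[OF vec_riesz[OF this]] show ?thesis unfolding lift_r_def l2_dmn .
qed

lemma lift_l_spec:
  assumes F: "F \<in> faces D k" and \<tau>: "continuous_on F \<tau>"
  shows "lift_l D k F \<tau> \<in> Vvec D k \<and>
    (\<forall>\<eta>\<in>Vvec D k. l2 (lift_l D k F \<tau>) \<eta> = - face_integral F (\<lambda>x. \<tau> x * njump D k F \<eta> x))"
proof -
  have "face_integral F (\<lambda>x. \<tau> x * njump D k F (c *\<^sub>R u + v) x)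
      = c * face_integral F (\<lambda>x. \<tau> x * njump D k F u x) + face_integral F (\<lambda>x. \<tau> x * njump D k F v x)"
    if uv: "u \<in> Vvec D k" "v \<in> Vvec D k" for u v c
  proof -
    have "face_integral F (\<lambda>x. \<tau> x * njump D k F (c *\<^sub>R u + v) x)
        = face_integral F (\<lambda>x. c * (\<tau> x * njump D k F u x) + \<tau> x * njump D k F v x)"
      by (rule face_integral_cong) (simp add: njump_lin[OF uv] distrib_left)
    also have "\<dots> = c * face_integral F (\<lambda>x. \<tau> x * njump D k F u x) + face_integral F (\<lambda>x. \<tau> x * njump D k F v x)"
      by (intro face_integral_lin face_compact[OF F] face_dim[OF F] continuous_on_mult \<tau> njump_continuous uv)
    finally show ?thesis .
  qed
  then have "vec.functional (\<lambda>\<eta>. - face_integral F (\<lambda>x. \<tau> x * njump D k F \<eta> x))"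
    unfolding vec.functional_def by simp
  from theI'[OF vec_riesz[OF this]] show ?thesis unfolding lift_l_def l2_dmn .
qed

text \<open>Stated for \<open>\<xi>\<close> given on the face only, because a jump is linear in the function on the face but not off it.\<close>

lemma lift_r_lin:
  assumes F: "F \<in> faces D k" and c: "continuous_on F \<tau>" "continuous_on F \<rho>" "continuous_on F \<xi>"
    and eq: "\<And>x. x \<in> F \<Longrightarrow> \<xi> x = c *\<^sub>R \<tau> x + \<rho> x"
  shows "lift_r D k F \<xi> = c *\<^sub>R lift_r D k F \<tau> + lift_r D k F \<rho>"
proof (rule vec.eq_if_all_eq)
  note s = lift_r_spec[OF F]
  show "lift_r D k F \<xi> \<in> Vvec D k" "c *\<^sub>R lift_r D k F \<tau> + lift_r D k F \<rho> \<in> Vvec D k"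
    using s[OF c(1)] s[OF c(2)] s[OF c(3)] by auto
  fix \<eta> assume \<eta>: "\<eta> \<in> Vvec D k"
  have "l2 (c *\<^sub>R lift_r D k F \<tau> + lift_r D k F \<rho>) \<eta>
      = - (c * face_integral F (\<lambda>x. \<tau> x \<bullet> avg D k F \<eta> x) + face_integral F (\<lambda>x. \<rho> x \<bullet> avg D k F \<eta> x))"
    using s[OF c(1)] s[OF c(2)] \<eta> by (simp add: vec.expand)
  also have "c * face_integral F (\<lambda>x. \<tau> x \<bullet> avg D k F \<eta> x) + face_integral F (\<lambda>x. \<rho> x \<bullet> avg D k F \<eta> x)
      = face_integral F (\<lambda>x. c * (\<tau> x \<bullet> avg D k F \<eta> x) + \<rho> x \<bullet> avg D k F \<eta> x)"
    by (intro face_integral_lin[symmetric] face_compact[OF F] face_dim[OF F] continuous_on_inner c avg_continuous \<eta>)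
  also have "\<dots> = face_integral F (\<lambda>x. \<xi> x \<bullet> avg D k F \<eta> x)"
    by (rule face_integral_cong) (simp add: eq inner_add_left)
  also have "- face_integral F (\<lambda>x. \<xi> x \<bullet> avg D k F \<eta> x) = l2 (lift_r D k F \<xi>) \<eta>"
    using s[OF c(3)] \<eta> by simp
  finally show "l2 (lift_r D k F \<xi>) \<eta> = l2 (c *\<^sub>R lift_r D k F \<tau> + lift_r D k F \<rho>) \<eta>"
    by (rule sym)
qed

lemma lift_l_lin:
  assumes F: "F \<in> faces D k" and c: "continuous_on F \<tau>" "continuous_on F \<rho>" "continuous_on F \<xi>"
    and eq: "\<And>x. x \<in> F \<Longrightarrow> \<xi> x = c * \<tau> x + \<rho> x"
  shows "lift_l D k F \<xi> = c *\<^sub>R lift_l D k F \<tau> + lift_l D k F \<rho>"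
proof (rule vec.eq_if_all_eq)
  note s = lift_l_spec[OF F]
  show "lift_l D k F \<xi> \<in> Vvec D k" "c *\<^sub>R lift_l D k F \<tau> + lift_l D k F \<rho> \<in> Vvec D k"
    using s[OF c(1)] s[OF c(2)] s[OF c(3)] by auto
  fix \<eta> assume \<eta>: "\<eta> \<in> Vvec D k"
  have "l2 (c *\<^sub>R lift_l D k F \<tau> + lift_l D k F \<rho>) \<eta>
      = - (c * face_integral F (\<lambda>x. \<tau> x * njump D k F \<eta> x) + face_integral F (\<lambda>x. \<rho> x * njump D k F \<eta> x))"
    using s[OF c(1)] s[OF c(2)] \<eta> by (simp add: vec.expand)
  also have "c * face_integral F (\<lambda>x. \<tau> x * njump D k F \<eta> x) + face_integral F (\<lambda>x. \<rho> x * njump D k F \<eta> x)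
      = face_integral F (\<lambda>x. c * (\<tau> x * njump D k F \<eta> x) + \<rho> x * njump D k F \<eta> x)"
    by (intro face_integral_lin[symmetric] face_compact[OF F] face_dim[OF F] continuous_on_mult c njump_continuous \<eta>)
  also have "\<dots> = face_integral F (\<lambda>x. \<xi> x * njump D k F \<eta> x)"
    by (rule face_integral_cong) (simp add: eq distrib_right)
  also have "- face_integral F (\<lambda>x. \<xi> x * njump D k F \<eta> x) = l2 (lift_l D k F \<xi>) \<eta>"
    using s[OF c(3)] \<eta> by simp
  finally show "l2 (lift_l D k F \<xi>) \<eta> = l2 (c *\<^sub>R lift_l D k F \<tau> + lift_l D k F \<rho>) \<eta>"
    by (rule sym)
qed

lemma int_face: "F \<in> int_faces D k \<Longrightarrow> F \<in> faces D k"
  by (simp add: faces_def)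

lemma beta_jump_continuous:
  "v \<in> V D k \<Longrightarrow> continuous_on F (\<lambda>y. beta D k F \<bullet> jump D k F v y)"
  by (intro continuous_intros jump_continuous)

lemma Gop_eq:
  "Gop D k v = (\<Sum>F\<in>faces D k. lift_r D k F (jump D k F v))
    + (\<Sum>F\<in>int_faces D k. lift_l D k F (\<lambda>y. beta D k F \<bullet> jump D k F v y))"
  by (simp add: fun_eq_iff Gop_def Lift_R_def Lift_L_def sum_fun_apply)

lemma Gop_Vvec:
  assumes v: "v \<in> V D k"
  shows "Gop D k v \<in> Vvec D k"
  unfolding Gop_eq
proof (intro subspace_add subspace_sum subspace_Vvec)
  show "lift_r D k F (jump D k F v) \<in> Vvec D k" if "F \<in> faces D k" for F
    using lift_r_spec[OF that jump_continuous[OF v]] by blast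
  show "lift_l D k F (\<lambda>y. beta D k F \<bullet> jump D k F v y) \<in> Vvec D k" if "F \<in> int_faces D k" for F
    using lift_l_spec[OF int_face[OF that] beta_jump_continuous[OF v]] by blast
qed

lemma Gop_lin:
  assumes u: "u \<in> V D k" and v: "v \<in> V D k"
  shows "Gop D k (c *\<^sub>R u + v) = c *\<^sub>R Gop D k u + Gop D k v"
proof -
  have w: "c *\<^sub>R u + v \<in> V D k" using u v by (intro subspace_add subspace_scale subspace_V)
  have "lift_r D k F (jump D k F (c *\<^sub>R u + v))
      = c *\<^sub>R lift_r D k F (jump D k F u) + lift_r D k F (jump D k F v)" if "F \<in> faces D k" for F
    by (intro lift_r_lin that jump_continuous u v w jump_lin)
  moreover have "lift_l D k F (\<lambda>y. beta D k F \<bullet> jump D k F (c *\<^sub>R u + v) y)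
      = c *\<^sub>R lift_l D k F (\<lambda>y. beta D k F \<bullet> jump D k F u y)
      + lift_l D k F (\<lambda>y. beta D k F \<bullet> jump D k F v y)" if "F \<in> int_faces D k" for F
    by (intro lift_l_lin int_face that beta_jump_continuous u v w) (simp add: jump_lin[OF u v] inner_add_right)
  ultimately show ?thesis
    by (simp add: Gop_eq sum.distrib scaleR_add_right scaleR_sum_right)
qed

section \<open>The discontinuous Galerkin form\<close>

definition penalty :: "(real^'n \<Rightarrow> real) \<Rightarrow> (real^'n \<Rightarrow> real) \<Rightarrow> real" where
  "penalty w v = (\<Sum>F\<in>faces D k. face_integral F (\<lambda>x. sigma D k F * (jump D k F w x \<bullet> jump D k F v x)))"

lemma penalty_lin:
  assumes w: "w \<in> V D k" and u: "u \<in> V D k" and v: "v \<in> V D k"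
  shows "penalty w (c *\<^sub>R u + v) = c * penalty w u + penalty w v"
proof -
  have "face_integral F (\<lambda>x. sigma D k F * (jump D k F w x \<bullet> jump D k F (c *\<^sub>R u + v) x))
      = c * face_integral F (\<lambda>x. sigma D k F * (jump D k F w x \<bullet> jump D k F u x))
       + face_integral F (\<lambda>x. sigma D k F * (jump D k F w x \<bullet> jump D k F v x))" if F: "F \<in> faces D k" for F
  proof -
    have "face_integral F (\<lambda>x. sigma D k F * (jump D k F w x \<bullet> jump D k F (c *\<^sub>R u + v) x))
        = face_integral F (\<lambda>x. c * (sigma D k F * (jump D k F w x \<bullet> jump D k F u x))
            + sigma D k F * (jump D k F w x \<bullet> jump D k F v x))"
      by (rule face_integral_cong) (simp add: jump_lin[OF u v] inner_add_right distrib_left mult.left_commute)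
    also have "\<dots> = c * face_integral F (\<lambda>x. sigma D k F * (jump D k F w x \<bullet> jump D k F u x))
       + face_integral F (\<lambda>x. sigma D k F * (jump D k F w x \<bullet> jump D k F v x))"
      by (intro face_integral_lin face_compact[OF F] face_dim[OF F] continuous_on_inner
          continuous_on_mult continuous_on_const jump_continuous w u v)
    finally show ?thesis .
  qed
  then show ?thesis by (simp add: penalty_def sum.distrib sum_distrib_left)
qed

lemma penalty_nonneg: "0 \<le> penalty v v"
  unfolding penalty_def
proof (intro sum_nonneg face_integral_nonneg mult_nonneg_nonneg inner_ge_zero)
  fix F assume F: "F \<in> faces D k"
  have "finite (adj D k F)" using finite_pieces by (simp add: adj_def)
  then have "Min (diameter ` adj D k F) \<in> diameter ` adj D k F"
    using adj_nonempty[OF F] by (intro Min_in) auto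
  then obtain T where "T \<in> adj D k F" "Min (diameter ` adj D k F) = diameter T" by auto
  then have "0 \<le> Min (diameter ` adj D k F)"
    using diameter_ge_0[OF piece(2)[OF adj_mesh(1)]] by simp
  then show "0 \<le> sigma D k F" using alpha_pos by (simp add: sigma_def)
qed

lemma Aform_eq:
  assumes w: "w \<in> V D k" and v: "v \<in> V D k"
  shows "Aform D k w v = l2 (bgrad D k w) (bgrad D k v) + l2 (bgrad D k w) (Gop D k v)
    + l2 (bgrad D k v) (Gop D k w) + theta D * l2 (Gop D k w) (Gop D k v) + penalty w v"
proof -
  have i: "integrable (lebesgue_on \<Omega>) (\<lambda>x. f x \<bullet> g x)" if "pw_continuous f" "pw_continuous g" for f g :: "real^'n \<Rightarrow> real^'n"
    using that by (intro pw_integrable pw_inner)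
  note p = bgrad_pw[OF w] bgrad_pw[OF v] Vvec_pw[OF Gop_Vvec[OF w]] Vvec_pw[OF Gop_Vvec[OF v]]
  show ?thesis unfolding Aform_def penalty_def[symmetric] dmn l2_def
    using i[OF p(1,2)] i[OF p(1,4)] i[OF p(3,2)] i[OF p(3,4)]
    by (simp add: inner_commute)
qed

lemma sym_form_Aform: "sym_form (V D k) (Aform D k)"
proof
  show "subspace (V D k)" by (rule subspace_V)
  show "Aform D k u v = Aform D k v u" if "u \<in> V D k" "v \<in> V D k" for u v
    by (simp add: Aform_def inner_commute add_ac)
  show "Aform D k u (c *\<^sub>R v + w) = c * Aform D k u v + Aform D k u w"
    if u: "u \<in> V D k" and v: "v \<in> V D k" and w: "w \<in> V D k" for u v w c
  proof -
    note p = bgrad_pw[OF u] bgrad_pw[OF v] bgrad_pw[OF w]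
      Vvec_pw[OF Gop_Vvec[OF u]] Vvec_pw[OF Gop_Vvec[OF v]] Vvec_pw[OF Gop_Vvec[OF w]]
    have s: "c *\<^sub>R v + w \<in> V D k" using v w by (intro subspace_add subspace_scale subspace_V)
    have comm: "l2 f g = l2 g f" for f g :: "real^'n \<Rightarrow> real^'n" by (simp add: l2_def inner_commute)
    show ?thesis
      unfolding Aform_eq[OF u s] Aform_eq[OF u v] Aform_eq[OF u w] bgrad_lin[OF v w] Gop_lin[OF v w]
        penalty_lin[OF u v w] comm[of _ "Gop D k u"]
        l2_lin[OF p(1,2,3)] l2_lin[OF p(1,5,6)] l2_lin[OF p(4,2,3)] l2_lin[OF p(4,5,6)]
      by (simp add: algebra_simps)
  qed
qed

text \<open>For \<open>\<theta> = 1\<close> the volume terms are the square of the norm of \<open>\<nabla>v + \<G>(v)\<close>.\<close>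

lemma Aform_nonneg_LDG:
  assumes "scheme D = LDG b"
  shows "0 \<le> Aform D k v v"
proof -
  have sq: "a \<bullet> a + a \<bullet> g + g \<bullet> a + theta D * (g \<bullet> g) = (a + g) \<bullet> (a + g)" for a g :: "real^'n"
    by (simp add: theta_def assms inner_add_left inner_add_right)
  show ?thesis
    unfolding Aform_def penalty_def[symmetric] sq
    by (intro add_nonneg_nonneg penalty_nonneg integral_nonneg_AE AE_I2 inner_ge_zero)
qed

end

section \<open>Definiteness from the error estimate\<close>

lemma iter_partial_zero: "iter_partial is (\<lambda>x. 0) = (\<lambda>x. 0)"
  by (induction "is") (simp_all add: frechet_derivative_const)

lemma test_function_zero: "test_function S (\<lambda>x. 0)"
  by (simp add: test_function_def iter_partial_zero)

lemma L2_zero: "L2 S (\<lambda>x. 0)"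
  by (simp add: L2_def)

lemma grad_zero: "grad (\<lambda>x. 0) x = 0"
  using grad_eq[OF has_derivative_const, of 0] by (simp add: vec_eq_iff)

lemma weak_solution_zero: "weak_solution \<Omega> (\<lambda>x. 0) (\<lambda>x. 0) (\<lambda>x. 0)"
proof -
  have "(\<lambda>j::nat. L2_norm_on \<Omega> (\<lambda>x. 0 - (0::real))) \<longlonglongrightarrow> 0"
    "(\<lambda>j::nat. L2_norm_on \<Omega> (\<lambda>x::real^'a. 0 - grad (\<lambda>x. 0) x)) \<longlonglongrightarrow> 0"
    by (simp_all add: L2_norm_on_def grad_zero)
  then have "H10 \<Omega> (\<lambda>x. 0) (\<lambda>x. 0)"
    unfolding H10_def
    by (intro conjI exI[of _ "\<lambda>j x. 0"] allI L2_zero test_function_zero)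
  then show ?thesis by (simp add: weak_solution_def)
qed

text \<open>The weak derivative is an arbitrary choice among all weak derivatives of zero. Being square integrable, it has a
finite norm whatever the choice.\<close>

lemma in_sobolev_2_zero: "in_sobolev T 2 (\<lambda>x. 0)"
proof -
  have w: "has_weak_deriv T is (\<lambda>x. 0) (\<lambda>x. 0)" for "is"
    by (simp add: has_weak_deriv_def L2_zero)
  have fin: "(\<integral>\<^sup>+x. ennreal ((weak_deriv T is (\<lambda>x. 0) x)\<^sup>2) \<partial>lebesgue_on T) < \<infinity>" for "is"
  proof -
    have "has_weak_deriv T is (\<lambda>x. 0) (weak_deriv T is (\<lambda>x. 0))"
      unfolding weak_deriv_def by (rule someI[of "has_weak_deriv T is (\<lambda>x. 0)", OF w])
    then have "integrable (lebesgue_on T) (\<lambda>x. (norm (weak_deriv T is (\<lambda>x. 0) x))\<^sup>2)"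
      by (simp add: has_weak_deriv_def L2_def)
    then show ?thesis by (simp add: integrable_iff_bounded)
  qed
  have "(\<Sum>is | length is \<le> 2. \<integral>\<^sup>+x. ennreal ((weak_deriv T is (\<lambda>x. 0) x)\<^sup>2) \<partial>lebesgue_on T) < \<infinity>"
  proof (cases "finite {is :: 'a list. length is \<le> 2}")
    case True
    then show ?thesis using fin by (simp add: less_top)
  qed (simp add: sum.infinite)
  then show ?thesis using w by (auto simp: in_sobolev_def sobolev_sq_def)
qed

context dg_level
begin

text \<open>An element of the kernel, and with it each of its multiples, is the discrete solution for \<open>f = 0\<close>, whose exact solution
is zero. The right-hand side of the error estimate depends on the exact solution only, so it bounds all these multiples
at once.\<close>

lemma nondegenerate_if_error_estimate:
  assumes err: "dg_error_estimate \<mu> \<D> 1" and D: "D \<in> \<D>"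
    and u: "u \<in> V D k" and ker: "\<And>v. v \<in> V D k \<Longrightarrow> Aform D k u v = 0"
  shows "u = 0"
proof -
  interpret A: sym_form "V D k" "Aform D k" by (rule sym_form_Aform)
  interpret l2: pd_form "V D k" l2 by (rule pd_form_l2[OF subspace_V V_pw])
  obtain K where K: "\<And>w. w \<in> V D k \<Longrightarrow> (\<And>v. v \<in> V D k \<Longrightarrow> Aform D k w v = 0)
      \<Longrightarrow> L2_norm_on \<Omega> (\<lambda>x. 0 - w x) \<le> K"
  proof -
    obtain C where C: "\<And>f u g uk. L2 (dmn D) f \<and> weak_solution (dmn D) f u g \<and>
        (\<forall>T\<in>mesh D k. in_sobolev T (1 + 1) u \<and> continuous_on T u) \<and>
        uk \<in> V D k \<and> (\<forall>v\<in>V D k. Aform D k uk v = (\<integral>x. f x * v x \<partial>lebesgue_on (dmn D))) \<Longrightarrow>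
        (let N = sqrt (\<Sum>T\<in>mesh D k. (sobolev_norm T (1 + 1) u)\<^sup>2);
             h = mesh_size D k; p = real (deg D k)
         in DG_norm D k (\<lambda>x. u x - uk x) (\<lambda>x. g x - bgrad D k uk x)
              \<le> C * (h powr min p 1 / p powr (1 - real \<mu> / 2)) * N \<and>
            L2_norm_on (dmn D) (\<lambda>x. u x - uk x)
              \<le> C * (h powr (min p 1 + 1) / p powr (1 + 1 - real \<mu>)) * N)"
    proof -
      have k: "k \<in> {1..levels D}" using level by simp
      show thesis using err[unfolded dg_error_estimate_def] D k that by blast
    qed
    define K where "K = C * (mesh_size D k powr (min (real (deg D k)) 1 + 1)
        / real (deg D k) powr (1 + 1 - real \<mu>)) * sqrt (\<Sum>T\<in>mesh D k. (sobolev_norm T (1 + 1) (\<lambda>x. 0))\<^sup>2)"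
    have "L2_norm_on \<Omega> (\<lambda>x. 0 - w x) \<le> K"
      if "w \<in> V D k" "\<And>v. v \<in> V D k \<Longrightarrow> Aform D k w v = 0" for w
      using C[of "\<lambda>x. 0" "\<lambda>x. 0" "\<lambda>x. 0" w] that
      by (simp add: L2_zero weak_solution_zero in_sobolev_2_zero Let_def dmn K_def)
    then show thesis by (rule that)
  qed
  have bound: "\<bar>t\<bar> * sqrt (l2 u u) \<le> K" for t
  proof -
    have "L2_norm_on \<Omega> (\<lambda>x. 0 - (t *\<^sub>R u) x) \<le> K"
      by (rule K[of "t *\<^sub>R u"]) (simp_all only: A.scale_left A.mem u ker mult_zero_right)
    moreover have "L2_norm_on \<Omega> (\<lambda>x. 0 - (t *\<^sub>R u) x) = sqrt (l2 (t *\<^sub>R u) (t *\<^sub>R u))"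
      by (simp add: L2_norm_on_def l2_def power2_eq_square)
    moreover have "l2 (t *\<^sub>R u) (t *\<^sub>R u) = t\<^sup>2 * l2 u u"
      using u by (simp add: l2.expand power2_eq_square)
    ultimately show ?thesis by (simp add: real_sqrt_mult)
  qed
  have "sqrt (l2 u u) = 0"
  proof (rule ccontr)
    assume "sqrt (l2 u u) \<noteq> 0"
    then have pos: "0 < sqrt (l2 u u)" using l2.nonneg[OF u] by simp
    have "\<bar>(K + 1) / sqrt (l2 u u)\<bar> * sqrt (l2 u u) = \<bar>K + 1\<bar>" using pos by (simp add: abs_divide)
    then show False using bound[of "(K + 1) / sqrt (l2 u u)"] by simp
  qed
  then show ?thesis using l2.definite[OF u] by simp
qed

end

section \<open>The operators on one level\<close>

locale dg_spd = dg_level +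
  assumes Aform_nonneg: "v \<in> V D k \<Longrightarrow> 0 \<le> Aform D k v v"
    and Aform_nondeg: "u \<in> V D k \<Longrightarrow> (\<And>v. v \<in> V D k \<Longrightarrow> Aform D k u v = 0) \<Longrightarrow> u = 0"
begin

lemma pd_form_Aform: "pd_form (V D k) (Aform D k)"
proof -
  interpret sym_form "V D k" "Aform D k" by (rule sym_form_Aform)
  interpret psd_form "V D k" "Aform D k" by unfold_locales (rule Aform_nonneg)
  show ?thesis
  proof unfold_locales
    show "u = 0" if "u \<in> V D k" "Aform D k u u = 0" for u
      using that null_orthogonal[OF that] by (intro Aform_nondeg)
  qed
qed

sublocale a: pd_form "V D k" "Aform D k" by (rule pd_form_Aform)
sublocale ip: pd_form "V D k" "ip D k" by (rule pd_form_ip)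

lemma finite_basis: "finite (basis_fun D k ` idx)"
  using finite_idx by simp

lemma Aop_spec:
  assumes u: "u \<in> V D k"
  shows "Aop D k u \<in> V D k" "v \<in> V D k \<Longrightarrow> ip D k (Aop D k u) v = Aform D k u v"
proof -
  have "ip.functional (Aform D k u)" unfolding ip.functional_def using u by (simp add: a.lin)
  from theI'[OF ip.riesz[OF finite_basis V_span this]]
  have "Aop D k u \<in> V D k \<and> (\<forall>v\<in>V D k. ip D k (Aop D k u) v = Aform D k u v)"
    unfolding Aop_def .
  then show "Aop D k u \<in> V D k" "v \<in> V D k \<Longrightarrow> ip D k (Aop D k u) v = Aform D k u v" by auto
qed

lemma norm1_eq: "v \<in> V D k \<Longrightarrow> norm1 D k v = a.nrm v"
  by (simp add: norm1_def a.nrm_def Aop_spec(2))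

lemma norm1_zero: "norm1 D k 0 = 0"
  by (simp add: norm1_eq a.nrm_def)

lemma Aop_add:
  assumes "u \<in> V D k" "v \<in> V D k"
  shows "Aop D k (u + v) = Aop D k u + Aop D k v"
  using assms Aop_spec by (intro ip.eq_if_all_eq) (auto simp: ip.add_left a.add_left)

text \<open>The spectrum in the smoother's bound consists of the eigenvalues of \<open>A\<^sub>k\<close>, which are those of the pair of forms \<open>\<A>\<^sub>k\<close>
and \<open>(\<cdot>, \<cdot>)\<^sub>k\<close>.\<close>

lemma Aform_le_bnd: "w \<in> V D k \<Longrightarrow> Aform D k w w \<le> bnd D k * ip D k w w"
proof (rule ip.rayleigh_bound[OF a.psd_form_axioms finite_basis V_span])
  fix l w assume w: "w \<in> V D k" "w \<noteq> 0" and ev: "\<And>v. v \<in> V D k \<Longrightarrow> Aform D k w v = l * ip D k w v"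
  have "Aop D k w = l *\<^sub>R w"
    using w ev Aop_spec[OF w(1)] by (intro ip.eq_if_all_eq) (auto simp: ip.scale_left)
  then have "l \<in> Aop_spectrum D k"
    using w unfolding Aop_spectrum_def by (auto simp: zero_fun_def scaleR_fun_def)
  then show "l \<le> bnd D k" using spectrum by fastforce
qed

lemma smoother_eq: "smoother D k u = u - inverse (bnd D k) *\<^sub>R Aop D k u"
  by (simp add: smoother_def fun_eq_iff)

lemma smoother:
  assumes u: "u \<in> V D k"
  shows "smoother D k u \<in> V D k" "a.nrm (smoother D k u) \<le> a.nrm u"
proof -
  show "smoother D k u \<in> V D k" using Aop_spec[OF u] u by (simp add: smoother_eq)
  have "Aform D k (smoother D k u) (smoother D k u) \<le> Aform D k u u"
    unfolding smoother_eq
    by (rule richardson_contraction[OF pd_form_ip pd_form_Aform Aop_spec Aform_le_bnd u])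
  then show "a.nrm (smoother D k u) \<le> a.nrm u" by (simp add: a.nrm_def)
qed

lemma smoother_add:
  "u \<in> V D k \<Longrightarrow> v \<in> V D k \<Longrightarrow> smoother D k (u + v) = smoother D k u + smoother D k v"
  by (simp add: smoother_eq Aop_add scaleR_add_right)

lemma smoother_pow:
  assumes "u \<in> V D k"
  shows "(smoother D k ^^ m) u \<in> V D k" "a.nrm ((smoother D k ^^ m) u) \<le> a.nrm u"
proof -
  have "(smoother D k ^^ m) u \<in> V D k \<and> a.nrm ((smoother D k ^^ m) u) \<le> a.nrm u"
    by (induction m) (use assms smoother order_trans in \<open>auto, fastforce\<close>)
  then show "(smoother D k ^^ m) u \<in> V D k" "a.nrm ((smoother D k ^^ m) u) \<le> a.nrm u" by auto
qed

lemma smoother_pow_add: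
  assumes "u \<in> V D k" "v \<in> V D k"
  shows "(smoother D k ^^ m) (u + v) = (smoother D k ^^ m) u + (smoother D k ^^ m) v"
proof (induction m)
  case (Suc m)
  then show ?case
    using smoother_add[OF smoother_pow(1)[OF assms(1)] smoother_pow(1)[OF assms(2)], of m m]
    by (simp only: funpow.simps comp_apply)
qed simp

end

lemma dg_spd_if_uniform_family:
  assumes dom: "polyhedral_domain \<Omega>" and disc: "\<forall>D\<in>\<D>. discretization \<Omega> D"
    and unif: "uniform_family \<D>" and err: "dg_error_estimate \<mu> \<D> 1"
    and D: "D \<in> \<D>" and k: "1 \<le> k" "k \<le> levels D"
  shows "dg_spd \<Omega> D k"
proof -
  interpret dg_level \<Omega> D k using dom disc D k by unfold_locales auto
  show ?thesis
  proof
    show "u = 0" if "u \<in> V D k" "\<And>v. v \<in> V D k \<Longrightarrow> Aform D k u v = 0" for u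
      using err D that by (rule nondegenerate_if_error_estimate)
    show "0 \<le> Aform D k v v" if v: "v \<in> V D k" for v
    proof (cases "\<exists>b. scheme D = LDG b")
      case True
      then show ?thesis using Aform_nonneg_LDG by blast
    next
      case False
      have "\<exists>c>0. \<forall>D\<in>\<D>. (\<forall>b. scheme D \<noteq> LDG b) \<longrightarrow>
        (\<forall>k\<in>{1..levels D}. \<forall>v\<in>V D k. c * (DG_norm D k v (bgrad D k v))\<^sup>2 \<le> Aform D k v v)"
        using unif unfolding uniform_family_def by (elim conjE)
      then obtain c where c: "c > 0" "c * (DG_norm D k v (bgrad D k v))\<^sup>2 \<le> Aform D k v v"
        using D False k v by fastforce
      have "0 \<le> c * (DG_norm D k v (bgrad D k v))\<^sup>2" using c(1) by simp
      then show ?thesis using c(2) by linarith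
    qed
  qed
qed

section \<open>Two consecutive levels\<close>

locale two_levels =
  coarse: dg_spd \<Omega> D k + fine: dg_spd \<Omega> D "Suc k"
  for \<Omega> :: "(real^'n::finite) set" and D :: "'n disc" and k :: nat
begin

lemma refinement: "uniform_refinement (mesh D k) (mesh D (Suc k))" "deg D k \<le> deg D (Suc k)"
proof -
  note d = coarse.disc[unfolded discretization_def]
  have k: "Suc k \<in> {2..levels D}" using coarse.level fine.level by simp
  note dk = d[THEN conjunct2, THEN conjunct2, THEN conjunct2, THEN conjunct2, THEN bspec, OF k]
  show "uniform_refinement (mesh D k) (mesh D (Suc k))" "deg D k \<le> deg D (Suc k)"
    using dk by simp_all
qed

text \<open>The polynomial on the parent, pulled back to the reference element through the map of the child, is again in the
polynomial space; the degree may only grow from one level to the next.\<close>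

lemma prolong_in_V:
  assumes v: "v \<in> V D k"
  shows "prolong D (Suc k) v \<in> V D (Suc k)"
proof -
  have "\<exists>q\<in>poly_space (kind D) (deg D (Suc k)). \<forall>x\<in>ref_elem (kind D). prolong D (Suc k) v (emap D (Suc k) T' x) = q x"
    if T': "T' \<in> mesh D (Suc k)" for T'
  proof -
    obtain T where T: "T \<in> mesh D k" "T' \<subseteq> T"
      using refinement(1) T' unfolding uniform_refinement_def by blast
    have R: "card {T'\<in>mesh D (Suc k). T' \<subseteq> T} = 2 ^ CARD('n)"
      "\<And>a. a extreme_point_of closure T \<Longrightarrow> midpoint a ` T \<in> mesh D (Suc k)"
      using refinement(1) T(1) unfolding uniform_refinement_def by blast+
    let ?F = "emap D k T" and ?F' = "emap D (Suc k) T'"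
    note F = coarse.elem[OF T(1)] and F' = fine.elem[OF T']
    obtain q where q: "q \<in> poly_space (kind D) (deg D k)" "\<forall>x\<in>ref_elem (kind D). v (?F x) = q x"
      using v T(1) unfolding V_def by blast
    have "(\<lambda>x. q (inv ?F (?F' x))) \<in> poly_space (kind D) (deg D k)"
    proof (rule poly_space_child[OF F F' _ q(1)])
      assume h: "kind D = Hypercube"
      have "affine_elem Hypercube ?F T" using F h by simp
      then show "\<exists>e. T' = ?F ` (\<lambda>y. (1/2) *\<^sub>R (e + y)) ` box 0 1"
        using hypercube_children[OF _ R T' T(2)] by metis
    qed
    then have poly: "(\<lambda>x. q (inv ?F (?F' x))) \<in> poly_space (kind D) (deg D (Suc k))"
      using poly_space_mono[OF refinement(2)] by blast
    have pullback: "prolong D (Suc k) v (?F' x) = q (inv ?F (?F' x))" if x: "x \<in> ref_elem (kind D)" for x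
    proof -
      have xT': "?F' x \<in> T'" using F' x by (auto simp: affine_elem_def)
      then have "inv ?F (?F' x) \<in> ref_elem (kind D)" using affine_elem_inv(3)[OF F] T(2) by blast
      then have "v (?F (inv ?F (?F' x))) = q (inv ?F (?F' x))" using q(2) by blast
      then have "v (?F' x) = q (inv ?F (?F' x))" by (simp only: affine_elem_inv(1)[OF F])
      moreover have "?F' x \<in> \<Union>(mesh D (Suc k))" using xT' T' by blast
      ultimately show ?thesis by (simp only: prolong_def if_True)
    qed
    show ?thesis by (rule bexI[OF _ poly]) (rule ballI, rule pullback)
  qed
  then show ?thesis
    unfolding V_def by (intro CollectI conjI ballI allI impI) (simp_all only: prolong_def if_False)
qed

lemma prolong_lin: "prolong D (Suc k) (c *\<^sub>R u + v) = c *\<^sub>R prolong D (Suc k) u + prolong D (Suc k) v"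
  by (auto simp: prolong_def fun_eq_iff)

lemma prolong_diff: "prolong D (Suc k) (u - v) = prolong D (Suc k) u - prolong D (Suc k) v"
  by (auto simp: prolong_def fun_eq_iff)

lemma project_spec:
  assumes v: "v \<in> V D (Suc k)"
  shows "project D (Suc k) v \<in> V D k"
    "w \<in> V D k \<Longrightarrow> Aform D k (project D (Suc k) v) w = Aform D (Suc k) v (prolong D (Suc k) w)"
proof -
  have "coarse.a.functional (\<lambda>w. Aform D (Suc k) v (prolong D (Suc k) w))"
    unfolding coarse.a.functional_def using v prolong_in_V by (simp add: prolong_lin fine.a.lin)
  from theI'[OF coarse.a.riesz[OF coarse.finite_basis coarse.V_span this]]
  have "project D (Suc k) v \<in> V D k \<and>
      (\<forall>w\<in>V D k. Aform D k (project D (Suc k) v) w = Aform D (Suc k) v (prolong D (Suc k) w))"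
    unfolding project_def diff_Suc_1 .
  then show "project D (Suc k) v \<in> V D k"
    "w \<in> V D k \<Longrightarrow> Aform D k (project D (Suc k) v) w = Aform D (Suc k) v (prolong D (Suc k) w)" by auto
qed

lemma two_level_eq:
  "two_level D (Suc k) m1 m2 v = (smoother D (Suc k) ^^ m2)
     ((smoother D (Suc k) ^^ m1) v - prolong D (Suc k) (project D (Suc k) ((smoother D (Suc k) ^^ m1) v)))"
  by (simp add: two_level_def Let_def fun_diff_def)

text \<open>The perturbation argument on one level: \<open>\<epsilon>\<close> bounds the coarse operator, \<open>\<delta>\<close> the two-level operator, and \<open>K\<close> the two-level
operator without smoothing.\<close>

lemma wcycle_step:
  assumes E: "\<And>q. q \<in> V D k \<Longrightarrow> wcycle D m1 m2 k q \<in> V D k"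
      "\<And>q. q \<in> V D k \<Longrightarrow> norm1 D k (wcycle D m1 m2 k q) \<le> \<epsilon> * norm1 D k q" "0 \<le> \<epsilon>"
    and two: "\<And>v. v \<in> V D (Suc k) \<Longrightarrow> norm1 D (Suc k) (two_level D (Suc k) m1 m2 v) \<le> \<delta> * norm1 D (Suc k) v"
    and two0: "\<And>v. v \<in> V D (Suc k) \<Longrightarrow> norm1 D (Suc k) (two_level D (Suc k) 0 0 v) \<le> K * norm1 D (Suc k) v"
      "0 \<le> K"
    and v: "v \<in> V D (Suc k)"
  shows "wcycle D m1 m2 (Suc k) v \<in> V D (Suc k)"
    "norm1 D (Suc k) (wcycle D m1 m2 (Suc k) v) \<le> (\<delta> + (1 + K) * \<epsilon>\<^sup>2) * norm1 D (Suc k) v"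
proof -
  define S R P E' w q where "S = smoother D (Suc k)" and "R = prolong D (Suc k)"
    and "P = project D (Suc k)" and "E' = wcycle D m1 m2 k" and "w = (S ^^ m1) v" and "q = P w"
  have w: "w \<in> V D (Suc k)" "fine.a.nrm w \<le> fine.a.nrm v"
    using fine.smoother_pow[OF v] by (simp_all add: w_def S_def)
  have R: "R u \<in> V D (Suc k)" if "u \<in> V D k" for u using prolong_in_V[OF that] by (simp add: R_def)
  have q: "q \<in> V D k" using project_spec(1)[OF w(1)] by (simp add: q_def P_def)
  have EE: "E' (E' q) \<in> V D k" using E(1) q by (simp add: E'_def)
  \<comment> \<open>Without smoothing the two-level operator is \<open>I - R P\<close>.\<close>
  have defect: "fine.a.nrm (u - R (P u)) \<le> K * fine.a.nrm u" if u: "u \<in> V D (Suc k)" for u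
  proof -
    have "u - R (P u) \<in> V D (Suc k)" using R project_spec(1)[OF u] u by (simp add: P_def)
    then show ?thesis
      using two0(1)[OF u] by (simp add: two_level_eq fine.norm1_eq u R_def P_def)
  qed
  have P: "P u \<in> V D k" "x \<in> V D k \<Longrightarrow> Aform D k (P u) x = Aform D (Suc k) u (R x)"
    if "u \<in> V D (Suc k)" for u x
    using project_spec[OF that] by (simp_all add: P_def R_def)
  have transfer: "u \<in> V D (Suc k) \<Longrightarrow> coarse.a.nrm (P u) \<le> sqrt (1 + K) * fine.a.nrm u"
    "x \<in> V D k \<Longrightarrow> fine.a.nrm (R x) \<le> sqrt (1 + K) * coarse.a.nrm x" for u x
    by (rule transfer_bounds[OF coarse.pd_form_Aform fine.pd_form_Aform, of R P]; use R P defect two0(2) in blast)+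
  have "wcycle D m1 m2 (Suc k) v = (S ^^ m2) (w - R (q - E' (E' q)))"
    using coarse.level by (simp add: Let_def S_def R_def P_def E'_def w_def q_def fun_diff_def)
  also have "w - R (q - E' (E' q)) = (w - R q) + R (E' (E' q))"
    by (simp add: R_def prolong_diff)
  also have "(S ^^ m2) \<dots> = (S ^^ m2) (w - R q) + (S ^^ m2) (R (E' (E' q)))"
    unfolding S_def using w R q EE by (intro fine.smoother_pow_add) auto
  also have "(S ^^ m2) (w - R q) = two_level D (Suc k) m1 m2 v"
    by (simp add: two_level_eq S_def R_def P_def w_def q_def)
  finally have split: "wcycle D m1 m2 (Suc k) v = two_level D (Suc k) m1 m2 v + (S ^^ m2) (R (E' (E' q)))" .
  have tl: "two_level D (Suc k) m1 m2 v \<in> V D (Suc k)"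
  proof -
    have "two_level D (Suc k) m1 m2 v = (S ^^ m2) (w - R q)"
      by (simp add: two_level_eq S_def R_def P_def w_def q_def)
    moreover have "(S ^^ m2) (w - R q) \<in> V D (Suc k)"
      unfolding S_def using w(1) R[OF q] by (intro fine.smoother_pow(1) fine.a.mem(5))
    ultimately show ?thesis by (simp only:)
  qed
  have cg: "(S ^^ m2) (R (E' (E' q))) \<in> V D (Suc k)"
    unfolding S_def using R[OF EE] by (rule fine.smoother_pow)
  show in_V: "wcycle D m1 m2 (Suc k) v \<in> V D (Suc k)" unfolding split using tl cg by simp
  have E'': "coarse.a.nrm (E' u) \<le> \<epsilon> * coarse.a.nrm u" if "u \<in> V D k" for u
    using E(2)[OF that] coarse.norm1_eq[OF that] coarse.norm1_eq[OF E(1)[OF that]] by (simp add: E'_def)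
  have "fine.a.nrm ((S ^^ m2) (R (E' (E' q)))) \<le> fine.a.nrm (R (E' (E' q)))"
    unfolding S_def using R[OF EE] by (rule fine.smoother_pow)
  also have "\<dots> \<le> sqrt (1 + K) * coarse.a.nrm (E' (E' q))"
    by (rule transfer(2)[OF EE])
  also have "coarse.a.nrm (E' (E' q)) \<le> \<epsilon> * (\<epsilon> * coarse.a.nrm q)"
    using E''[of "E' q"] E''[OF q] E(1)[OF q] mult_left_mono[OF E''[OF q] E(3)] by (simp add: E'_def)
  also have "coarse.a.nrm q \<le> sqrt (1 + K) * fine.a.nrm w"
    unfolding q_def by (rule transfer(1)[OF w(1)])
  also note w(2)
  finally have "fine.a.nrm ((S ^^ m2) (R (E' (E' q)))) \<le> sqrt (1 + K) * (\<epsilon> * (\<epsilon> * (sqrt (1 + K) * fine.a.nrm v)))"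
    using E(3) two0(2) by (simp add: mult_left_mono)
  also have "\<dots> = (1 + K) * \<epsilon>\<^sup>2 * fine.a.nrm v"
    using two0(2) by (simp add: power2_eq_square)
  finally have cgb: "fine.a.nrm ((S ^^ m2) (R (E' (E' q)))) \<le> (1 + K) * \<epsilon>\<^sup>2 * fine.a.nrm v" .
  have "fine.a.nrm (wcycle D m1 m2 (Suc k) v)
      \<le> fine.a.nrm (two_level D (Suc k) m1 m2 v) + fine.a.nrm ((S ^^ m2) (R (E' (E' q))))"
    unfolding split by (rule fine.a.nrm_add_le[OF tl cg])
  also have "\<dots> \<le> \<delta> * fine.a.nrm v + (1 + K) * \<epsilon>\<^sup>2 * fine.a.nrm v"
    using two[OF v] cgb by (intro add_mono) (simp_all add: fine.norm1_eq v tl)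
  finally show "norm1 D (Suc k) (wcycle D m1 m2 (Suc k) v) \<le> (\<delta> + (1 + K) * \<epsilon>\<^sup>2) * norm1 D (Suc k) v"
    by (simp only: fine.norm1_eq[OF in_V] fine.norm1_eq[OF v] distrib_right)
qed

end

section \<open>Convergence of the W-cycle\<close>

text \<open>Chosen so that \<open>m1 + m2\<close> above the threshold makes \<open>sqrt (m1 + m2)\<close> at least \<open>(1 + K) (c + 1)\<^sup>2 p\<^bsup>2+\<mu>\<^esup>\<close>, with
\<open>K = c p\<^bsup>2+\<mu>\<^esup>\<close>.\<close>

definition smoothing_threshold :: "nat \<Rightarrow> real \<Rightarrow> nat \<Rightarrow> nat" where
  "smoothing_threshold \<mu> c p =
     nat \<lceil>((1 + c * real p ^ (2 + \<mu>)) * (c + 1)\<^sup>2 * real p ^ (2 + \<mu>))\<^sup>2\<rceil>"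

lemma smoothing_threshold_mono:
  assumes "0 < c" "p \<le> p'"
  shows "smoothing_threshold \<mu> c p \<le> smoothing_threshold \<mu> c p'"
proof -
  have "real p ^ (2 + \<mu>) \<le> real p' ^ (2 + \<mu>)" using assms by (intro power_mono) auto
  then show ?thesis unfolding smoothing_threshold_def using assms
    by (intro nat_mono ceiling_mono power_mono mult_mono add_mono mult_nonneg_nonneg add_nonneg_nonneg) auto
qed

lemma Sigma_k_nonneg: "0 \<le> Sigma_k \<mu> D k m1 m2"
  by (simp add: Sigma_k_def)

text \<open>Since \<open>(1 + m1) (1 + m2) \<ge> m1 + m2\<close>, the sum of the numbers of steps controls the denominator of \<open>\<Sigma>\<^sub>k\<close>, however the steps
are distributed.\<close>

lemma coarse_term_absorbed:
  assumes c: "0 < c" and m: "smoothing_threshold \<mu> c (deg D k) \<le> m1 + m2"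
  shows "(1 + c * real (deg D k) ^ (2 + \<mu>)) * (c + 1)\<^sup>2 * Sigma_k \<mu> D k m1 m2 \<le> 1"
proof -
  define s where "s = real (deg D k) ^ (2 + \<mu>)"
  define r where "r = sqrt (1 + real m1) * sqrt (1 + real m2)"
  have r: "r > 0" by (simp add: r_def)
  have "((1 + c * s) * (c + 1)\<^sup>2 * s)\<^sup>2 \<le> real (smoothing_threshold \<mu> c (deg D k))"
    unfolding smoothing_threshold_def s_def by (rule real_nat_ceiling_ge)
  also have "\<dots> \<le> real (m1 + m2)" using m by simp
  also have "\<dots> \<le> r\<^sup>2" by (simp add: r_def power_mult_distrib algebra_simps)
  finally have "(1 + c * s) * (c + 1)\<^sup>2 * s \<le> r" using less_imp_le[OF r] by (rule power2_le_imp_le)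
  then have "(1 + c * s) * (c + 1)\<^sup>2 * s / r \<le> 1" using r by (simp only: pos_divide_le_eq mult_1)
  moreover have "Sigma_k \<mu> D k m1 m2 = s / r" by (simp only: Sigma_k_def s_def r_def)
  ultimately show ?thesis by (simp only: s_def times_divide_eq_right)
qed

theorem theorem4p7:
  fixes \<Omega> :: "(real^'n::finite) set"
    and \<D> :: "'n disc set"
    and S :: "real set"
    and \<mu> :: nat
    and C2lvl :: real
  assumes dim: "CARD('n) \<in> {2, 3}"
    and dom: "polyhedral_domain \<Omega>"
    and disc: "\<forall>D\<in>\<D>. discretization \<Omega> D"
    and unif: "uniform_family \<D>"
    and S: "1 \<in> S" "\<forall>s\<in>S. 1 \<le> s"
    and reg: "\<forall>s\<in>S. elliptic_regularity \<Omega> s"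
    and mu: "\<mu> \<in> {0, 1}"
    and err: "\<forall>s\<in>S. dg_error_estimate \<mu> \<D> s"
    and C2lvl: "0 < C2lvl"
    and two_level: "\<forall>D\<in>\<D>. \<forall>k\<in>{2..levels D}. \<forall>m1 m2. \<forall>v\<in>V D k.
      norm1 D k (two_level D k m1 m2 v) \<le> C2lvl * Sigma_k \<mu> D k m1 m2 * norm1 D k v"
  shows "\<exists>(C::real) (m :: nat \<Rightarrow> nat). C2lvl < C \<and>
    (\<forall>D\<in>\<D>. \<forall>k\<in>{1..levels D}. \<forall>m1 m2. m (deg D k) \<le> m1 + m2 \<longrightarrow>
      (\<forall>v\<in>V D k. norm1 D k (wcycle D m1 m2 k v) \<le> C * Sigma_k \<mu> D k m1 m2 * norm1 D k v))"
proof -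
  define m where "m = smoothing_threshold \<mu> C2lvl"
  have err1: "dg_error_estimate \<mu> \<D> 1" using err S(1) by (rule bspec)
  have spd: "dg_spd \<Omega> D k" if "D \<in> \<D>" "1 \<le> k" "k \<le> levels D" for D k
    by (rule dg_spd_if_uniform_family[OF dom disc unif err1 that])
  have main: "wcycle D m1 m2 k v \<in> V D k \<and>
      norm1 D k (wcycle D m1 m2 k v) \<le> (C2lvl + 1) * Sigma_k \<mu> D k m1 m2 * norm1 D k v"
    if D: "D \<in> \<D>" and "1 \<le> k" "k \<le> levels D" "m (deg D k) \<le> m1 + m2" "v \<in> V D k" for D k m1 m2 v
    using that(2-)
  proof (induction k arbitrary: v rule: nat_induct_at_least)
    case base
    interpret dg_spd \<Omega> D 1 using spd[OF D] base by simp
    have 0: "wcycle D m1 m2 1 v = 0" by (simp add: fun_eq_iff)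
    have "norm1 D 1 0 = 0" by (rule norm1_zero)
    moreover have "0 \<le> norm1 D 1 v"
      using norm1_eq[of v] a.nrm_nonneg[of v] base by simp
    ultimately have "norm1 D 1 0 \<le> (C2lvl + 1) * Sigma_k \<mu> D 1 m1 m2 * norm1 D 1 v"
      using C2lvl Sigma_k_nonneg[of \<mu> D 1 m1 m2] by simp
    then show ?case unfolding 0 by (rule conjI[OF a.mem(1)])
  next
    case (Suc k)
    interpret two_levels \<Omega> D k
      unfolding two_levels_def using spd[OF D, of k] spd[OF D, of "Suc k"] Suc by auto
    define p where "p = real (deg D (Suc k)) ^ (2 + \<mu>)"
    define s s' where "s = Sigma_k \<mu> D (Suc k) m1 m2" and "s' = Sigma_k \<mu> D k m1 m2"
    have k: "Suc k \<in> {2..levels D}" using Suc by auto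
    have mk: "m (deg D k) \<le> m1 + m2"
      unfolding m_def
      by (rule order_trans[OF smoothing_threshold_mono[OF C2lvl refinement(2)] Suc.prems(2)[unfolded m_def]])
    have IH: "wcycle D m1 m2 k q \<in> V D k"
        "norm1 D k (wcycle D m1 m2 k q) \<le> (C2lvl + 1) * s' * norm1 D k q" if "q \<in> V D k" for q
      using Suc.IH[OF Suc_leD[OF Suc.prems(1)] mk that] by (simp_all only: s'_def)
    have s: "0 \<le> s'" "s' \<le> s"
      using power_mono[of "real (deg D k)" "real (deg D (Suc k))" "2 + \<mu>"] refinement(2)
      by (auto simp: s_def s'_def Sigma_k_def intro!: divide_right_mono)
    have tl: "norm1 D (Suc k) (Defs.two_level D (Suc k) i j u) \<le> C2lvl * Sigma_k \<mu> D (Suc k) i j * norm1 D (Suc k) u"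
      if "u \<in> V D (Suc k)" for i j u using two_level D k that by blast
    have tl0: "norm1 D (Suc k) (Defs.two_level D (Suc k) 0 0 u) \<le> (C2lvl * p) * norm1 D (Suc k) u"
      if "u \<in> V D (Suc k)" for u using tl[OF that, of 0 0] by (simp add: Sigma_k_def p_def)
    \<comment> \<open>With \<open>m1 = m2 = 0\<close> the factor \<open>\<Sigma>\<^sub>k\<close> is \<open>p\<close>, so \<open>C2lvl * p\<close> is the constant \<open>K\<close> of the stability bound.\<close>
    note step = wcycle_step[of m1 m2 "(C2lvl + 1) * s'" "C2lvl * s" "C2lvl * p" v, OF IH _ _ tl0]
    have in_V: "wcycle D m1 m2 (Suc k) v \<in> V D (Suc k)"
      and bound: "norm1 D (Suc k) (wcycle D m1 m2 (Suc k) v)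
        \<le> (C2lvl * s + (1 + C2lvl * p) * ((C2lvl + 1) * s')\<^sup>2) * norm1 D (Suc k) v"
      using step tl[of _ m1 m2] s C2lvl Suc.prems(3) by (simp_all add: s_def p_def)
    have "C2lvl * s + (1 + C2lvl * p) * ((C2lvl + 1) * s')\<^sup>2 \<le> (C2lvl + 1) * s"
    proof -
      have "(1 + C2lvl * p) * ((C2lvl + 1) * s')\<^sup>2 \<le> (1 + C2lvl * p) * ((C2lvl + 1) * s)\<^sup>2"
        using s C2lvl by (intro mult_left_mono power_mono) (auto simp: p_def)
      also have "\<dots> = ((1 + C2lvl * p) * (C2lvl + 1)\<^sup>2 * s) * s" by (simp add: power2_eq_square)
      also have "\<dots> \<le> 1 * s"
        using coarse_term_absorbed[OF C2lvl, of \<mu> D "Suc k" m1 m2] Suc.prems(2) s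
        by (intro mult_right_mono) (auto simp: m_def s_def p_def)
      finally show ?thesis by (simp add: distrib_right)
    qed
    from mult_right_mono[OF this]
    have "(C2lvl * s + (1 + C2lvl * p) * ((C2lvl + 1) * s')\<^sup>2) * norm1 D (Suc k) v
        \<le> (C2lvl + 1) * s * norm1 D (Suc k) v"
      using Suc.prems(3) by (simp add: fine.norm1_eq fine.a.nrm_nonneg)
    with bound have "norm1 D (Suc k) (wcycle D m1 m2 (Suc k) v) \<le> (C2lvl + 1) * s * norm1 D (Suc k) v"
      by (rule order_trans)
    then show ?case unfolding s_def by (rule conjI[OF in_V])
  qed
  show ?thesis
  proof (rule exI[of _ "C2lvl + 1"], rule exI[of _ m], intro conjI ballI allI impI)
    show "C2lvl < C2lvl + 1" by simp
    show "norm1 D k (wcycle D m1 m2 k v) \<le> (C2lvl + 1) * Sigma_k \<mu> D k m1 m2 * norm1 D k v"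
      if "D \<in> \<D>" "k \<in> {1..levels D}" "m (deg D k) \<le> m1 + m2" "v \<in> V D k" for D k m1 m2 v
    proof -
      have "1 \<le> k" "k \<le> levels D" using that(2) by simp_all
      from main[OF that(1) this that(3,4)] show ?thesis by (rule conjunct2)
    qed
  qed
qed

end
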